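(* Let $\Omega\subset\mathbb R^N$ be Lebesgue measurable, $a\in\mathbb R$, $1<q<\infty$, $q'$ the conjugate exponent of $q$, and let $\Phi$ be a convex Orlicz function satisfying the condition $\Delta_2$ suitable to the measure $\mu$. Let $\mathcal X=\left(\left(L^\Phi(\Omega_k),\|\cdot\|_\Phi\right)\right)_{k\in I}$, $\mathcal X'=\left(\left(L^{\Phi^*}(\Omega_k),\|\cdot\|^O_{\Phi^*}\right)\right)_{k\in I}$ and $E=l_q(2^{ak})$, so that $E'=l_{q'}(2^{-ak})$. Then $$\left(HO^\Phi_{a,q},\|\cdot\|_{HO^\Phi_{a,q}}\right)^*=\left(HO^\Phi_{a,q},\|\cdot\|_{HO^\Phi_{a,q}}\right)'=\left(HO^{\Phi^*}_{-a,q'},\|\cdot\|_{E'(\mathcal X')}\right)$$ with equivalent norms. Furthermore, in this case the Hölder type inequality holds: for all $f\in E(\mathcal X)$ and $g\in E'(\mathcal X')$, $fg\in L^1(\Omega)$ and $\int_\Omega|fg|\,d\mu\le\|f\|_{E(\mathcal X)}\|g\|_{E'(\mathcal X')}$.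
   Context: $\mu$ is Lebesgue measure. An Orlicz function is a non-decreasing $\Phi:[0,\infty)\to[0,\infty)$ vanishing and right continuous at $0$, continuous on $(0,\infty)$, with $\lim_{u\to\infty}\Phi(u)=\infty$. $I_\Phi(f)=\int\Phi(|f|)\,d\mu$, $L^\Phi=\{f\in L^0:I_\Phi(sf)<\infty\text{ for some }s>0\}$, $\|f\|_\Phi=\inf\{\lambda>0:I_\Phi(f/\lambda)\le1\}$. $\Phi$ satisfies $\Delta_2$ for all (large) arguments if there is $K$ (and $u_0$) with $\Phi(2u)\le K\Phi(u)$ for all $u\ge0$ ($u\ge u_0$); "$\Delta_2$ suitable to $\mu$" means $\Delta_2$ for all arguments if $\mu(\Omega)=\infty$, and for large arguments if $\mu(\Omega)<\infty$. The complementary function is $\Phi^*(u)=\sup_{v\ge0}\{uv-\Phi(v)\}$ and the Orlicz norm is $\|f\|^O_{\Phi^*}=\sup\{\int fg\,d\mu:I_\Phi(g)\le1\}$. Let $I=\{-1,0,1,2,\dots\}$, $\Omega_{-1}=\{\omega\in\Omega:|\omega|<1/2\}$, $\Omega_k=\{\omega\in\Omega:2^{k-1}\le|\omega|<2^k\}$ for $k\ge0$ (local spaces assumed non-trivial). $l_q(2^{ak})$ is the space of sequences on $I$ with norm $\left(\sum_k2^{akq}|x_k|^q\right)^{1/q}$. For ideal spaces $X_k$ over $\Omega_k$, $E(\mathcal X)=\{f\in L^0(\Omega):f\chi_{\Omega_k}\in X_k\ \forall k,\ (\|f\chi_{\Omega_k}\|_{X_k})_k\in E\}$, $\|f\|_{E(\mathcal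 X)}=\|(\|f\chi_{\Omega_k}\|_{X_k})_k\|_E$. The Orlicz-Herz space $HO^\Phi_{a,q}$ is $E(\mathcal X)$ for $E=l_q(2^{ak})$, $X_k=(L^\Phi(\Omega_k),\|\cdot\|_\Phi)$. $X^*$ is the topological dual; the Köthe dual is $X'=\{g\in L^0:\|g\|_{X'}=\sup_{\|f\|_X\le1}\int|fg|\,d\mu<\infty\}$; $X^*$ is identified with functions $g$ through $f\mapsto\int fg\,d\mu$. *)

theory Defs
  imports "HOL-Analysis.Analysis" "HOL-Library.FuncSet"
begin

text \<open>
  Elements of \<open>L\<^sup>0\<close> over a measure space are represented by real-valued measurable functions;
  functions that agree almost everywhere are not literally identified. A function space is a
  set of such functions together with a norm, whose values are meaningful on that set only.
\<close>

record 'a fspace =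
  elems :: "('a \<Rightarrow> real) set"
  fnorm :: "('a \<Rightarrow> real) \<Rightarrow> real"

definition equivalent_norms_on ::
  "('a \<Rightarrow> real) set \<Rightarrow> (('a \<Rightarrow> real) \<Rightarrow> real) \<Rightarrow> (('a \<Rightarrow> real) \<Rightarrow> real) \<Rightarrow> bool" where
  "equivalent_norms_on S n1 n2 \<longleftrightarrow>
     (\<exists>c>0. \<exists>C>0. \<forall>f\<in>S. c * n1 f \<le> n2 f \<and> n2 f \<le> C * n1 f)"

definition eq_equivalent_norms :: "'a fspace \<Rightarrow> 'a fspace \<Rightarrow> bool" where
  "eq_equivalent_norms X Y \<longleftrightarrow>
     elems X = elems Y \<and> equivalent_norms_on (elems X) (fnorm X) (fnorm Y)"

definition eq_equal_norms :: "'a fspace \<Rightarrow> 'a fspace \<Rightarrow> bool" where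
  "eq_equal_norms X Y \<longleftrightarrow> elems X = elems Y \<and> (\<forall>f\<in>elems X. fnorm X f = fnorm Y f)"


subsection \<open>Orlicz functions and Orlicz spaces\<close>

definition orlicz_function :: "(real \<Rightarrow> real) \<Rightarrow> bool" where
  "orlicz_function \<Phi> \<longleftrightarrow>
     (\<forall>u\<ge>0. 0 \<le> \<Phi> u) \<and> mono_on {0..} \<Phi> \<and> \<Phi> 0 = 0 \<and> continuous (at_right 0) \<Phi> \<and>
     continuous_on {0<..} \<Phi> \<and> filterlim \<Phi> at_top at_top"

definition delta2_all :: "(real \<Rightarrow> real) \<Rightarrow> bool" where
  "delta2_all \<Phi> \<longleftrightarrow> (\<exists>K. \<forall>u\<ge>0. \<Phi> (2 * u) \<le> K * \<Phi> u)"

definition delta2_large :: "(real \<Rightarrow> real) \<Rightarrow> bool" where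
  "delta2_large \<Phi> \<longleftrightarrow> (\<exists>K. \<exists>u0\<ge>0. \<forall>u\<ge>u0. \<Phi> (2 * u) \<le> K * \<Phi> u)"

definition delta2_suitable :: "'a measure \<Rightarrow> (real \<Rightarrow> real) \<Rightarrow> bool" where
  "delta2_suitable M \<Phi> \<longleftrightarrow>
     (if emeasure M (space M) = \<infinity> then delta2_all \<Phi> else delta2_large \<Phi>)"

text \<open>
  The complementary function may take the value \<open>\<infinity>\<close> (e.g. for \<open>\<Phi> u = u\<close>). The truncation
  of negative numbers by \<^const>\<open>ennreal\<close> does not affect the supremum, as \<open>v = 0\<close> contributes
  the value \<open>0\<close> when \<open>\<Phi> 0 = 0\<close>.
\<close>

definition complementary :: "(real \<Rightarrow> real) \<Rightarrow> real \<Rightarrow> ennreal" where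
  "complementary \<Phi> u = (SUP v\<in>{0..}. ennreal (u * v - \<Phi> v))"

definition modular :: "'a measure \<Rightarrow> (real \<Rightarrow> ennreal) \<Rightarrow> ('a \<Rightarrow> real) \<Rightarrow> ennreal" where
  "modular M \<Phi> f = (\<integral>\<^sup>+\<omega>. \<Phi> \<bar>f \<omega>\<bar> \<partial>M)"

definition luxemburg_norm :: "'a measure \<Rightarrow> (real \<Rightarrow> ennreal) \<Rightarrow> ('a \<Rightarrow> real) \<Rightarrow> real" where
  "luxemburg_norm M \<Phi> f = Inf {l. l > 0 \<and> modular M \<Phi> (\<lambda>\<omega>. f \<omega> / l) \<le> 1}"

definition orlicz_space :: "'a measure \<Rightarrow> (real \<Rightarrow> ennreal) \<Rightarrow> 'a fspace" where
  "orlicz_space M \<Phi> =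
     \<lparr> elems = {f \<in> borel_measurable M. \<exists>s>0. modular M \<Phi> (\<lambda>\<omega>. s * f \<omega>) < \<infinity>},
       fnorm = luxemburg_norm M \<Phi> \<rparr>"

text \<open>
  This is the Orlicz norm of the space of the complementary function of \<open>\<Phi>\<close>. For \<open>f\<close> in that
  space, \<open>f g\<close> is integrable and the supremum is finite by Young's inequality.
\<close>

definition orlicz_norm_complementary ::
  "'a measure \<Rightarrow> (real \<Rightarrow> real) \<Rightarrow> ('a \<Rightarrow> real) \<Rightarrow> real" where
  "orlicz_norm_complementary M \<Phi> f =
     (SUP g\<in>{g \<in> borel_measurable M. modular M (ennreal \<circ> \<Phi>) g \<le> 1}. \<integral>\<omega>. f \<omega> * g \<omega> \<partial>M)"

definition complementary_orlicz_space :: "'a measure \<Rightarrow> (real \<Rightarrow> real) \<Rightarrow> 'a fspace" where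
  "complementary_orlicz_space M \<Phi> =
     \<lparr> elems = elems (orlicz_space M (complementary \<Phi>)),
       fnorm = orlicz_norm_complementary M \<Phi> \<rparr>"


subsection \<open>Herz-type spaces\<close>

definition herz_index :: "int set" where
  "herz_index = {-1..}"

definition shell :: "(real ^ 'n) set \<Rightarrow> int \<Rightarrow> (real ^ 'n) set" where
  "shell \<Omega> k =
     (if k = -1 then {\<omega> \<in> \<Omega>. norm \<omega> < 1 / 2}
      else {\<omega> \<in> \<Omega>. 2 powi (k - 1) \<le> norm \<omega> \<and> norm \<omega> < 2 powi k})"

definition weighted_lq :: "real \<Rightarrow> real \<Rightarrow> int fspace" where
  "weighted_lq q a =
     \<lparr> elems = {x. (\<lambda>k. 2 powr (a * of_int k * q) * \<bar>x k\<bar> powr q) summable_on herz_index},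
       fnorm = (\<lambda>x. (\<Sum>\<^sub>\<infinity>k\<in>herz_index. 2 powr (a * of_int k * q) * \<bar>x k\<bar> powr q) powr (1 / q)) \<rparr>"

definition herz_type_space ::
  "(real ^ 'n) set \<Rightarrow> int fspace \<Rightarrow> (int \<Rightarrow> (real ^ 'n) fspace) \<Rightarrow> (real ^ 'n) fspace" where
  "herz_type_space \<Omega> E X =
     \<lparr> elems = {f \<in> borel_measurable (lebesgue_on \<Omega>).
         (\<forall>k\<in>herz_index. (\<lambda>\<omega>. f \<omega> * indicator (shell \<Omega> k) \<omega>) \<in> elems (X k)) \<and>
         (\<lambda>k. fnorm (X k) (\<lambda>\<omega>. f \<omega> * indicator (shell \<Omega> k) \<omega>)) \<in> elems E},
       fnorm = (\<lambda>f. fnorm E (\<lambda>k. fnorm (X k) (\<lambda>\<omega>. f \<omega> * indicator (shell \<Omega> k) \<omega>))) \<rparr>"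

definition orlicz_herz ::
  "(real ^ 'n) set \<Rightarrow> (real \<Rightarrow> ennreal) \<Rightarrow> real \<Rightarrow> real \<Rightarrow> (real ^ 'n) fspace" where
  "orlicz_herz \<Omega> \<Phi> a q =
     herz_type_space \<Omega> (weighted_lq q a) (\<lambda>k. orlicz_space (lebesgue_on (shell \<Omega> k)) \<Phi>)"


subsection \<open>Koethe dual and topological dual\<close>

definition kothe_norm :: "'a measure \<Rightarrow> 'a fspace \<Rightarrow> ('a \<Rightarrow> real) \<Rightarrow> ennreal" where
  "kothe_norm M X g =
     (SUP f\<in>{f \<in> elems X. fnorm X f \<le> 1}. \<integral>\<^sup>+\<omega>. ennreal \<bar>f \<omega> * g \<omega>\<bar> \<partial>M)"

definition kothe_dual :: "'a measure \<Rightarrow> 'a fspace \<Rightarrow> 'a fspace" where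
  "kothe_dual M X =
     \<lparr> elems = {g \<in> borel_measurable M. kothe_norm M X g < \<infinity>},
       fnorm = (\<lambda>g. enn2real (kothe_norm M X g)) \<rparr>"

text \<open>
  A functional is a function on \<^term>\<open>elems X\<close>, made unique by extensionality. Continuity with
  respect to the (semi)norm forces it to respect almost-everywhere equality.
\<close>

definition top_dual :: "'a fspace \<Rightarrow> (('a \<Rightarrow> real) \<Rightarrow> real) set" where
  "top_dual X = {T \<in> extensional (elems X).
     (\<forall>f\<in>elems X. \<forall>g\<in>elems X. T (\<lambda>\<omega>. f \<omega> + g \<omega>) = T f + T g) \<and>
     (\<forall>c. \<forall>f\<in>elems X. T (\<lambda>\<omega>. c * f \<omega>) = c * T f) \<and>
     (\<forall>f\<in>elems X. \<forall>e>0. \<exists>d>0. \<forall>g\<in>elems X.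
        fnorm X (\<lambda>\<omega>. g \<omega> - f \<omega>) < d \<longrightarrow> \<bar>T g - T f\<bar> < e)}"

definition dual_norm :: "'a fspace \<Rightarrow> (('a \<Rightarrow> real) \<Rightarrow> real) \<Rightarrow> real" where
  "dual_norm X T = (SUP f\<in>{f \<in> elems X. fnorm X f \<le> 1}. \<bar>T f\<bar>)"

definition pairing :: "'a measure \<Rightarrow> 'a fspace \<Rightarrow> ('a \<Rightarrow> real) \<Rightarrow> ('a \<Rightarrow> real) \<Rightarrow> real" where
  "pairing M X g = restrict (\<lambda>f. \<integral>\<omega>. f \<omega> * g \<omega> \<partial>M) (elems X)"

text \<open>
  \<open>X\<^sup>* = Y\<close> with equivalent norms: \<open>g \<mapsto> (f \<mapsto> \<integral> f g)\<close> is a well-defined bijection from \<open>Y\<close>,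
  modulo almost-everywhere equality, onto the topological dual of \<open>X\<close>, and the dual norm is
  equivalent to the norm of \<open>Y\<close>.
\<close>

definition top_dual_identified :: "'a measure \<Rightarrow> 'a fspace \<Rightarrow> 'a fspace \<Rightarrow> bool" where
  "top_dual_identified M X Y \<longleftrightarrow>
     (\<forall>f\<in>elems X. \<forall>g\<in>elems Y. integrable M (\<lambda>\<omega>. f \<omega> * g \<omega>)) \<and>
     pairing M X ` elems Y = top_dual X \<and>
     (\<forall>g\<in>elems Y. \<forall>h\<in>elems Y. pairing M X g = pairing M X h \<longleftrightarrow> (AE \<omega> in M. g \<omega> = h \<omega>)) \<and>
     equivalent_norms_on (elems Y) (fnorm Y) (\<lambda>g. dual_norm X (pairing M X g))"

end

theory Submission
  imports Defs
begin

text \<open>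
  The space \<open>HO\<close> is the \<open>l\<^sub>q\<close>-sum, with weights \<open>2\<^bsup>ak\<^esup>\<close>, of the Orlicz spaces over the shells of \<open>\<Omega>\<close>.
  Two things have to be shown: its Koethe dual is the corresponding sum of the dual spaces, and
  every continuous functional is integration against an element of the Koethe dual.

  The Koethe dual is computed isometrically. Hoelder's inequality on each shell, between the
  Luxemburg norm and the Orlicz norm (\<open>orlicz_Holder\<close>), combines with Hoelder's inequality for
  sequences to the inequality on \<open>\<Omega>\<close> (\<open>HO_Holder\<close>). Hence \<open>E'(X')\<close>, denoted by \<open>HO'\<close>, is contained in
  the Koethe dual, whose norm is at most that of \<open>HO'\<close>. Conversely, a function \<open>g\<close> of finite Koethe norm is tested against
  \<open>\<Sum>k\<in>F. x\<^sub>k h\<^sub>k\<close> where \<open>h\<^sub>k\<close> lives on the \<open>k\<close>-th shell, has modular at most \<open>1\<close>, and nearly attains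
  the Orlicz norm of \<open>g\<close> there; the extremal choice of \<open>x\<close> in Hoelder's inequality for sequences
  shows that the Koethe norm dominates the norm of \<open>E'(X')\<close> (\<open>kothe_dual_HO_subset\<close>). For this, \<open>g\<close>
  must first be known to lie in \<open>L\<^bsup>\<Phi>*\<^esup>\<close> on each shell. That is the content of
  \<open>complementary_modular_le_1\<close>: if \<open>\<integral>\<bar>f g\<bar> \<le> c\<close> for all \<open>f\<close> of modular at most \<open>1\<close>, then \<open>g / c\<close> has
  \<open>\<Phi>*\<close>-modular at most \<open>1\<close>. The same lemma shows that the Luxemburg norm of \<open>L\<^bsup>\<Phi>*\<^esup>\<close> is at most the
  Orlicz norm, which in turn is at most twice the Luxemburg norm by Young's inequality. So it does
  not matter which of the two norms defines the elements of the dual Orlicz-Herz space.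

  For the topological dual, the condition \<open>\<Delta>\<^sub>2\<close> makes all modulars of an element of \<open>L\<^bsup>\<Phi>\<^esup>\<close> finite.
  Dominated convergence then holds in norm, first on each shell and then in \<open>HO\<close>. Every shell has
  finite measure, so that in both cases of the suitable \<open>\<Delta>\<^sub>2\<close> condition it is the estimate for
  large arguments that is applied. In a function space with this property, fix a strictly positive
  element \<open>w\<close>. For a continuous functional \<open>T\<close> the set function \<open>A \<mapsto> T (1\<^sub>A w)\<close> is a finite signed
  measure that vanishes on null sets. If \<open>h\<close> is its Radon-Nikodym density, then \<open>h / w\<close> represents
  \<open>T\<close>, first on products of \<open>w\<close> with simple functions and, by dominated convergence, everywhere
  (\<open>top_dual_representation\<close>).
\<close>

section \<open>Weighted sequence spaces and their Koethe duals\<close>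

lemma conjugate_exponent_gt_1:
  fixes p q :: real
  assumes "1 < p" "1 / p + 1 / q = 1"
  shows "1 < q"
proof -
  have "1 / q = 1 - 1 / p" "0 < 1 - 1 / p" "1 - 1 / p < 1"
    using assms by (auto simp: field_simps)
  then have "0 < 1 / q" "1 / q < 1" by simp_all
  then show ?thesis by (simp add: field_simps)
qed

lemma Holder_sum:
  fixes a b :: "'i \<Rightarrow> real"
  assumes "finite F" and pq: "1 < p" "1 < q" "1 / p + 1 / q = 1"
    and nn: "\<And>k. k \<in> F \<Longrightarrow> 0 \<le> a k" "\<And>k. k \<in> F \<Longrightarrow> 0 \<le> b k"
  shows "(\<Sum>k\<in>F. a k * b k) \<le> (\<Sum>k\<in>F. a k powr p) powr (1 / p) * (\<Sum>k\<in>F. b k powr q) powr (1 / q)"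
proof -
  define A where "A = (\<Sum>k\<in>F. a k powr p) powr (1 / p)"
  define B where "B = (\<Sum>k\<in>F. b k powr q) powr (1 / q)"
  have Ap: "A powr p = (\<Sum>k\<in>F. a k powr p)" and Bq: "B powr q = (\<Sum>k\<in>F. b k powr q)"
    using pq by (auto simp: A_def B_def powr_powr sum_nonneg)
  show ?thesis
  proof (cases "A = 0 \<or> B = 0")
    case True
    then have "(\<Sum>k\<in>F. a k powr p) = 0 \<or> (\<Sum>k\<in>F. b k powr q) = 0"
      by (auto simp: A_def B_def)
    then have "\<forall>k\<in>F. a k * b k = 0"
      using \<open>finite F\<close> by (auto simp: sum_nonneg_eq_0_iff)
    then have "(\<Sum>k\<in>F. a k * b k) = 0" by (simp add: sum.neutral)
    then show ?thesis by (simp add: sum_nonneg)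
  next
    case False
    then have pos: "A > 0" "B > 0" by (auto simp: A_def B_def)
    have "(\<Sum>k\<in>F. (a k / A) * (b k / B)) \<le> (\<Sum>k\<in>F. (a k / A) powr p / p + (b k / B) powr q / q)"
      using pq nn pos by (intro sum_mono Youngs_inequality) auto
    also have "\<dots> = (\<Sum>k\<in>F. a k powr p / A powr p / p) + (\<Sum>k\<in>F. b k powr q / B powr q / q)"
      using nn pos by (simp add: sum.distrib powr_divide)
    also have "\<dots> = (\<Sum>k\<in>F. a k powr p) / A powr p / p + (\<Sum>k\<in>F. b k powr q) / B powr q / q"
      by (simp add: sum_divide_distrib)
    also have "\<dots> = 1"
      using pos pq by (simp add: Ap[symmetric] Bq[symmetric])
    finally have "(\<Sum>k\<in>F. a k * b k) / (A * B) \<le> 1"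
      by (simp add: sum_divide_distrib)
    then show ?thesis
      using pos by (simp add: A_def[symmetric] B_def[symmetric] field_simps)
  qed
qed

text \<open>
  The test sequence is the one for which equality holds in Hoelder's inequality: the power
  \<open>b\<^bsup>q-1\<^esup>\<close>, normalised in \<open>l\<^sub>p\<close>.
\<close>

lemma Holder_sum_converse:
  fixes b :: "'i \<Rightarrow> real"
  assumes "finite F" and pq: "1 < p" "1 < q" "1 / p + 1 / q = 1"
    and nn: "\<And>k. k \<in> F \<Longrightarrow> 0 \<le> b k" and "0 \<le> C"
    and le: "\<And>x. (\<And>k. 0 \<le> x k) \<Longrightarrow> (\<Sum>k\<in>F. x k powr p) \<le> 1 \<Longrightarrow> (\<Sum>k\<in>F. x k * b k) \<le> C"
  shows "(\<Sum>k\<in>F. b k powr q) \<le> C powr q"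
proof -
  define S where "S = (\<Sum>k\<in>F. b k powr q)"
  have S0: "0 \<le> S" by (simp add: S_def sum_nonneg)
  show ?thesis
  proof (cases "S = 0")
    case True then show ?thesis by (simp add: S_def)
  next
    case False
    with S0 have S: "S > 0" by simp
    have qp: "(q - 1) * p = q" using pq by (simp add: field_simps)
    define x where "x k = b k powr (q - 1) / S powr (1 / p)" for k
    have "(\<Sum>k\<in>F. x k powr p) = (\<Sum>k\<in>F. b k powr q / S)"
      using S pq by (intro sum.cong) (auto simp: x_def powr_divide powr_powr qp)
    also have "\<dots> = 1" using S by (simp add: sum_divide_distrib[symmetric] S_def[symmetric])
    finally have "(\<Sum>k\<in>F. x k * b k) \<le> C" by (intro le) (auto simp: x_def)
    also have "(\<Sum>k\<in>F. x k * b k) = (\<Sum>k\<in>F. b k powr q / S powr (1 / p))"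
    proof (intro sum.cong refl)
      fix k assume "k \<in> F"
      have "b k powr (q - 1) * b k = b k powr q"
        using nn[OF \<open>k \<in> F\<close>] by (cases "b k = 0") (auto simp: powr_diff)
      then show "x k * b k = b k powr q / S powr (1 / p)" by (simp add: x_def)
    qed
    also have "\<dots> = S powr 1 / S powr (1 / p)"
      using S by (simp add: S_def sum_divide_distrib[symmetric] sum_nonneg)
    also have "\<dots> = S powr (1 / q)"
    proof -
      have "1 / q = 1 - 1 / p" using pq by simp
      then show ?thesis by (simp only: powr_diff)
    qed
    finally have "(S powr (1 / q)) powr q \<le> C powr q" using pq by (intro powr_mono2) auto
    then show ?thesis using S pq by (simp add: powr_powr S_def)
  qed
qed

text \<open>
  Sums over the index set of the shells occur both as real infinite sums, in the norm of \<open>l\<^sub>q\<close>, and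
  as extended nonnegative integrals, in the decomposition of an integral over \<open>\<Omega>\<close>. The next two
  lemmas reduce the latter to finite partial sums, which are common to both.
\<close>

lemma nn_integral_count_space_ge_sum:
  assumes "finite F" "F \<subseteq> A"
  shows "(\<Sum>k\<in>F. f k) \<le> (\<integral>\<^sup>+k. f k \<partial>count_space A)"
proof -
  have "(\<Sum>k\<in>F. f k) = (\<integral>\<^sup>+k. f k * indicator F k \<partial>count_space A)"
    using assms by (subst nn_integral_count_space'[of F]) (auto simp: indicator_def)
  also have "\<dots> \<le> (\<integral>\<^sup>+k. f k \<partial>count_space A)"
    by (intro nn_integral_mono) (auto simp: indicator_def)
  finally show ?thesis .
qed

lemma nn_integral_count_space_le:
  assumes A: "countable A" and le: "\<And>F. finite F \<Longrightarrow> F \<subseteq> A \<Longrightarrow> (\<Sum>k\<in>F. f k) \<le> C"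
  shows "(\<integral>\<^sup>+k. f k \<partial>count_space A) \<le> C"
proof (cases "A = {}")
  case False
  define F where "F n = from_nat_into A ` {..n}" for n
  have F: "finite (F n)" "F n \<subseteq> A" for n
    using from_nat_into[OF False] by (auto simp: F_def)
  have "(\<integral>\<^sup>+k. f k \<partial>count_space A) = (\<integral>\<^sup>+k. (SUP n. f k * indicator (F n) k) \<partial>count_space A)"
  proof (intro nn_integral_cong)
    fix k assume "k \<in> space (count_space A)"
    then obtain m where m: "from_nat_into A m = k"
      using from_nat_into_surj[OF A] by auto
    show "f k = (SUP n. f k * indicator (F n) k)"
    proof (rule antisym)
      have "f k = f k * indicator (F m) k" using m by (auto simp: F_def)
      also have "\<dots> \<le> (SUP n. f k * indicator (F n) k)" by (rule SUP_upper) simp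
      finally show "f k \<le> (SUP n. f k * indicator (F n) k)" .
    qed (auto intro!: SUP_least simp: indicator_def)
  qed
  also have "\<dots> = (SUP n. (\<integral>\<^sup>+k. f k * indicator (F n) k \<partial>count_space A))"
  proof (rule nn_integral_monotone_convergence_SUP)
    show "incseq (\<lambda>n k. f k * indicator (F n) k)"
      by (auto simp: F_def incseq_def le_fun_def indicator_def)
  qed simp
  also have "\<dots> \<le> C"
  proof (rule SUP_least)
    fix n
    have "(\<integral>\<^sup>+k. f k * indicator (F n) k \<partial>count_space A) = (\<Sum>k\<in>F n. f k)"
      using F[of n] by (subst nn_integral_count_space'[of "F n"]) (auto simp: indicator_def)
    then show "(\<integral>\<^sup>+k. f k * indicator (F n) k \<partial>count_space A) \<le> C"
      using le[OF F(1,2)] by simp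
  qed
  finally show ?thesis .
qed (simp add: nn_integral_count_space_finite)

definition weight :: "real \<Rightarrow> int \<Rightarrow> real" where
  "weight a k = 2 powr (a * of_int k)"

lemma weight_pos [simp]: "0 < weight a k" and weight_nonneg [simp]: "0 \<le> weight a k"
  and weight_nonzero [simp]: "weight a k \<noteq> 0"
  by (simp_all add: weight_def)

lemma weight_minus: "weight (- a) k = 1 / weight a k"
  by (simp add: weight_def powr_minus_divide)

lemma elems_weighted_lq_iff:
  "x \<in> elems (weighted_lq q a) \<longleftrightarrow> (\<lambda>k. (weight a k * \<bar>x k\<bar>) powr q) summable_on herz_index"
  by (simp add: weighted_lq_def weight_def powr_mult powr_powr)

lemma fnorm_weighted_lq:
  "fnorm (weighted_lq q a) x = (\<Sum>\<^sub>\<infinity>k\<in>herz_index. (weight a k * \<bar>x k\<bar>) powr q) powr (1 / q)"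
  by (simp add: weighted_lq_def weight_def powr_mult powr_powr)

lemma fnorm_weighted_lq_nonneg: "0 \<le> fnorm (weighted_lq q a) x"
  by (simp add: fnorm_weighted_lq)

lemma weighted_lqI:
  assumes "0 < q" "0 \<le> C"
    and le: "\<And>F. finite F \<Longrightarrow> F \<subseteq> herz_index \<Longrightarrow> (\<Sum>k\<in>F. (weight a k * \<bar>x k\<bar>) powr q) \<le> C powr q"
  shows "x \<in> elems (weighted_lq q a)" and "fnorm (weighted_lq q a) x \<le> C"
proof -
  let ?t = "\<lambda>k. (weight a k * \<bar>x k\<bar>) powr q"
  have s: "?t summable_on herz_index"
    using le by (intro nonneg_bdd_above_summable_on bdd_aboveI2[where M = "C powr q"]) auto
  then show "x \<in> elems (weighted_lq q a)" by (simp add: elems_weighted_lq_iff)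
  have "infsum ?t herz_index \<le> C powr q"
    using s le by (intro infsum_le_finite_sums) auto
  then have "infsum ?t herz_index powr (1 / q) \<le> (C powr q) powr (1 / q)"
    using \<open>0 < q\<close> by (intro powr_mono2 infsum_nonneg) auto
  then show "fnorm (weighted_lq q a) x \<le> C"
    using \<open>0 < q\<close> \<open>0 \<le> C\<close> by (simp add: fnorm_weighted_lq powr_powr)
qed

lemma sum_le_fnorm_weighted_lq:
  assumes "0 < q" "x \<in> elems (weighted_lq q a)" "finite F" "F \<subseteq> herz_index"
  shows "(\<Sum>k\<in>F. (weight a k * \<bar>x k\<bar>) powr q) \<le> fnorm (weighted_lq q a) x powr q"
proof -
  have "(\<Sum>k\<in>F. (weight a k * \<bar>x k\<bar>) powr q) \<le> (\<Sum>\<^sub>\<infinity>k\<in>herz_index. (weight a k * \<bar>x k\<bar>) powr q)"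
    using assms by (intro finite_sum_le_infsum) (auto simp: elems_weighted_lq_iff)
  also have "\<dots> = fnorm (weighted_lq q a) x powr q"
    using assms by (simp add: fnorm_weighted_lq powr_powr infsum_nonneg)
  finally show ?thesis .
qed

lemma weighted_lq_mono:
  assumes "0 < q" "0 \<le> C" and y: "y \<in> elems (weighted_lq q a)"
    and le: "\<And>k. k \<in> herz_index \<Longrightarrow> \<bar>x k\<bar> \<le> C * \<bar>y k\<bar>"
  shows "x \<in> elems (weighted_lq q a)" and "fnorm (weighted_lq q a) x \<le> C * fnorm (weighted_lq q a) y"
proof -
  have bound: "(\<Sum>k\<in>F. (weight a k * \<bar>x k\<bar>) powr q) \<le> (C * fnorm (weighted_lq q a) y) powr q"
    if F: "finite F" "F \<subseteq> herz_index" for F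
  proof -
    have "(\<Sum>k\<in>F. (weight a k * \<bar>x k\<bar>) powr q) \<le> (\<Sum>k\<in>F. (C * (weight a k * \<bar>y k\<bar>)) powr q)"
    proof (intro sum_mono powr_mono2)
      fix k assume "k \<in> F"
      then have "weight a k * \<bar>x k\<bar> \<le> weight a k * (C * \<bar>y k\<bar>)"
        using F le by (intro mult_left_mono) auto
      then show "weight a k * \<bar>x k\<bar> \<le> C * (weight a k * \<bar>y k\<bar>)" by (simp add: algebra_simps)
    qed (use \<open>0 < q\<close> in auto)
    also have "\<dots> = C powr q * (\<Sum>k\<in>F. (weight a k * \<bar>y k\<bar>) powr q)"
      using \<open>0 \<le> C\<close> by (simp add: powr_mult sum_distrib_left)
    also have "\<dots> \<le> C powr q * fnorm (weighted_lq q a) y powr q"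
      using sum_le_fnorm_weighted_lq[OF \<open>0 < q\<close> y F] by (intro mult_left_mono) auto
    also have "\<dots> = (C * fnorm (weighted_lq q a) y) powr q"
      using \<open>0 \<le> C\<close> by (simp add: powr_mult fnorm_weighted_lq_nonneg)
    finally show ?thesis .
  qed
  have "0 \<le> C * fnorm (weighted_lq q a) y"
    using \<open>0 \<le> C\<close> by (simp add: fnorm_weighted_lq_nonneg)
  from weighted_lqI[OF \<open>0 < q\<close> this bound]
  show "x \<in> elems (weighted_lq q a)" "fnorm (weighted_lq q a) x \<le> C * fnorm (weighted_lq q a) y"
    by auto
qed

lemma weighted_lq_Holder:
  assumes pq: "1 < q" "1 < q'" "1 / q + 1 / q' = 1"
    and x: "x \<in> elems (weighted_lq q a)" and y: "y \<in> elems (weighted_lq q' (- a))"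
    and F: "finite F" "F \<subseteq> herz_index"
  shows "(\<Sum>k\<in>F. \<bar>x k\<bar> * \<bar>y k\<bar>) \<le> fnorm (weighted_lq q a) x * fnorm (weighted_lq q' (- a)) y"
proof -
  have "(\<Sum>k\<in>F. \<bar>x k\<bar> * \<bar>y k\<bar>) = (\<Sum>k\<in>F. (weight a k * \<bar>x k\<bar>) * (weight (- a) k * \<bar>y k\<bar>))"
    by (intro sum.cong) (auto simp: weight_minus)
  also have "\<dots> \<le> (\<Sum>k\<in>F. (weight a k * \<bar>x k\<bar>) powr q) powr (1 / q) *
      (\<Sum>k\<in>F. (weight (- a) k * \<bar>y k\<bar>) powr q') powr (1 / q')"
    using pq F by (intro Holder_sum) auto
  also have "\<dots> \<le> (fnorm (weighted_lq q a) x powr q) powr (1 / q) *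
      (fnorm (weighted_lq q' (- a)) y powr q') powr (1 / q')"
    using pq sum_le_fnorm_weighted_lq[OF _ x F] sum_le_fnorm_weighted_lq[OF _ y F]
    by (intro mult_mono powr_mono2) (auto intro: sum_nonneg)
  also have "\<dots> = fnorm (weighted_lq q a) x * fnorm (weighted_lq q' (- a)) y"
    using pq by (simp add: powr_powr fnorm_weighted_lq_nonneg)
  finally show ?thesis .
qed

text \<open>
  Only finitely supported test sequences are required. This is the form in which both Koethe duals
  are computed, that of \<open>l\<^sub>q\<close> and that of the Orlicz-Herz space.
\<close>

lemma weighted_lq_Holder_converse:
  assumes pq: "1 < q" "1 < q'" "1 / q + 1 / q' = 1" and "0 \<le> C"
    and le: "\<And>F x. finite F \<Longrightarrow> F \<subseteq> herz_index \<Longrightarrow> (\<And>k. 0 \<le> x k) \<Longrightarrow> (\<And>k. k \<notin> F \<Longrightarrow> x k = 0) \<Longrightarrow>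
      x \<in> elems (weighted_lq q a) \<Longrightarrow> fnorm (weighted_lq q a) x \<le> 1 \<Longrightarrow> (\<Sum>k\<in>F. x k * \<bar>y k\<bar>) \<le> C"
  shows "y \<in> elems (weighted_lq q' (- a))" and "fnorm (weighted_lq q' (- a)) y \<le> C"
proof -
  have bound: "(\<Sum>k\<in>F. (weight (- a) k * \<bar>y k\<bar>) powr q') \<le> C powr q'"
    if F: "finite F" "F \<subseteq> herz_index" for F
  proof (rule Holder_sum_converse[OF F(1) pq])
    fix z :: "int \<Rightarrow> real" assume z: "\<And>k. 0 \<le> z k" "(\<Sum>k\<in>F. z k powr q) \<le> 1"
    define x where "x k = (if k \<in> F then z k / weight a k else 0)" for k
    have "(\<Sum>k\<in>G. (weight a k * \<bar>x k\<bar>) powr q) \<le> 1 powr q" if "finite G" for G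
    proof -
      have "(\<Sum>k\<in>G. (weight a k * \<bar>x k\<bar>) powr q) = (\<Sum>k\<in>G \<inter> F. z k powr q)"
        using z pq that by (intro sum.mono_neutral_cong_right) (auto simp: x_def)
      also have "\<dots> \<le> (\<Sum>k\<in>F. z k powr q)" using F by (intro sum_mono2) auto
      finally show ?thesis using z by simp
    qed
    then have xE: "x \<in> elems (weighted_lq q a)" "fnorm (weighted_lq q a) x \<le> 1"
      using weighted_lqI[of q 1 a x] pq by auto
    have "(\<Sum>k\<in>F. x k * \<bar>y k\<bar>) \<le> C"
      by (rule le[OF F _ _ xE]) (auto simp: x_def z)
    also have "(\<Sum>k\<in>F. x k * \<bar>y k\<bar>) = (\<Sum>k\<in>F. z k * (weight (- a) k * \<bar>y k\<bar>))"
      by (intro sum.cong) (auto simp: x_def weight_minus)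
    finally show "(\<Sum>k\<in>F. z k * (weight (- a) k * \<bar>y k\<bar>)) \<le> C" .
  qed (use \<open>0 \<le> C\<close> in auto)
  show "y \<in> elems (weighted_lq q' (- a))"
    using weighted_lqI[OF _ \<open>0 \<le> C\<close> bound] pq by auto
  show "fnorm (weighted_lq q' (- a)) y \<le> C"
    using weighted_lqI[OF _ \<open>0 \<le> C\<close> bound] pq by auto
qed

lemma kothe_dual_weighted_lq:
  assumes pq: "1 < q" "1 < q'" "1 / q + 1 / q' = 1"
  shows "eq_equal_norms (kothe_dual (count_space herz_index) (weighted_lq q a)) (weighted_lq q' (- a))"
proof -
  let ?E = "weighted_lq q a" and ?E' = "weighted_lq q' (- a)"
  let ?K = "kothe_norm (count_space herz_index) ?E"
  have le: "?K y \<le> ennreal (fnorm ?E' y)" if y: "y \<in> elems ?E'" for y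
    unfolding kothe_norm_def
  proof (rule SUP_least, rule nn_integral_count_space_le)
    fix x F assume x: "x \<in> {f \<in> elems ?E. fnorm ?E f \<le> 1}" and F: "finite F" "F \<subseteq> herz_index"
    have "(\<Sum>k\<in>F. \<bar>x k\<bar> * \<bar>y k\<bar>) \<le> fnorm ?E x * fnorm ?E' y"
      using weighted_lq_Holder[OF pq _ y F] x by blast
    also have "\<dots> \<le> 1 * fnorm ?E' y" using x by (intro mult_right_mono fnorm_weighted_lq_nonneg) auto
    finally show "(\<Sum>k\<in>F. ennreal \<bar>x k * y k\<bar>) \<le> ennreal (fnorm ?E' y)"
      by (simp add: sum_ennreal abs_mult ennreal_leI)
  qed simp
  have ge: "y \<in> elems ?E' \<and> fnorm ?E' y \<le> enn2real (?K y)" if fin: "?K y < \<infinity>" for y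
  proof -
    have "(\<Sum>k\<in>F. x k * \<bar>y k\<bar>) \<le> enn2real (?K y)"
      if F: "finite F" "F \<subseteq> herz_index" and x: "\<And>k. 0 \<le> x k" "x \<in> elems ?E" "fnorm ?E x \<le> 1" for F x
    proof -
      have "ennreal (\<Sum>k\<in>F. x k * \<bar>y k\<bar>) = (\<Sum>k\<in>F. ennreal \<bar>x k * y k\<bar>)"
        using x by (subst sum_ennreal) (auto simp: abs_mult)
      also have "\<dots> \<le> (\<integral>\<^sup>+k. ennreal \<bar>x k * y k\<bar> \<partial>count_space herz_index)"
        using F by (rule nn_integral_count_space_ge_sum)
      also have "\<dots> \<le> ?K y" unfolding kothe_norm_def using x by (intro SUP_upper) auto
      finally show ?thesis using fin by (cases "?K y") auto
    qed
    then show ?thesis using weighted_lq_Holder_converse[OF pq, of "enn2real (?K y)" a y] by auto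
  qed
  have "elems (kothe_dual (count_space herz_index) ?E) = elems ?E'"
    using ge le by (auto simp: kothe_dual_def intro: le_less_trans[OF _ ennreal_less_top])
  moreover have "enn2real (?K y) = fnorm ?E' y" if "y \<in> elems ?E'" for y
    using le[OF that] ge[of y] le_less_trans[OF le[OF that] ennreal_less_top]
    by (intro antisym enn2real_leI fnorm_weighted_lq_nonneg) auto
  ultimately show ?thesis by (simp add: eq_equal_norms_def kothe_dual_def)
qed

lemma weighted_lq_add:
  assumes q: "0 < q" and x: "x \<in> elems (weighted_lq q a)" and y: "y \<in> elems (weighted_lq q a)"
  shows "(\<lambda>k. x k + y k) \<in> elems (weighted_lq q a)"
proof -
  have "(\<lambda>k. 2 powr q * ((weight a k * \<bar>x k\<bar>) powr q + (weight a k * \<bar>y k\<bar>) powr q)) summable_on herz_index"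
    using x y by (intro summable_on_cmult_right summable_on_add) (auto simp: elems_weighted_lq_iff)
  then have "(\<lambda>k. (weight a k * \<bar>x k + y k\<bar>) powr q) summable_on herz_index"
  proof (rule summable_on_comparison_test)
    fix k
    let ?m = "max (weight a k * \<bar>x k\<bar>) (weight a k * \<bar>y k\<bar>)"
    have "weight a k * \<bar>x k + y k\<bar> \<le> weight a k * \<bar>x k\<bar> + weight a k * \<bar>y k\<bar>"
      unfolding distrib_left[symmetric] by (intro mult_left_mono abs_triangle_ineq) auto
    also have "\<dots> \<le> 2 * ?m" by simp
    finally have "(weight a k * \<bar>x k + y k\<bar>) powr q \<le> (2 * ?m) powr q"
      using q by (intro powr_mono2) auto
    also have "\<dots> = 2 powr q * ?m powr q" by (simp add: powr_mult)
    also have "\<dots> \<le> 2 powr q * ((weight a k * \<bar>x k\<bar>) powr q + (weight a k * \<bar>y k\<bar>) powr q)"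
      by (intro mult_left_mono) (auto simp: max_def)
    finally show "(weight a k * \<bar>x k + y k\<bar>) powr q \<le>
      2 powr q * ((weight a k * \<bar>x k\<bar>) powr q + (weight a k * \<bar>y k\<bar>) powr q)" .
  qed auto
  then show ?thesis by (simp add: elems_weighted_lq_iff)
qed

lemma weighted_lq_dominated_convergence:
  assumes q: "0 < q" and y: "y \<in> elems (weighted_lq q a)"
    and le: "\<And>n k. k \<in> herz_index \<Longrightarrow> \<bar>x n k\<bar> \<le> \<bar>y k\<bar>"
    and lim: "\<And>k. k \<in> herz_index \<Longrightarrow> (\<lambda>n. x n k) \<longlonglongrightarrow> 0"
  shows "(\<lambda>n. fnorm (weighted_lq q a) (x n)) \<longlonglongrightarrow> 0"
proof (rule order_tendstoI)
  let ?C = "count_space herz_index"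
  fix e :: real assume "0 < e"
  define d where "d = e / 2"
  have d: "0 < d" "d < e" using \<open>0 < e\<close> by (auto simp: d_def)
  have "(\<lambda>n. \<integral>\<^sup>+k. ennreal ((weight a k * \<bar>x n k\<bar>) powr q) \<partial>?C) \<longlonglongrightarrow> (\<integral>\<^sup>+k. 0 \<partial>?C)"
  proof (rule nn_integral_dominated_convergence[where w = "\<lambda>k. ennreal ((weight a k * \<bar>y k\<bar>) powr q)"])
    show "AE k in ?C. ennreal ((weight a k * \<bar>x n k\<bar>) powr q) \<le> ennreal ((weight a k * \<bar>y k\<bar>) powr q)" for n
      using le q by (intro AE_I2 ennreal_leI powr_mono2 mult_left_mono) auto
    have "(\<integral>\<^sup>+k. ennreal ((weight a k * \<bar>y k\<bar>) powr q) \<partial>?C) \<le> ennreal (fnorm (weighted_lq q a) y powr q)"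
      using sum_le_fnorm_weighted_lq[OF q y]
      by (intro nn_integral_count_space_le) (auto simp: sum_ennreal intro!: ennreal_leI)
    then show "(\<integral>\<^sup>+k. ennreal ((weight a k * \<bar>y k\<bar>) powr q) \<partial>?C) < \<infinity>"
      by (rule le_less_trans) simp
    show "AE k in ?C. (\<lambda>n. ennreal ((weight a k * \<bar>x n k\<bar>) powr q)) \<longlonglongrightarrow> 0"
    proof (rule AE_I2)
      fix k assume "k \<in> space ?C"
      then have "(\<lambda>n. weight a k * \<bar>x n k\<bar>) \<longlonglongrightarrow> weight a k * \<bar>0\<bar>"
        using lim by (intro tendsto_intros) auto
      then have "(\<lambda>n. (weight a k * \<bar>x n k\<bar>) powr q) \<longlonglongrightarrow> 0 powr q"
        using q by (intro tendsto_powr') auto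
      then show "(\<lambda>n. ennreal ((weight a k * \<bar>x n k\<bar>) powr q)) \<longlonglongrightarrow> 0"
        using tendsto_ennrealI[of "\<lambda>n. (weight a k * \<bar>x n k\<bar>) powr q" 0] by simp
    qed
  qed auto
  then have "\<forall>\<^sub>F n in sequentially. (\<integral>\<^sup>+k. ennreal ((weight a k * \<bar>x n k\<bar>) powr q) \<partial>?C) < ennreal (d powr q)"
    using d by (intro order_tendstoD(2)[where y = 0]) auto
  then show "\<forall>\<^sub>F n in sequentially. fnorm (weighted_lq q a) (x n) < e"
  proof eventually_elim
    case (elim n)
    have "fnorm (weighted_lq q a) (x n) \<le> d"
    proof (rule weighted_lqI(2)[OF q])
      fix F assume F: "finite F" "F \<subseteq> herz_index"
      have "ennreal (\<Sum>k\<in>F. (weight a k * \<bar>x n k\<bar>) powr q) = (\<Sum>k\<in>F. ennreal ((weight a k * \<bar>x n k\<bar>) powr q))"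
        by (simp add: sum_ennreal)
      also have "\<dots> \<le> (\<integral>\<^sup>+k. ennreal ((weight a k * \<bar>x n k\<bar>) powr q) \<partial>?C)"
        using F by (rule nn_integral_count_space_ge_sum)
      also have "\<dots> \<le> ennreal (d powr q)" using elim by simp
      finally show "(\<Sum>k\<in>F. (weight a k * \<bar>x n k\<bar>) powr q) \<le> d powr q" by simp
    qed (use d in simp)
    with d show ?case by simp
  qed
next
  fix e :: real assume "e < 0"
  then have "e < fnorm (weighted_lq q a) (x n)" for n
    using fnorm_weighted_lq_nonneg by (rule less_le_trans)
  then show "\<forall>\<^sub>F n in sequentially. e < fnorm (weighted_lq q a) (x n)" by simp
qed

text \<open>
  A positive sequence in \<open>l\<^sub>q\<close> provides the coefficients, on the single shells, of a strictly
  positive element of the Orlicz-Herz space.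
\<close>

lemma weighted_lq_strictly_positive_elem:
  assumes q: "1 < q"
  obtains z where "z \<in> elems (weighted_lq q a)" "\<And>k. 0 < z k"
proof -
  define t :: "int \<Rightarrow> real" where "t k = (1 / 2) ^ nat (k + 1)" for k
  have t: "0 < t k" "t k \<le> 1" for k by (auto simp: t_def power_le_one)
  have "(\<Sum>k\<in>F. (weight a k * \<bar>t k / weight a k\<bar>) powr q) \<le> (2 powr (1 / q)) powr q"
    if F: "finite F" "F \<subseteq> herz_index" for F
  proof -
    have "(\<Sum>k\<in>F. (weight a k * \<bar>t k / weight a k\<bar>) powr q) \<le> (\<Sum>k\<in>F. t k)"
    proof (rule sum_mono)
      fix k
      have "(weight a k * \<bar>t k / weight a k\<bar>) powr q = t k powr q" using t[of k] by (simp add: abs_divide)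
      also have "\<dots> \<le> t k powr 1" using t[of k] q by (intro powr_mono') auto
      finally show "(weight a k * \<bar>t k / weight a k\<bar>) powr q \<le> t k" using t[of k] by simp
    qed
    also have "\<dots> = (\<Sum>n\<in>(\<lambda>k. nat (k + 1)) ` F. (1 / 2) ^ n)"
    proof (subst sum.reindex)
      have "inj_on (\<lambda>k. nat (k + 1)) herz_index" by (auto simp: inj_on_def herz_index_def)
      then show "inj_on (\<lambda>k. nat (k + 1)) F" using F(2) by (rule inj_on_subset)
    qed (simp add: t_def)
    also have "\<dots> \<le> (\<Sum>n. (1 / 2) ^ n)"
      using F by (intro sum_le_suminf) (auto intro: summable_geometric)
    also have "\<dots> = 2" by (subst suminf_geometric) auto
    finally show ?thesis using q by (simp add: powr_powr)
  qed
  then have "(\<lambda>k. t k / weight a k) \<in> elems (weighted_lq q a)"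
    using q by (intro weighted_lqI[where C = "2 powr (1 / q)"]) auto
  then show thesis by (rule that) (use t in simp)
qed

section \<open>Orlicz spaces and the two norms of the complementary space\<close>

lemma fnorm_orlicz_space: "fnorm (orlicz_space M \<Psi>) = luxemburg_norm M \<Psi>"
  by (simp add: orlicz_space_def)

lemma modular_cong:
  "(\<And>\<omega>. \<omega> \<in> space M \<Longrightarrow> f \<omega> = g \<omega>) \<Longrightarrow> modular M \<Psi> f = modular M \<Psi> g"
  unfolding modular_def by (intro nn_integral_cong) auto

lemma luxemburg_norm_cong:
  assumes "\<And>\<omega>. \<omega> \<in> space M \<Longrightarrow> f \<omega> = g \<omega>"
  shows "luxemburg_norm M \<Psi> f = luxemburg_norm M \<Psi> g"
proof -
  have "modular M \<Psi> (\<lambda>\<omega>. f \<omega> / l) = modular M \<Psi> (\<lambda>\<omega>. g \<omega> / l)" for l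
    using assms by (intro modular_cong) auto
  then show ?thesis by (simp add: luxemburg_norm_def)
qed

lemma orlicz_space_cong:
  assumes "\<And>\<omega>. \<omega> \<in> space M \<Longrightarrow> f \<omega> = g \<omega>"
  shows "f \<in> elems (orlicz_space M \<Psi>) \<longleftrightarrow> g \<in> elems (orlicz_space M \<Psi>)"
proof -
  have "modular M \<Psi> (\<lambda>\<omega>. s * f \<omega>) = modular M \<Psi> (\<lambda>\<omega>. s * g \<omega>)" for s
    using assms by (intro modular_cong) auto
  moreover have "f \<in> borel_measurable M \<longleftrightarrow> g \<in> borel_measurable M"
    using assms by (intro measurable_cong) auto
  ultimately show ?thesis by (simp add: orlicz_space_def)
qed

lemma orlicz_norm_complementary_cong:
  assumes "\<And>\<omega>. \<omega> \<in> space M \<Longrightarrow> f \<omega> = g \<omega>"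
  shows "orlicz_norm_complementary M \<Phi> f = orlicz_norm_complementary M \<Phi> g"
proof -
  have "(\<integral>\<omega>. f \<omega> * h \<omega> \<partial>M) = (\<integral>\<omega>. g \<omega> * h \<omega> \<partial>M)" for h
    using assms by (intro Bochner_Integration.integral_cong) auto
  then show ?thesis by (simp add: orlicz_norm_complementary_def)
qed

text \<open>
  The convexity inequality on rays from the origin carries the elementary theory of the Luxemburg
  norm. In this form it covers \<open>\<Phi>\<close> and the complementary function, which may be infinite, at the
  same time. Measurability is stated for the absolute value because the behaviour of \<open>\<Phi>\<close> at negative
  arguments is arbitrary.
\<close>

locale star_shaped_function =
  fixes \<Psi> :: "real \<Rightarrow> ennreal"
  assumes measurable_abs [measurable]: "(\<lambda>u. \<Psi> \<bar>u\<bar>) \<in> borel_measurable borel"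
    and mono: "0 \<le> u \<Longrightarrow> u \<le> v \<Longrightarrow> \<Psi> u \<le> \<Psi> v"
    and star: "0 \<le> t \<Longrightarrow> t \<le> 1 \<Longrightarrow> 0 \<le> u \<Longrightarrow> \<Psi> (t * u) \<le> ennreal t * \<Psi> u"
begin

lemma modular_mono:
  assumes "AE \<omega> in M. \<bar>f \<omega>\<bar> \<le> \<bar>g \<omega>\<bar>"
  shows "modular M \<Psi> f \<le> modular M \<Psi> g"
  unfolding modular_def using assms by (intro nn_integral_mono_AE) (auto elim!: eventually_mono intro: mono)

lemma modular_scale:
  assumes [measurable]: "f \<in> borel_measurable M" and t: "0 \<le> t" "t \<le> 1"
  shows "modular M \<Psi> (\<lambda>\<omega>. t * f \<omega>) \<le> ennreal t * modular M \<Psi> f"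
proof -
  have "modular M \<Psi> (\<lambda>\<omega>. t * f \<omega>) \<le> (\<integral>\<^sup>+\<omega>. ennreal t * \<Psi> \<bar>f \<omega>\<bar> \<partial>M)"
    unfolding modular_def using t by (intro nn_integral_mono) (simp add: abs_mult star)
  also have "\<dots> = ennreal t * modular M \<Psi> f"
    unfolding modular_def by (rule nn_integral_cmult) measurable
  finally show ?thesis .
qed

lemma modular_divide_le_1:
  assumes [measurable]: "f \<in> borel_measurable M" and c: "modular M \<Psi> f \<le> ennreal c" "1 \<le> c"
  shows "modular M \<Psi> (\<lambda>\<omega>. f \<omega> / c) \<le> 1"
proof -
  have "modular M \<Psi> (\<lambda>\<omega>. f \<omega> / c) \<le> ennreal (1 / c) * modular M \<Psi> f"
    using modular_scale[of f M "1 / c"] c by simp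
  also have "\<dots> \<le> ennreal (1 / c) * ennreal c" using c by (intro mult_left_mono) auto
  also have "\<dots> = 1" using c by (simp flip: ennreal_mult)
  finally show ?thesis .
qed

lemma modular_divide_mono:
  assumes "0 < l" "l \<le> l'"
  shows "modular M \<Psi> (\<lambda>\<omega>. f \<omega> / l') \<le> modular M \<Psi> (\<lambda>\<omega>. f \<omega> / l)"
  using assms by (intro modular_mono AE_I2) (auto simp: abs_divide intro!: divide_left_mono mult_pos_pos)

text \<open>
  The modular of \<open>s f\<close>, once it is finite, is brought below \<open>1\<close> by dividing \<open>s f\<close> by a large constant.
  Hence the infimum in the Luxemburg norm is taken over a nonempty set.
\<close>

lemma orlicz_space_iff:
  "f \<in> elems (orlicz_space M \<Psi>) \<longleftrightarrow>
     f \<in> borel_measurable M \<and> (\<exists>l>0. modular M \<Psi> (\<lambda>\<omega>. f \<omega> / l) \<le> 1)"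
proof safe
  assume f: "f \<in> elems (orlicz_space M \<Psi>)"
  then show [measurable]: "f \<in> borel_measurable M" by (simp add: orlicz_space_def)
  from f obtain s where s: "s > 0" "modular M \<Psi> (\<lambda>\<omega>. s * f \<omega>) < \<infinity>"
    by (auto simp: orlicz_space_def)
  define c where "c = max 1 (enn2real (modular M \<Psi> (\<lambda>\<omega>. s * f \<omega>)))"
  have "modular M \<Psi> (\<lambda>\<omega>. s * f \<omega> / c) \<le> 1"
  proof (rule modular_divide_le_1)
    have "modular M \<Psi> (\<lambda>\<omega>. s * f \<omega>) = ennreal (enn2real (modular M \<Psi> (\<lambda>\<omega>. s * f \<omega>)))"
      using s by simp
    also have "\<dots> \<le> ennreal c" by (intro ennreal_leI) (simp add: c_def)
    finally show "modular M \<Psi> (\<lambda>\<omega>. s * f \<omega>) \<le> ennreal c" .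
  qed (auto simp: c_def)
  moreover have "c > 0" by (simp add: c_def)
  ultimately show "\<exists>l>0. modular M \<Psi> (\<lambda>\<omega>. f \<omega> / l) \<le> 1"
    using s by (intro exI[of _ "c / s"]) (simp add: mult.commute)
next
  fix l :: real assume "f \<in> borel_measurable M" and l: "0 < l" "modular M \<Psi> (\<lambda>\<omega>. f \<omega> / l) \<le> 1"
  moreover have "modular M \<Psi> (\<lambda>\<omega>. (1 / l) * f \<omega>) < \<infinity>"
    using l(2) by (simp add: order.strict_trans1)
  ultimately show "f \<in> elems (orlicz_space M \<Psi>)"
    unfolding orlicz_space_def by (auto intro!: exI[of _ "1 / l"])
qed

lemma luxemburg_norm_le:
  assumes "0 < l" "modular M \<Psi> (\<lambda>\<omega>. f \<omega> / l) \<le> 1"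
  shows "luxemburg_norm M \<Psi> f \<le> l"
  unfolding luxemburg_norm_def using assms by (intro cInf_lower) (auto intro!: bdd_belowI[of _ 0])

lemma luxemburg_norm_nonneg:
  assumes "f \<in> elems (orlicz_space M \<Psi>)"
  shows "0 \<le> luxemburg_norm M \<Psi> f"
  unfolding luxemburg_norm_def using assms by (intro cInf_greatest) (auto simp: orlicz_space_iff)

text \<open>
  The set of admissible constants in the Luxemburg norm is upward closed. The limiting case, where
  the constant is the norm itself, is avoided throughout: all estimates are made for larger
  constants, followed by a passage to the limit.
\<close>

lemma modular_le_1:
  assumes f: "f \<in> elems (orlicz_space M \<Psi>)" and less: "luxemburg_norm M \<Psi> f < l"
  shows "modular M \<Psi> (\<lambda>\<omega>. f \<omega> / l) \<le> 1"
proof -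
  obtain l' where "0 < l'" "modular M \<Psi> (\<lambda>\<omega>. f \<omega> / l') \<le> 1" "l' < l"
    using less f cInf_lessD[of "{l. l > 0 \<and> modular M \<Psi> (\<lambda>\<omega>. f \<omega> / l) \<le> 1}" l]
    by (auto simp: luxemburg_norm_def orlicz_space_iff)
  then show ?thesis using modular_divide_mono[of l' l M f] by (meson less_imp_le order_trans)
qed

lemma orlicz_space_mono:
  assumes g: "g \<in> elems (orlicz_space M \<Psi>)" and f: "f \<in> borel_measurable M"
    and le: "AE \<omega> in M. \<bar>f \<omega>\<bar> \<le> \<bar>g \<omega>\<bar>"
  shows "f \<in> elems (orlicz_space M \<Psi>)" and "luxemburg_norm M \<Psi> f \<le> luxemburg_norm M \<Psi> g"
proof -
  have *: "modular M \<Psi> (\<lambda>\<omega>. f \<omega> / l) \<le> modular M \<Psi> (\<lambda>\<omega>. g \<omega> / l)" if "l > 0" for l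
    using le that by (intro modular_mono) (auto simp: abs_divide divide_right_mono)
  show "f \<in> elems (orlicz_space M \<Psi>)"
    using f g * by (auto simp: orlicz_space_iff intro: order_trans)
  show "luxemburg_norm M \<Psi> f \<le> luxemburg_norm M \<Psi> g"
  proof (rule dense_ge)
    fix l assume l: "luxemburg_norm M \<Psi> g < l"
    then have "l > 0" using luxemburg_norm_nonneg[OF g] by simp
    with l show "luxemburg_norm M \<Psi> f \<le> l"
      using modular_le_1[OF g l] * by (intro luxemburg_norm_le) (auto intro: order_trans)
  qed
qed

lemma luxemburg_norm_cmult_le:
  assumes f: "f \<in> elems (orlicz_space M \<Psi>)"
  shows "(\<lambda>\<omega>. c * f \<omega>) \<in> elems (orlicz_space M \<Psi>)"
    and "luxemburg_norm M \<Psi> (\<lambda>\<omega>. c * f \<omega>) \<le> \<bar>c\<bar> * luxemburg_norm M \<Psi> f"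
proof -
  have [measurable]: "f \<in> borel_measurable M" using f by (simp add: orlicz_space_iff)
  define N where "N = luxemburg_norm M \<Psi> f"
  have N: "0 \<le> N" using f by (simp add: N_def luxemburg_norm_nonneg)
  have *: "modular M \<Psi> (\<lambda>\<omega>. c * f \<omega> / (\<bar>c\<bar> * (N + e) + e)) \<le> 1" if "e > 0" for e
  proof -
    have "modular M \<Psi> (\<lambda>\<omega>. c * f \<omega> / (\<bar>c\<bar> * (N + e) + e)) \<le> modular M \<Psi> (\<lambda>\<omega>. f \<omega> / (N + e))"
    proof (intro modular_mono AE_I2)
      fix \<omega>
      have p: "0 < \<bar>c\<bar> * (N + e) + e" "0 < N + e"
        using N that by (auto intro!: add_nonneg_pos mult_nonneg_nonneg)
      have "\<bar>c\<bar> * \<bar>f \<omega>\<bar> * (N + e) \<le> \<bar>f \<omega>\<bar> * (\<bar>c\<bar> * (N + e) + e)"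
        using that by (simp add: algebra_simps)
      then show "\<bar>c * f \<omega> / (\<bar>c\<bar> * (N + e) + e)\<bar> \<le> \<bar>f \<omega> / (N + e)\<bar>"
        using p by (simp add: abs_divide abs_mult divide_simps)
    qed
    also have "\<dots> \<le> 1" using modular_le_1[OF f, of "N + e"] that by (simp add: N_def)
    finally show ?thesis .
  qed
  have pos: "0 < \<bar>c\<bar> * (N + e) + e" if "e > 0" for e
    using N that by (auto intro!: add_nonneg_pos mult_nonneg_nonneg)
  show "(\<lambda>\<omega>. c * f \<omega>) \<in> elems (orlicz_space M \<Psi>)"
    using *[of 1] pos[of 1] by (auto simp: orlicz_space_iff)
  have "luxemburg_norm M \<Psi> (\<lambda>\<omega>. c * f \<omega>) \<le> \<bar>c\<bar> * N"
  proof (rule field_le_epsilon)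
    fix e :: real assume "e > 0"
    define d where "d = e / (\<bar>c\<bar> + 1)"
    have "d > 0" using \<open>e > 0\<close> by (simp add: d_def)
    have "d * (\<bar>c\<bar> + 1) = e" by (simp add: d_def)
    have "luxemburg_norm M \<Psi> (\<lambda>\<omega>. c * f \<omega>) \<le> \<bar>c\<bar> * (N + d) + d"
      using \<open>d > 0\<close> by (intro luxemburg_norm_le * pos)
    also have "\<dots> = \<bar>c\<bar> * N + d * (\<bar>c\<bar> + 1)" by (simp add: algebra_simps)
    also have "\<dots> = \<bar>c\<bar> * N + e" by (simp only: \<open>d * (\<bar>c\<bar> + 1) = e\<close>)
    finally show "luxemburg_norm M \<Psi> (\<lambda>\<omega>. c * f \<omega>) \<le> \<bar>c\<bar> * N + e" .
  qed
  then show "luxemburg_norm M \<Psi> (\<lambda>\<omega>. c * f \<omega>) \<le> \<bar>c\<bar> * luxemburg_norm M \<Psi> f"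
    by (simp add: N_def)
qed

end

locale convex_orlicz_function =
  fixes \<Phi> :: "real \<Rightarrow> real"
  assumes orlicz: "orlicz_function \<Phi>" and convex: "convex_on {0..} \<Phi>"
begin

lemma zero [simp]: "\<Phi> 0 = 0" and nonneg [simp]: "0 \<le> u \<Longrightarrow> 0 \<le> \<Phi> u"
  and mono: "0 \<le> u \<Longrightarrow> u \<le> v \<Longrightarrow> \<Phi> u \<le> \<Phi> v"
  using orlicz by (auto simp: orlicz_function_def mono_on_def)

lemma star_shaped: "0 \<le> t \<Longrightarrow> t \<le> 1 \<Longrightarrow> 0 \<le> u \<Longrightarrow> \<Phi> (t * u) \<le> t * \<Phi> u"
  using convex_onD[OF convex, of t 0 u] by simp

lemma continuous_abs: "continuous_on UNIV (\<lambda>u. \<Phi> \<bar>u\<bar>)"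
proof (rule continuous_at_imp_continuous_on, rule ballI)
  fix u :: real
  show "isCont (\<lambda>u. \<Phi> \<bar>u\<bar>) u"
  proof (cases "u = 0")
    case True
    have "(\<Phi> \<longlongrightarrow> 0) (at_right 0)"
      using orlicz by (auto simp: orlicz_function_def continuous_within)
    moreover have "filterlim abs (at_right 0) (at (0::real))"
      unfolding filterlim_at by (auto simp: eventually_at_filter intro!: tendsto_eq_intros)
    ultimately have "((\<lambda>u. \<Phi> \<bar>u\<bar>) \<longlongrightarrow> 0) (at 0)"
      by (rule filterlim_compose)
    then show ?thesis using True by (simp add: isCont_def)
  next
    case False
    have "isCont \<Phi> \<bar>u\<bar>"
      using orlicz False by (auto simp: orlicz_function_def continuous_on_eq_continuous_at)
    then show ?thesis by (rule isCont_o2[rotated]) (intro continuous_intros)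
  qed
qed

lemma borel_measurable_abs [measurable]: "(\<lambda>u. \<Phi> \<bar>u\<bar>) \<in> borel_measurable borel"
  by (rule borel_measurable_continuous_onI[OF continuous_abs])

text \<open>
  By continuity of \<open>\<Phi>\<close>, a countable dense set of arguments suffices in the supremum. This gives
  measurability of the complementary function, and it makes monotone convergence applicable in
  \<open>complementary_modular_le_1\<close> below.
\<close>

lemma complementary_countable_SUP:
  "\<exists>v :: nat \<Rightarrow> real. (\<forall>n. 0 \<le> v n) \<and>
     (\<forall>u. complementary \<Phi> u = (SUP n. ennreal (u * v n - \<Phi> (v n))))"
proof -
  obtain D :: "real set" where D: "countable D" "\<And>X. open X \<Longrightarrow> X \<noteq> {} \<Longrightarrow> \<exists>d\<in>D. d \<in> X"
    by (erule countable_dense_setE)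
  have "D \<noteq> {}" using D(2)[of UNIV] by auto
  define v where "v n = \<bar>from_nat_into D n\<bar>" for n
  have "complementary \<Phi> u = (SUP n. ennreal (u * v n - \<Phi> (v n)))" for u
  proof (rule antisym)
    show "complementary \<Phi> u \<le> (SUP n. ennreal (u * v n - \<Phi> (v n)))"
      unfolding complementary_def
    proof (rule SUP_least, rule dense_le)
      fix x y assume x: "x \<in> {0..}" and y: "y < ennreal (u * x - \<Phi> x)"
      then obtain r where r: "0 \<le> r" "y = ennreal r" "r < u * x - \<Phi> x"
        by (cases y) (auto simp: ennreal_less_iff ennreal_less_top top_unique)
      have "open ((\<lambda>x. u * \<bar>x\<bar> - \<Phi> \<bar>x\<bar>) -` {r<..})"
        by (intro open_vimage open_greaterThan continuous_intros continuous_abs)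
      moreover have "x \<in> (\<lambda>x. u * \<bar>x\<bar> - \<Phi> \<bar>x\<bar>) -` {r<..}" using x r by auto
      ultimately obtain d where d: "d \<in> D" "r < u * \<bar>d\<bar> - \<Phi> \<bar>d\<bar>" using D(2) by blast
      obtain n where n: "from_nat_into D n = d" using from_nat_into_surj[OF D(1) d(1)] by auto
      have "y \<le> ennreal (u * v n - \<Phi> (v n))"
        using d n r by (auto simp: v_def intro!: ennreal_leI)
      also have "\<dots> \<le> (SUP n. ennreal (u * v n - \<Phi> (v n)))" by (rule SUP_upper) simp
      finally show "y \<le> (SUP n. ennreal (u * v n - \<Phi> (v n)))" .
    qed
    show "(SUP n. ennreal (u * v n - \<Phi> (v n))) \<le> complementary \<Phi> u"
      unfolding complementary_def by (rule SUP_least, rule SUP_upper2[of "v _"]) (auto simp: v_def)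
  qed
  then show ?thesis by (intro exI[of _ v]) (auto simp: v_def)
qed

lemma Young: "0 \<le> v \<Longrightarrow> ennreal (u * v) \<le> ennreal (\<Phi> v) + complementary \<Phi> u"
proof -
  assume "0 \<le> v"
  then have "ennreal (u * v - \<Phi> v) \<le> complementary \<Phi> u"
    unfolding complementary_def by (intro SUP_upper) auto
  moreover have "ennreal (u * v) \<le> ennreal (\<Phi> v) + ennreal (u * v - \<Phi> v)"
    using \<open>0 \<le> v\<close> by (cases "\<Phi> v \<le> u * v") (auto simp flip: ennreal_plus intro!: ennreal_leI add_increasing2)
  ultimately show ?thesis by (meson add_left_mono order_trans)
qed

sublocale Phi: star_shaped_function "ennreal \<circ> \<Phi>"
proof
  fix t u :: real assume "0 \<le> t" "t \<le> 1" "0 \<le> u"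
  then show "(ennreal \<circ> \<Phi>) (t * u) \<le> ennreal t * (ennreal \<circ> \<Phi>) u"
    by (simp add: star_shaped ennreal_leI flip: ennreal_mult)
qed (auto intro!: ennreal_leI mono simp: comp_def)

sublocale compl: star_shaped_function "complementary \<Phi>"
proof
  obtain v :: "nat \<Rightarrow> real"
    where v: "\<And>u. complementary \<Phi> u = (SUP n. ennreal (u * v n - \<Phi> (v n)))"
    using complementary_countable_SUP by blast
  show "(\<lambda>u. complementary \<Phi> \<bar>u\<bar>) \<in> borel_measurable borel"
    unfolding v by measurable
next
  fix u u' :: real assume "0 \<le> u" "u \<le> u'"
  then show "complementary \<Phi> u \<le> complementary \<Phi> u'"
    unfolding complementary_def
  proof (intro SUP_least)
    fix v :: real assume v: "v \<in> {0..}"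
    have "ennreal (u * v - \<Phi> v) \<le> ennreal (u' * v - \<Phi> v)"
      using v \<open>u \<le> u'\<close> by (intro ennreal_leI) (simp add: mult_right_mono)
    also have "\<dots> \<le> (SUP v\<in>{0..}. ennreal (u' * v - \<Phi> v))" using v by (rule SUP_upper)
    finally show "ennreal (u * v - \<Phi> v) \<le> (SUP v\<in>{0..}. ennreal (u' * v - \<Phi> v))" .
  qed
next
  fix t u :: real assume t: "0 \<le> t" "t \<le> 1" and "0 \<le> u"
  show "complementary \<Phi> (t * u) \<le> ennreal t * complementary \<Phi> u"
    unfolding complementary_def
  proof (rule SUP_least)
    fix v :: real assume v: "v \<in> {0..}"
    have "t * \<Phi> v \<le> \<Phi> v" using t v mult_right_mono[of t 1 "\<Phi> v"] by simp
    then have "t * u * v - \<Phi> v \<le> t * (u * v - \<Phi> v)" by (simp add: algebra_simps)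
    then have "ennreal (t * u * v - \<Phi> v) \<le> ennreal t * ennreal (u * v - \<Phi> v)"
      using t by (simp add: ennreal_leI flip: ennreal_mult')
    also have "\<dots> \<le> ennreal t * (SUP v\<in>{0..}. ennreal (u * v - \<Phi> v))"
      using v by (intro mult_left_mono SUP_upper) auto
    finally show "ennreal (t * u * v - \<Phi> v) \<le> ennreal t * (SUP v\<in>{0..}. ennreal (u * v - \<Phi> v))" .
  qed
qed

lemma luxemburg_norm_triangle:
  assumes f: "f \<in> elems (orlicz_space M (ennreal \<circ> \<Phi>))" and g: "g \<in> elems (orlicz_space M (ennreal \<circ> \<Phi>))"
  shows "(\<lambda>\<omega>. f \<omega> + g \<omega>) \<in> elems (orlicz_space M (ennreal \<circ> \<Phi>))"
    and "luxemburg_norm M (ennreal \<circ> \<Phi>) (\<lambda>\<omega>. f \<omega> + g \<omega>) \<le>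
      luxemburg_norm M (ennreal \<circ> \<Phi>) f + luxemburg_norm M (ennreal \<circ> \<Phi>) g"
proof -
  let ?N = "luxemburg_norm M (ennreal \<circ> \<Phi>)" and ?I = "modular M (ennreal \<circ> \<Phi>)"
  have [measurable]: "f \<in> borel_measurable M" "g \<in> borel_measurable M"
    using f g by (auto simp: Phi.orlicz_space_iff)
  have *: "?I (\<lambda>\<omega>. (f \<omega> + g \<omega>) / (l + m)) \<le> 1" if l: "?N f < l" and m: "?N g < m" for l m
  proof -
    have pos: "0 < l" "0 < m" using l m Phi.luxemburg_norm_nonneg f g by force+
    define t where "t = m / (l + m)"
    have t: "0 \<le> t" "t \<le> 1" "1 - t = l / (l + m)" using pos by (auto simp: t_def field_simps)
    have "?I (\<lambda>\<omega>. (f \<omega> + g \<omega>) / (l + m)) \<le>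
        (\<integral>\<^sup>+\<omega>. ennreal (1 - t) * ennreal (\<Phi> \<bar>f \<omega> / l\<bar>) + ennreal t * ennreal (\<Phi> \<bar>g \<omega> / m\<bar>) \<partial>M)"
      unfolding modular_def comp_def
    proof (rule nn_integral_mono)
      fix \<omega>
      have "\<bar>(f \<omega> + g \<omega>) / (l + m)\<bar> \<le> (\<bar>f \<omega>\<bar> + \<bar>g \<omega>\<bar>) / (l + m)"
        using pos by (simp add: abs_divide divide_right_mono abs_triangle_ineq)
      also have "\<dots> = (1 - t) * \<bar>f \<omega> / l\<bar> + t * \<bar>g \<omega> / m\<bar>"
        using pos by (simp add: t(3) abs_divide) (simp add: t_def add_divide_distrib)
      finally have "\<Phi> \<bar>(f \<omega> + g \<omega>) / (l + m)\<bar> \<le> \<Phi> ((1 - t) * \<bar>f \<omega> / l\<bar> + t * \<bar>g \<omega> / m\<bar>)"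
        by (intro mono) auto
      also have "\<dots> \<le> (1 - t) * \<Phi> \<bar>f \<omega> / l\<bar> + t * \<Phi> \<bar>g \<omega> / m\<bar>"
        using convex_onD[OF convex, of t "\<bar>f \<omega> / l\<bar>" "\<bar>g \<omega> / m\<bar>"] t by simp
      finally show "ennreal (\<Phi> \<bar>(f \<omega> + g \<omega>) / (l + m)\<bar>) \<le>
          ennreal (1 - t) * ennreal (\<Phi> \<bar>f \<omega> / l\<bar>) + ennreal t * ennreal (\<Phi> \<bar>g \<omega> / m\<bar>)"
        using t(1,2) by (simp add: ennreal_leI del: abs_divide flip: ennreal_mult ennreal_plus)
    qed
    also have "\<dots> = ennreal (1 - t) * ?I (\<lambda>\<omega>. f \<omega> / l) + ennreal t * ?I (\<lambda>\<omega>. g \<omega> / m)"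
      unfolding modular_def comp_def
      by (simp add: nn_integral_add nn_integral_cmult del: abs_divide)
    also have "\<dots> \<le> ennreal (1 - t) * 1 + ennreal t * 1"
      using Phi.modular_le_1[OF f l] Phi.modular_le_1[OF g m] by (intro add_mono mult_left_mono) auto
    also have "\<dots> = 1" using t(1,2) by (simp flip: ennreal_plus)
    finally show ?thesis .
  qed
  have pos: "0 < l + m" if "?N f < l" and "?N g < m" for l m
    using that Phi.luxemburg_norm_nonneg[OF f] Phi.luxemburg_norm_nonneg[OF g] by linarith
  show "(\<lambda>\<omega>. f \<omega> + g \<omega>) \<in> elems (orlicz_space M (ennreal \<circ> \<Phi>))"
    using *[of "?N f + 1" "?N g + 1"] pos[of "?N f + 1" "?N g + 1"] unfolding Phi.orlicz_space_iff
    by (auto intro!: exI[of _ "?N f + 1 + (?N g + 1)"])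
  show "?N (\<lambda>\<omega>. f \<omega> + g \<omega>) \<le> ?N f + ?N g"
  proof (rule field_le_epsilon)
    fix e :: real assume "e > 0"
    have "?N (\<lambda>\<omega>. f \<omega> + g \<omega>) \<le> (?N f + e / 2) + (?N g + e / 2)"
      using \<open>e > 0\<close> by (intro Phi.luxemburg_norm_le * pos) auto
    then show "?N (\<lambda>\<omega>. f \<omega> + g \<omega>) \<le> ?N f + ?N g + e" by simp
  qed
qed

lemma nn_integral_mult_le_Young:
  assumes [measurable]: "g \<in> borel_measurable M" "h \<in> borel_measurable M"
    and l: "0 < l" "modular M (complementary \<Phi>) (\<lambda>\<omega>. g \<omega> / l) \<le> 1"
    and h: "modular M (ennreal \<circ> \<Phi>) h \<le> 1"
  shows "(\<integral>\<^sup>+\<omega>. ennreal \<bar>h \<omega> * g \<omega>\<bar> \<partial>M) \<le> ennreal (2 * l)"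
proof -
  have "(\<integral>\<^sup>+\<omega>. ennreal \<bar>h \<omega> * g \<omega>\<bar> \<partial>M) \<le>
      (\<integral>\<^sup>+\<omega>. ennreal l * (ennreal (\<Phi> \<bar>h \<omega>\<bar>) + complementary \<Phi> \<bar>g \<omega> / l\<bar>) \<partial>M)"
  proof (rule nn_integral_mono)
    fix \<omega>
    have "ennreal \<bar>h \<omega> * g \<omega>\<bar> = ennreal l * ennreal (\<bar>g \<omega> / l\<bar> * \<bar>h \<omega>\<bar>)"
      using l by (simp add: abs_mult flip: ennreal_mult)
    also have "\<dots> \<le> ennreal l * (ennreal (\<Phi> \<bar>h \<omega>\<bar>) + complementary \<Phi> \<bar>g \<omega> / l\<bar>)"
      by (intro mult_left_mono Young) auto
    finally show "ennreal \<bar>h \<omega> * g \<omega>\<bar> \<le> \<dots>" .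
  qed
  also have "\<dots> = ennreal l * (modular M (ennreal \<circ> \<Phi>) h + modular M (complementary \<Phi>) (\<lambda>\<omega>. g \<omega> / l))"
    unfolding modular_def comp_def by (simp add: nn_integral_cmult nn_integral_add del: abs_divide)
  also have "\<dots> \<le> ennreal l * (1 + 1)" using l h by (intro mult_left_mono add_mono) auto
  also have "\<dots> = ennreal (2 * l)" using l by (simp add: ennreal_mult mult.commute)
  finally show ?thesis .
qed

text \<open>
  The Orlicz norm is a supremum of real numbers, and hence meaningful only when the set is bounded
  above; Young's inequality provides the bound together with one half of the equivalence of the
  two norms.
\<close>

lemma orlicz_norm_bdd:
  assumes g: "g \<in> elems (orlicz_space M (complementary \<Phi>))"
    and h [measurable]: "h \<in> borel_measurable M" and mod: "modular M (ennreal \<circ> \<Phi>) h \<le> 1"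
  shows "integrable M (\<lambda>\<omega>. g \<omega> * h \<omega>)"
    and "(\<integral>\<omega>. g \<omega> * h \<omega> \<partial>M) \<le> 2 * luxemburg_norm M (complementary \<Phi>) g"
proof -
  let ?N = "luxemburg_norm M (complementary \<Phi>) g"
  have [measurable]: "g \<in> borel_measurable M" using g by (simp add: compl.orlicz_space_iff)
  have le: "(\<integral>\<^sup>+\<omega>. ennreal \<bar>h \<omega> * g \<omega>\<bar> \<partial>M) \<le> ennreal (2 * l)" if "?N < l" for l
    using compl.modular_le_1[OF g that] compl.luxemburg_norm_nonneg[OF g] that mod
    by (intro nn_integral_mult_le_Young) auto
  show int: "integrable M (\<lambda>\<omega>. g \<omega> * h \<omega>)"
    unfolding integrable_iff_bounded using le[of "?N + 1"]
    by (auto simp: mult.commute intro: le_less_trans[OF _ ennreal_less_top])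
  show "(\<integral>\<omega>. g \<omega> * h \<omega> \<partial>M) \<le> 2 * ?N"
  proof (rule dense_ge)
    fix x assume "2 * ?N < x"
    then have "?N < x / 2" by simp
    have "0 \<le> x" using \<open>2 * ?N < x\<close> compl.luxemburg_norm_nonneg[OF g] by simp
    have "(\<integral>\<omega>. g \<omega> * h \<omega> \<partial>M) \<le> (\<integral>\<omega>. \<bar>g \<omega> * h \<omega>\<bar> \<partial>M)"
      using int by (intro integral_mono) auto
    also have "\<dots> = enn2real (\<integral>\<^sup>+\<omega>. ennreal \<bar>h \<omega> * g \<omega>\<bar> \<partial>M)"
      by (subst integral_eq_nn_integral) (auto simp: mult.commute)
    also have "\<dots> \<le> x"
      using le[OF \<open>?N < x / 2\<close>] \<open>0 \<le> x\<close> by (intro enn2real_leI) auto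
    finally show "(\<integral>\<omega>. g \<omega> * h \<omega> \<partial>M) \<le> x" .
  qed
qed

lemma orlicz_norm_le_luxemburg:
  assumes "g \<in> elems (orlicz_space M (complementary \<Phi>))"
  shows "orlicz_norm_complementary M \<Phi> g \<le> 2 * luxemburg_norm M (complementary \<Phi>) g"
  unfolding orlicz_norm_complementary_def
  using orlicz_norm_bdd(2)[OF assms]
  by (intro cSUP_least) (auto intro!: exI[of _ "\<lambda>_. 0"] simp: modular_def)

lemma bdd_above_orlicz_norm:
  assumes "g \<in> elems (orlicz_space M (complementary \<Phi>))"
  shows "bdd_above ((\<lambda>h. \<integral>\<omega>. g \<omega> * h \<omega> \<partial>M) `
    {h \<in> borel_measurable M. modular M (ennreal \<circ> \<Phi>) h \<le> 1})"
  using orlicz_norm_bdd(2)[OF assms] by (intro bdd_aboveI2) auto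

text \<open>
  The set of test functions in the Orlicz norm is invariant under changes of sign, so that the
  absolute value may be taken inside of the integral.
\<close>

lemma orlicz_norm_upper:
  assumes g: "g \<in> elems (orlicz_space M (complementary \<Phi>))"
    and h [measurable]: "h \<in> borel_measurable M" and mod: "modular M (ennreal \<circ> \<Phi>) h \<le> 1"
  shows "(\<integral>\<^sup>+\<omega>. ennreal \<bar>h \<omega> * g \<omega>\<bar> \<partial>M) \<le> ennreal (orlicz_norm_complementary M \<Phi> g)"
proof -
  have [measurable]: "g \<in> borel_measurable M" using g by (simp add: compl.orlicz_space_iff)
  define h' where "h' = (\<lambda>\<omega>. \<bar>h \<omega>\<bar> * sgn (g \<omega>))"
  have [measurable]: "h' \<in> borel_measurable M" unfolding h'_def by measurable
  have mod': "modular M (ennreal \<circ> \<Phi>) h' \<le> 1"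
    using Phi.modular_mono[of h' h M] mod by (auto simp: h'_def abs_mult abs_sgn_eq intro: order_trans)
  have eq: "g \<omega> * h' \<omega> = \<bar>h \<omega> * g \<omega>\<bar>" for \<omega>
    by (auto simp: h'_def abs_mult abs_sgn sgn_mult algebra_simps)
  have "(\<integral>\<^sup>+\<omega>. ennreal \<bar>h \<omega> * g \<omega>\<bar> \<partial>M) = ennreal (\<integral>\<omega>. g \<omega> * h' \<omega> \<partial>M)"
    using orlicz_norm_bdd(1)[OF g _ mod'] unfolding eq
    by (intro nn_integral_eq_integral) auto
  also have "\<dots> \<le> ennreal (orlicz_norm_complementary M \<Phi> g)"
    unfolding orlicz_norm_complementary_def using mod' bdd_above_orlicz_norm[OF g]
    by (intro ennreal_leI cSUP_upper) auto
  finally show ?thesis .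
qed

lemma orlicz_norm_nonneg:
  assumes g: "g \<in> elems (orlicz_space M (complementary \<Phi>))"
  shows "0 \<le> orlicz_norm_complementary M \<Phi> g"
proof -
  have "(\<integral>\<omega>. g \<omega> * 0 \<partial>M) \<le> orlicz_norm_complementary M \<Phi> g"
    unfolding orlicz_norm_complementary_def using bdd_above_orlicz_norm[OF g]
    by (intro cSUP_upper2[where x = "\<lambda>_. 0"]) (auto simp: modular_def)
  then show ?thesis by simp
qed

text \<open>
  For every \<open>d > 0\<close>, the function \<open>f / (\<parallel>f\<parallel> + d)\<close> has modular at most \<open>1\<close> and is thus admissible in the
  Orlicz norm of \<open>g\<close>.
\<close>

lemma orlicz_Holder:
  assumes f: "f \<in> elems (orlicz_space M (ennreal \<circ> \<Phi>))"
    and g: "g \<in> elems (orlicz_space M (complementary \<Phi>))"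
  shows "(\<integral>\<^sup>+\<omega>. ennreal \<bar>f \<omega> * g \<omega>\<bar> \<partial>M) \<le>
    ennreal (luxemburg_norm M (ennreal \<circ> \<Phi>) f * orlicz_norm_complementary M \<Phi> g)"
proof (rule ennreal_le_epsilon)
  let ?N = "luxemburg_norm M (ennreal \<circ> \<Phi>) f" and ?O = "orlicz_norm_complementary M \<Phi> g"
  have [measurable]: "f \<in> borel_measurable M" "g \<in> borel_measurable M"
    using f g by (auto simp: Phi.orlicz_space_iff compl.orlicz_space_iff)
  have N: "0 \<le> ?N" and O: "0 \<le> ?O"
    using Phi.luxemburg_norm_nonneg[OF f] orlicz_norm_nonneg[OF g] by auto
  fix e :: real assume "0 < e"
  define d where "d = e / (?O + 1)"
  have d: "0 < d" "d * ?O \<le> e" using O \<open>0 < e\<close> by (auto simp: d_def field_simps)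
  have "(\<integral>\<^sup>+\<omega>. ennreal \<bar>f \<omega> * g \<omega>\<bar> \<partial>M) =
      (\<integral>\<^sup>+\<omega>. ennreal (?N + d) * ennreal \<bar>f \<omega> / (?N + d) * g \<omega>\<bar> \<partial>M)"
    using N d by (intro nn_integral_cong) (simp add: abs_mult abs_divide del: ennreal_plus flip: ennreal_mult)
  also have "\<dots> = ennreal (?N + d) * (\<integral>\<^sup>+\<omega>. ennreal \<bar>f \<omega> / (?N + d) * g \<omega>\<bar> \<partial>M)"
    by (rule nn_integral_cmult) measurable
  also have "\<dots> \<le> ennreal (?N + d) * ennreal ?O"
    using Phi.modular_le_1[OF f, of "?N + d"] d by (intro mult_left_mono orlicz_norm_upper[OF g]) auto
  also have "\<dots> = ennreal (?N * ?O + d * ?O)"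
    using N O d by (simp add: algebra_simps flip: ennreal_mult)
  also have "\<dots> \<le> ennreal (?N * ?O + e)" using d by (intro ennreal_leI) auto
  also have "\<dots> = ennreal (?N * ?O) + ennreal e" using N O \<open>0 < e\<close> by simp
  finally show "(\<integral>\<^sup>+\<omega>. ennreal \<bar>f \<omega> * g \<omega>\<bar> \<partial>M) \<le> ennreal (?N * ?O) + ennreal e" .
qed

end

locale orlicz_finite_measure = finite_measure M + convex_orlicz_function \<Phi>
  for M :: "'a measure" and \<Phi> :: "real \<Rightarrow> real"
begin

lemma modular_bounded_finite:
  assumes "\<And>\<omega>. \<omega> \<in> space M \<Longrightarrow> \<bar>f \<omega>\<bar> \<le> B"
  shows "modular M (ennreal \<circ> \<Phi>) f < \<infinity>"
proof -
  have "modular M (ennreal \<circ> \<Phi>) f \<le> (\<integral>\<^sup>+\<omega>. ennreal (\<Phi> B) \<partial>M)"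
    unfolding modular_def using assms by (intro nn_integral_mono) (auto intro!: ennreal_leI mono)
  also have "\<dots> < \<infinity>" by (simp add: less_top[symmetric] ennreal_mult_eq_top_iff)
  finally show ?thesis .
qed

lemma const_in_orlicz_space: "(\<lambda>_. c) \<in> elems (orlicz_space M (ennreal \<circ> \<Phi>))"
  using modular_bounded_finite[of "\<lambda>_. c" "\<bar>c\<bar>"]
  by (auto simp: orlicz_space_def intro!: exI[of _ 1])

text \<open>
  Write \<open>\<Phi>* u = sup\<^sub>n (u v\<^sub>n - \<Phi> v\<^sub>n)\<close> with a sequence \<open>v\<close>. Let \<open>F\<^sub>n\<close> be the simple function that chooses at each
  point one of \<open>0, v\<^sub>0, \<dots>, v\<^sub>n\<^sub>-\<^sub>1\<close> for which \<open>D\<^sub>n = \<bar>g / c\<bar> F\<^sub>n - \<Phi> F\<^sub>n\<close> is largest. Then \<open>D\<^sub>n\<close> increases to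
  \<open>\<Phi>* \<bar>g / c\<bar>\<close>, and it is enough to see that \<open>\<integral>D\<^sub>n \<le> 1\<close>. Let \<open>r\<close> be the modular of \<open>F\<^sub>n\<close>, which is finite
  as \<open>F\<^sub>n\<close> is bounded and the measure is finite, and let \<open>m = max 1 r\<close>. By convexity \<open>F\<^sub>n / m\<close> has
  modular at most \<open>1\<close>, so the hypothesis yields \<open>\<integral>D\<^sub>n + r = \<integral>\<bar>g / c\<bar> F\<^sub>n \<le> m\<close>, which implies
  \<open>\<integral>D\<^sub>n \<le> max 1 r - r \<le> 1\<close>.
\<close>

lemma complementary_modular_le_1:
  assumes g [measurable]: "g \<in> borel_measurable M" and c: "0 < c"
    and bound: "\<And>f. f \<in> borel_measurable M \<Longrightarrow> modular M (ennreal \<circ> \<Phi>) f \<le> 1 \<Longrightarrow>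
      (\<integral>\<^sup>+\<omega>. ennreal \<bar>f \<omega> * g \<omega>\<bar> \<partial>M) \<le> ennreal c"
  shows "modular M (complementary \<Phi>) (\<lambda>\<omega>. g \<omega> / c) \<le> 1"
proof -
  obtain v :: "nat \<Rightarrow> real" where "(\<forall>n. 0 \<le> v n) \<and>
      (\<forall>u. complementary \<Phi> u = (SUP n. ennreal (u * v n - \<Phi> (v n))))"
    using complementary_countable_SUP ..
  then have v: "\<And>n. 0 \<le> v n" "\<And>u. complementary \<Phi> u = (SUP n. ennreal (u * v n - \<Phi> (v n)))"
    by simp_all
  define G where "G \<omega> x = \<bar>g \<omega> / c\<bar> * x - \<Phi> \<bar>x\<bar>" for \<omega> x
  \<comment> \<open>the running maximiser: \<open>v n\<close> replaces the current value where it is better\<close>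
  define F where "F = rec_nat (\<lambda>\<omega>. 0) (\<lambda>n F \<omega>. if G \<omega> (F \<omega>) < G \<omega> (v n) then v n else F \<omega>)"
  have F0: "F 0 \<omega> = 0" and FS: "F (Suc n) \<omega> = (if G \<omega> (F n \<omega>) < G \<omega> (v n) then v n else F n \<omega>)" for n \<omega>
    by (simp_all add: F_def)
  define D where "D n \<omega> = G \<omega> (F n \<omega>)" for n \<omega>
  have F_meas [measurable]: "F n \<in> borel_measurable M" for n
  proof (induction n)
    case (Suc n)
    note [measurable] = this
    show ?case unfolding FS G_def by measurable
  qed (simp add: F0)
  have [measurable]: "D n \<in> borel_measurable M" for n unfolding D_def G_def by measurable
  have F_nonneg: "0 \<le> F n \<omega>" for n \<omega> by (induction n) (auto simp: F0 FS v(1))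
  have F_bound: "F n \<omega> \<le> (\<Sum>i<n. v i)" for n \<omega>
  proof (induction n)
    case (Suc n)
    then show ?case using sum_nonneg[of "{..<n}" v] by (simp add: FS v(1) add_increasing2)
  qed (simp add: F0)
  have D_mono: "D n \<omega> \<le> D (Suc n) \<omega>" and D_ge: "G \<omega> (v n) \<le> D (Suc n) \<omega>" for n \<omega>
    by (auto simp: D_def FS)
  have D_incseq: "incseq (\<lambda>n. D n \<omega>)" for \<omega> by (rule incseq_SucI) (rule D_mono)
  have "0 = D 0 \<omega>" for \<omega> by (simp add: D_def F0 G_def)
  then have D_nonneg: "0 \<le> D n \<omega>" for n \<omega> using incseqD[OF D_incseq, of 0 n] by simp
  have compl_eq: "complementary \<Phi> \<bar>g \<omega> / c\<bar> = (SUP n. ennreal (D n \<omega>))" for \<omega>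
  proof (rule antisym)
    show "complementary \<Phi> \<bar>g \<omega> / c\<bar> \<le> (SUP n. ennreal (D n \<omega>))"
      unfolding v(2)
    proof (rule SUP_least)
      fix n
      have "ennreal (\<bar>g \<omega> / c\<bar> * v n - \<Phi> (v n)) \<le> ennreal (D (Suc n) \<omega>)"
        using D_ge[of \<omega> n] v(1)[of n] by (intro ennreal_leI) (simp add: G_def)
      also have "\<dots> \<le> (SUP n. ennreal (D n \<omega>))" by (rule SUP_upper) simp
      finally show "ennreal (\<bar>g \<omega> / c\<bar> * v n - \<Phi> (v n)) \<le> (SUP n. ennreal (D n \<omega>))" .
    qed
    show "(SUP n. ennreal (D n \<omega>)) \<le> complementary \<Phi> \<bar>g \<omega> / c\<bar>"
    proof (rule SUP_least)
      fix n
      show "ennreal (D n \<omega>) \<le> complementary \<Phi> \<bar>g \<omega> / c\<bar>"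
        unfolding complementary_def using F_nonneg[of n \<omega>]
        by (intro SUP_upper2[of "F n \<omega>"]) (auto simp: D_def G_def)
    qed
  qed
  have le_1: "(\<integral>\<^sup>+\<omega>. ennreal (D n \<omega>) \<partial>M) \<le> 1" for n
  proof -
    let ?P = "modular M (ennreal \<circ> \<Phi>) (F n)"
    have "?P < \<infinity>"
      using F_nonneg F_bound by (intro modular_bounded_finite[of _ "\<Sum>i<n. v i"]) auto
    then obtain r where r: "0 \<le> r" "?P = ennreal r" by (cases ?P) auto
    \<comment> \<open>dividing by \<open>m\<close> makes \<open>F n\<close> admissible, whether or not its modular exceeds \<open>1\<close>\<close>
    define m where "m = max 1 r"
    have m: "1 \<le> m" "?P \<le> ennreal m" using r by (auto simp: m_def intro!: ennreal_leI)
    have "(\<integral>\<^sup>+\<omega>. ennreal (D n \<omega>) \<partial>M) + ?P = (\<integral>\<^sup>+\<omega>. ennreal (D n \<omega>) + ennreal (\<Phi> \<bar>F n \<omega>\<bar>) \<partial>M)"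
      unfolding modular_def comp_def by (subst nn_integral_add) auto
    also have "\<dots> = (\<integral>\<^sup>+\<omega>. ennreal (m / c) * ennreal \<bar>F n \<omega> / m * g \<omega>\<bar> \<partial>M)"
      using D_nonneg c m F_nonneg
      by (intro nn_integral_cong)
        (simp add: D_def G_def abs_mult abs_divide field_simps flip: ennreal_plus ennreal_mult)
    also have "\<dots> = ennreal (m / c) * (\<integral>\<^sup>+\<omega>. ennreal \<bar>F n \<omega> / m * g \<omega>\<bar> \<partial>M)"
      by (rule nn_integral_cmult) measurable
    also have "\<dots> \<le> ennreal (m / c) * ennreal c"
      using m by (intro mult_left_mono bound Phi.modular_divide_le_1) auto
    also have "\<dots> = ennreal m" using c m by (simp flip: ennreal_mult)
    finally have le: "(\<integral>\<^sup>+\<omega>. ennreal (D n \<omega>) \<partial>M) + ennreal r \<le> ennreal m" by (simp add: r)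
    then obtain s where s: "0 \<le> s" "(\<integral>\<^sup>+\<omega>. ennreal (D n \<omega>) \<partial>M) = ennreal s"
      by (cases "\<integral>\<^sup>+\<omega>. ennreal (D n \<omega>) \<partial>M") (auto simp: top_unique)
    have "s + r \<le> m" using le r s m by (simp flip: ennreal_plus)
    then have "s \<le> 1" using r by (auto simp: m_def)
    then show ?thesis using s by (simp add: ennreal_le_1)
  qed
  have "modular M (complementary \<Phi>) (\<lambda>\<omega>. g \<omega> / c) = (\<integral>\<^sup>+\<omega>. (SUP n. ennreal (D n \<omega>)) \<partial>M)"
    by (simp add: modular_def compl_eq del: abs_divide)
  also have "\<dots> = (SUP n. \<integral>\<^sup>+\<omega>. ennreal (D n \<omega>) \<partial>M)"
    using incseqD[OF D_incseq]
    by (intro nn_integral_monotone_convergence_SUP) (auto simp: incseq_def le_fun_def intro!: ennreal_leI)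
  also have "\<dots> \<le> 1" by (rule SUP_least) (rule le_1)
  finally show ?thesis .
qed

lemma complementary_orlicz_spaceI:
  assumes g: "g \<in> borel_measurable M" and c: "0 \<le> c"
    and bound: "\<And>f. f \<in> borel_measurable M \<Longrightarrow> modular M (ennreal \<circ> \<Phi>) f \<le> 1 \<Longrightarrow>
      (\<integral>\<^sup>+\<omega>. ennreal \<bar>f \<omega> * g \<omega>\<bar> \<partial>M) \<le> ennreal c"
  shows "g \<in> elems (orlicz_space M (complementary \<Phi>))"
    and "luxemburg_norm M (complementary \<Phi>) g \<le> c"
proof -
  have *: "modular M (complementary \<Phi>) (\<lambda>\<omega>. g \<omega> / d) \<le> 1" if "c < d" for d
  proof (rule complementary_modular_le_1[OF g])
    fix f assume "f \<in> borel_measurable M" "modular M (ennreal \<circ> \<Phi>) f \<le> 1"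
    then have "(\<integral>\<^sup>+\<omega>. ennreal \<bar>f \<omega> * g \<omega>\<bar> \<partial>M) \<le> ennreal c" by (rule bound)
    also have "\<dots> \<le> ennreal d" using that by (intro ennreal_leI) simp
    finally show "(\<integral>\<^sup>+\<omega>. ennreal \<bar>f \<omega> * g \<omega>\<bar> \<partial>M) \<le> ennreal d" .
  qed (use that c in simp)
  show "g \<in> elems (orlicz_space M (complementary \<Phi>))"
    using g c *[of "c + 1"] by (auto simp: compl.orlicz_space_iff intro!: exI[of _ "c + 1"])
  show "luxemburg_norm M (complementary \<Phi>) g \<le> c"
  proof (rule dense_ge)
    fix d assume "c < d"
    then show "luxemburg_norm M (complementary \<Phi>) g \<le> d"
      using * c by (intro compl.luxemburg_norm_le) auto
  qed
qed

lemma luxemburg_le_orlicz_norm: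
  assumes g: "g \<in> elems (orlicz_space M (complementary \<Phi>))"
  shows "luxemburg_norm M (complementary \<Phi>) g \<le> orlicz_norm_complementary M \<Phi> g"
  using g orlicz_norm_upper[OF g] orlicz_norm_nonneg[OF g]
  by (intro complementary_orlicz_spaceI) (auto simp: compl.orlicz_space_iff)

text \<open>
  Doubling the argument multiplies the modular by at most \<open>\<bar>K\<bar>\<close>, up to the contribution of the small
  arguments, which is at most \<open>\<Phi> (2 u\<^sub>0)\<close> times the total mass.
\<close>

lemma modular_finite:
  assumes d2: "delta2_large \<Phi>" and f: "f \<in> elems (orlicz_space M (ennreal \<circ> \<Phi>))"
  shows "modular M (ennreal \<circ> \<Phi>) (\<lambda>\<omega>. f \<omega> / l) < \<infinity>"
proof -
  let ?I = "modular M (ennreal \<circ> \<Phi>)"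
  have [measurable]: "f \<in> borel_measurable M" using f by (simp add: Phi.orlicz_space_iff)
  obtain K u0 where K: "0 \<le> u0" "\<And>u. u0 \<le> u \<Longrightarrow> \<Phi> (2 * u) \<le> K * \<Phi> u"
    using d2 by (auto simp: delta2_large_def)
  have K': "\<Phi> (2 * u) \<le> \<bar>K\<bar> * \<Phi> u + \<Phi> (2 * u0)" if "0 \<le> u" for u
  proof (cases "u0 \<le> u")
    case True
    have "\<Phi> (2 * u) \<le> \<bar>K\<bar> * \<Phi> u"
      using K(2)[OF True] that by (intro order_trans[OF K(2)[OF True]] mult_right_mono) auto
    then show ?thesis using K by (simp add: add_increasing2)
  next
    case False
    then have "\<Phi> (2 * u) \<le> \<Phi> (2 * u0)" using that by (intro mono) auto
    then show ?thesis using that by (simp add: add_increasing)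
  qed
  have double: "?I (\<lambda>\<omega>. 2 * h \<omega>) < \<infinity>" if [measurable]: "h \<in> borel_measurable M" and fin: "?I h < \<infinity>" for h
  proof -
    have "?I (\<lambda>\<omega>. 2 * h \<omega>) \<le> (\<integral>\<^sup>+\<omega>. ennreal \<bar>K\<bar> * ennreal (\<Phi> \<bar>h \<omega>\<bar>) + ennreal (\<Phi> (2 * u0)) \<partial>M)"
      unfolding modular_def comp_def using K' K
      by (intro nn_integral_mono) (simp add: abs_mult ennreal_leI flip: ennreal_mult ennreal_plus)
    also have "\<dots> = ennreal \<bar>K\<bar> * ?I h + ennreal (\<Phi> (2 * u0)) * emeasure M (space M)"
      unfolding modular_def comp_def by (simp add: nn_integral_add nn_integral_cmult)
    also have "\<dots> < \<infinity>"
      using fin by (simp add: less_top[symmetric] ennreal_mult_eq_top_iff)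
    finally show ?thesis .
  qed
  obtain s where s: "0 < s" "?I (\<lambda>\<omega>. s * f \<omega>) < \<infinity>" using f by (auto simp: orlicz_space_def)
  have pow: "?I (\<lambda>\<omega>. 2 ^ n * s * f \<omega>) < \<infinity>" for n
  proof (induction n)
    case (Suc n)
    then show ?case using double[OF _ Suc] by (simp add: mult.assoc comp_def)
  qed (use s in \<open>simp add: comp_def\<close>)
  obtain n where "\<bar>1 / l\<bar> / s < 2 ^ n" using real_arch_pow[of 2] by auto
  then have n: "\<bar>1 / l\<bar> \<le> 2 ^ n * s" using s by (simp only: pos_divide_less_eq less_imp_le)
  have "?I (\<lambda>\<omega>. f \<omega> / l) \<le> ?I (\<lambda>\<omega>. 2 ^ n * s * f \<omega>)"
  proof (intro Phi.modular_mono AE_I2)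
    fix \<omega>
    have "\<bar>f \<omega> / l\<bar> = \<bar>1 / l\<bar> * \<bar>f \<omega>\<bar>" by (simp add: abs_divide)
    also have "\<dots> \<le> 2 ^ n * s * \<bar>f \<omega>\<bar>" by (intro mult_right_mono n) auto
    also have "\<dots> = \<bar>2 ^ n * s * f \<omega>\<bar>" using s by (simp add: abs_mult)
    finally show "\<bar>f \<omega> / l\<bar> \<le> \<bar>2 ^ n * s * f \<omega>\<bar>" .
  qed
  with pow[of n] show ?thesis by (simp add: order.strict_trans1)
qed

text \<open>
  All modulars of the majorant are finite by the \<open>\<Delta>\<^sub>2\<close> condition. Dominated convergence thus applies to
  \<open>\<Phi> \<bar>F\<^sub>n / e\<bar>\<close> for every \<open>e > 0\<close>, and norm convergence follows as soon as these integrals are below \<open>1\<close>.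
\<close>

lemma luxemburg_norm_dominated_convergence:
  assumes d2: "delta2_large \<Phi>" and f: "f \<in> elems (orlicz_space M (ennreal \<circ> \<Phi>))"
    and F: "\<And>n. F n \<in> borel_measurable M" and le: "\<And>n. AE \<omega> in M. \<bar>F n \<omega>\<bar> \<le> \<bar>f \<omega>\<bar>"
    and lim: "AE \<omega> in M. (\<lambda>n. F n \<omega>) \<longlonglongrightarrow> 0"
  shows "(\<lambda>n. luxemburg_norm M (ennreal \<circ> \<Phi>) (F n)) \<longlonglongrightarrow> 0"
proof (rule order_tendstoI)
  let ?N = "luxemburg_norm M (ennreal \<circ> \<Phi>)"
  note [measurable] = F
  have [measurable]: "f \<in> borel_measurable M" using f by (simp add: Phi.orlicz_space_iff)
  have FL: "F n \<in> elems (orlicz_space M (ennreal \<circ> \<Phi>))" for n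
    by (rule Phi.orlicz_space_mono[OF f F le])
  {
    fix x :: real assume "x < 0"
    then have "x < ?N (F n)" for n using Phi.luxemburg_norm_nonneg[OF FL] by (rule less_le_trans)
    then show "\<forall>\<^sub>F n in sequentially. x < ?N (F n)" by simp
  next
    fix x :: real assume "0 < x"
    define e where "e = x / 2"
    have e: "0 < e" "e < x" using \<open>0 < x\<close> by (auto simp: e_def)
    have "(\<lambda>n. \<integral>\<^sup>+\<omega>. ennreal (\<Phi> \<bar>F n \<omega> / e\<bar>) \<partial>M) \<longlonglongrightarrow> (\<integral>\<^sup>+\<omega>. 0 \<partial>M)"
    proof (rule nn_integral_dominated_convergence[where w = "\<lambda>\<omega>. ennreal (\<Phi> \<bar>f \<omega> / e\<bar>)"])
      show "AE \<omega> in M. ennreal (\<Phi> \<bar>F n \<omega> / e\<bar>) \<le> ennreal (\<Phi> \<bar>f \<omega> / e\<bar>)" for n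
        using le[of n] e by (auto simp: abs_divide divide_right_mono intro!: ennreal_leI mono)
      show "(\<integral>\<^sup>+\<omega>. ennreal (\<Phi> \<bar>f \<omega> / e\<bar>) \<partial>M) < \<infinity>"
        using modular_finite[OF d2 f, of e] by (simp add: modular_def)
      show "AE \<omega> in M. (\<lambda>n. ennreal (\<Phi> \<bar>F n \<omega> / e\<bar>)) \<longlonglongrightarrow> 0"
        using lim
      proof eventually_elim
        fix \<omega> assume "(\<lambda>n. F n \<omega>) \<longlonglongrightarrow> 0"
        then have "(\<lambda>n. F n \<omega> / e) \<longlonglongrightarrow> 0" using tendsto_divide[of _ 0 _ "\<lambda>_. e" e] e by simp
        then have "(\<lambda>n. \<Phi> \<bar>F n \<omega> / e\<bar>) \<longlonglongrightarrow> \<Phi> \<bar>0\<bar>"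
          using continuous_on_tendsto_compose[OF continuous_abs, of "\<lambda>n. F n \<omega> / e" 0] by simp
        then show "(\<lambda>n. ennreal (\<Phi> \<bar>F n \<omega> / e\<bar>)) \<longlonglongrightarrow> 0"
          using tendsto_ennrealI by fastforce
      qed
    qed measurable
    then have "\<forall>\<^sub>F n in sequentially. (\<integral>\<^sup>+\<omega>. ennreal (\<Phi> \<bar>F n \<omega> / e\<bar>) \<partial>M) < 1"
      by (intro order_tendstoD(2)[where y = 0]) auto
    then show "\<forall>\<^sub>F n in sequentially. ?N (F n) < x"
    proof eventually_elim
      case (elim n)
      then have "?N (F n) \<le> e"
        using e by (intro Phi.luxemburg_norm_le) (auto simp: modular_def)
      with e show ?case by simp
    qed
  }
qed

end

section \<open>The Radon-Nikodym theorem for finite signed measures\<close>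

text \<open>
  For a finite signed measure this is the positive part in its Jordan decomposition.
\<close>

definition positive_variation :: "'a measure \<Rightarrow> ('a set \<Rightarrow> real) \<Rightarrow> 'a set \<Rightarrow> ennreal" where
  "positive_variation M \<nu> A = (SUP B\<in>{B \<in> sets M. B \<subseteq> A}. ennreal (\<nu> B))"

locale finite_signed_measure =
  fixes M :: "'a measure" and \<nu> :: "'a set \<Rightarrow> real" and C :: real
  assumes sums: "range A \<subseteq> sets M \<Longrightarrow> disjoint_family A \<Longrightarrow> (\<lambda>n. \<nu> (A n)) sums \<nu> (\<Union>n. A n)"
    and bounded: "B \<in> sets M \<Longrightarrow> \<bar>\<nu> B\<bar> \<le> C"
begin

lemma empty [simp]: "\<nu> {} = 0"
proof -
  have "(\<lambda>n. \<nu> {}) sums \<nu> {}" using sums[of "\<lambda>_. {}"] by (simp add: disjoint_family_on_def)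
  then have "(\<lambda>n. \<nu> {}) \<longlonglongrightarrow> 0" using sums_summable summable_LIMSEQ_zero by blast
  then show ?thesis by (simp add: LIMSEQ_const_iff)
qed

lemma additive:
  assumes "A \<in> sets M" "B \<in> sets M" "A \<inter> B = {}"
  shows "\<nu> (A \<union> B) = \<nu> A + \<nu> B"
proof -
  have "disjoint_family (binaryset A B)"
    using assms by (auto simp: disjoint_family_on_def binaryset_def)
  then have "(\<lambda>n. \<nu> (binaryset A B n)) sums \<nu> (A \<union> B)"
    using sums[of "binaryset A B"] assms by (simp add: UN_binaryset_eq range_binaryset_eq)
  moreover have "(\<lambda>n. \<nu> (binaryset A B n)) sums (\<nu> A + \<nu> B)" by (rule binaryset_sums) simp
  ultimately show ?thesis by (rule sums_unique2)
qed

lemma uminus: "finite_signed_measure M (\<lambda>A. - \<nu> A) C"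
  by standard (auto intro!: sums_minus sums bounded)

abbreviation pos :: "'a set \<Rightarrow> ennreal" where
  "pos \<equiv> positive_variation M \<nu>"

lemma pos_mono: "A \<subseteq> B \<Longrightarrow> pos A \<le> pos B"
  unfolding positive_variation_def by (intro SUP_subset_mono) auto

lemma pos_upper: "B \<in> sets M \<Longrightarrow> B \<subseteq> A \<Longrightarrow> ennreal (\<nu> B) \<le> pos A"
  unfolding positive_variation_def by (intro SUP_upper) auto

lemma pos_empty [simp]: "pos {} = 0"
proof -
  have "{B \<in> sets M. B \<subseteq> {}} = {{}}" by auto
  then show ?thesis by (simp add: positive_variation_def)
qed

lemma pos_le: "pos A \<le> ennreal C"
  unfolding positive_variation_def
proof (rule SUP_least)
  fix B assume "B \<in> {B \<in> sets M. B \<subseteq> A}"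
  then have "\<bar>\<nu> B\<bar> \<le> C" by (intro bounded) auto
  then show "ennreal (\<nu> B) \<le> ennreal C" by (intro ennreal_leI) auto
qed

lemma pos_superadditive:
  assumes "A \<inter> B = {}"
  shows "pos A + pos B \<le> pos (A \<union> B)"
proof -
  have ne: "{D \<in> sets M. D \<subseteq> S} \<noteq> {}" for S by auto
  have *: "ennreal (\<nu> D) + ennreal (\<nu> E) \<le> pos (A \<union> B)"
    if D: "D \<in> sets M" "D \<subseteq> A" and E: "E \<in> sets M" "E \<subseteq> B" for D E
  proof -
    consider "\<nu> D \<le> 0" | "\<nu> E \<le> 0" | "0 \<le> \<nu> D" "0 \<le> \<nu> E" by linarith
    then show ?thesis
    proof cases
      case 1 then show ?thesis using pos_upper[OF E(1), of "A \<union> B"] E by (auto simp: ennreal_neg)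
    next
      case 2 then show ?thesis using pos_upper[OF D(1), of "A \<union> B"] D by (auto simp: ennreal_neg)
    next
      case 3
      have "D \<inter> E = {}" using D E assms by auto
      then have "ennreal (\<nu> D) + ennreal (\<nu> E) = ennreal (\<nu> (D \<union> E))"
        using 3 D E by (simp add: additive)
      also have "\<dots> \<le> pos (A \<union> B)" using D E by (intro pos_upper) auto
      finally show ?thesis .
    qed
  qed
  have "pos A + pos B = (SUP D\<in>{D \<in> sets M. D \<subseteq> A}. ennreal (\<nu> D) + pos B)"
    unfolding positive_variation_def[of M \<nu> A] by (rule ennreal_SUP_add_left[OF ne, symmetric])
  also have "\<dots> \<le> pos (A \<union> B)"
  proof (rule SUP_least)
    fix D assume D: "D \<in> {D \<in> sets M. D \<subseteq> A}"
    have "ennreal (\<nu> D) + pos B = (SUP E\<in>{D \<in> sets M. D \<subseteq> B}. ennreal (\<nu> D) + ennreal (\<nu> E))"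
      unfolding positive_variation_def[of M \<nu> B] by (rule ennreal_SUP_add_right[OF ne])
    also have "\<dots> \<le> pos (A \<union> B)" using D * by (intro SUP_least) auto
    finally show "ennreal (\<nu> D) + pos B \<le> pos (A \<union> B)" .
  qed
  finally show ?thesis .
qed

lemma pos_countably_additive: "countably_additive (sets M) pos"
proof (rule countably_additiveI)
  fix A :: "nat \<Rightarrow> 'a set"
  assume A: "range A \<subseteq> sets M" "disjoint_family A" "\<Union> (range A) \<in> sets M"
  show "(\<Sum>i. pos (A i)) = pos (\<Union> (range A))"
  proof (rule antisym)
    have "(\<Sum>i<n. pos (A i)) \<le> pos (\<Union>i<n. A i)" for n
    proof (induction n)
      case (Suc n)
      have "(\<Union>i<n. A i) \<inter> A n = {}"
        using A(2) by (auto simp: disjoint_family_on_def) (metis disjoint_iff less_irrefl)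
      then have "pos (\<Union>i<n. A i) + pos (A n) \<le> pos ((\<Union>i<n. A i) \<union> A n)"
        by (rule pos_superadditive)
      also have "(\<Union>i<n. A i) \<union> A n = (\<Union>i<Suc n. A i)" by (auto simp: less_Suc_eq)
      finally have "pos (\<Union>i<n. A i) + pos (A n) \<le> pos (\<Union>i<Suc n. A i)" .
      with add_right_mono[OF Suc, of "pos (A n)"] show ?case unfolding sum.lessThan_Suc by (rule order_trans)
    qed simp
    moreover have "pos (\<Union>i<n. A i) \<le> pos (\<Union> (range A))" for n by (intro pos_mono) auto
    ultimately show "(\<Sum>i. pos (A i)) \<le> pos (\<Union> (range A))"
      unfolding suminf_eq_SUP by (intro SUP_least) (rule order_trans)
  next
    show "pos (\<Union> (range A)) \<le> (\<Sum>i. pos (A i))"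
      unfolding positive_variation_def[of M \<nu> "\<Union> (range A)"]
    proof (rule SUP_least)
      fix B assume "B \<in> {B \<in> sets M. B \<subseteq> \<Union> (range A)}"
      then have B: "B \<in> sets M" "(\<Union>i. B \<inter> A i) = B" by auto
      have "(\<lambda>i. \<nu> (B \<inter> A i)) sums \<nu> (\<Union>i. B \<inter> A i)"
        using A B(1) by (intro sums) (auto simp: disjoint_family_on_def)
      then have "(\<lambda>n. \<Sum>i<n. \<nu> (B \<inter> A i)) \<longlonglongrightarrow> \<nu> B" by (simp only: sums_def B(2))
      then have lim: "(\<lambda>n. ennreal (\<Sum>i<n. \<nu> (B \<inter> A i))) \<longlonglongrightarrow> ennreal (\<nu> B)"
        by (rule tendsto_ennrealI)
      show "ennreal (\<nu> B) \<le> (\<Sum>i. pos (A i))"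
      proof (rule LIMSEQ_le_const2[OF lim], intro exI allI impI)
        fix n
        have pos_part: "ennreal (max 0 x) = ennreal x" for x :: real
          by (cases "0 \<le> x") (auto simp: ennreal_neg)
        have "ennreal (\<Sum>i<n. \<nu> (B \<inter> A i)) \<le> ennreal (\<Sum>i<n. max 0 (\<nu> (B \<inter> A i)))"
          by (intro ennreal_leI sum_mono) auto
        also have "\<dots> = (\<Sum>i<n. ennreal (\<nu> (B \<inter> A i)))" by (subst sum_ennreal[symmetric]) (auto simp: pos_part simp del: sum_ennreal)
        also have "\<dots> \<le> (\<Sum>i<n. pos (A i))"
          using A(1) B(1) by (intro sum_mono pos_upper) auto
        also have "\<dots> \<le> (\<Sum>i. pos (A i))" by (intro sum_le_suminf) auto
        finally show "ennreal (\<Sum>i<n. \<nu> (B \<inter> A i)) \<le> (\<Sum>i. pos (A i))" .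
      qed
    qed
  qed
qed

text \<open>
  The positive variation is a finite measure, absolutely continuous if \<open>\<nu>\<close> vanishes on null sets. So
  the Radon-Nikodym theorem for measures applies, with a density that is finite almost everywhere.
\<close>

lemma pos_density:
  assumes "sigma_finite_measure M" and null: "\<And>A. A \<in> null_sets M \<Longrightarrow> \<nu> A = 0"
  obtains h where "integrable M h" "\<And>A. A \<in> sets M \<Longrightarrow> enn2real (pos A) = (\<integral>\<omega>. indicator A \<omega> * h \<omega> \<partial>M)"
proof -
  interpret sigma_finite_measure M by fact
  define N where "N = measure_of (space M) (sets M) pos"
  have sets_N: "sets N = sets M" by (simp add: N_def)
  have N: "emeasure N A = pos A" if "A \<in> sets M" for A
    unfolding N_def using that pos_countably_additive
    by (intro emeasure_measure_of_sigma sets.sigma_algebra_axioms) (auto simp: positive_def)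
  have "absolutely_continuous M N"
    unfolding absolutely_continuous_def
  proof
    fix A assume A: "A \<in> null_sets M"
    then have "\<nu> B = 0" if "B \<in> sets M" "B \<subseteq> A" for B using that null null_sets_subset by blast
    then have "pos A \<le> 0" unfolding positive_variation_def by (intro SUP_least) auto
    with A show "A \<in> null_sets N" by (auto simp: null_sets_def N sets_N)
  qed
  then obtain f where f [measurable]: "f \<in> borel_measurable M" and dens: "density M f = N"
    using Radon_Nikodym sets_N by blast
  have f_eq: "(\<integral>\<^sup>+\<omega>. f \<omega> * indicator A \<omega> \<partial>M) = pos A" if "A \<in> sets M" for A
    using N[OF that] that by (simp add: dens[symmetric] emeasure_density)
  have "(\<integral>\<^sup>+\<omega>. f \<omega> \<partial>M) = pos (space M)"
    using f_eq[of "space M"] by (simp cong: nn_integral_cong)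
  then have "(\<integral>\<^sup>+\<omega>. f \<omega> \<partial>M) < \<infinity>" using pos_le[of "space M"] by (simp add: order.strict_trans1)
  then have fin: "AE \<omega> in M. f \<omega> = ennreal (enn2real (f \<omega>))"
    using nn_integral_noteq_infinite[of f M] by (auto elim!: eventually_mono simp: less_top)
  have "(\<integral>\<^sup>+\<omega>. ennreal (enn2real (f \<omega>)) \<partial>M) = (\<integral>\<^sup>+\<omega>. f \<omega> \<partial>M)"
    using fin by (intro nn_integral_cong_AE) auto
  then have int: "integrable M (\<lambda>\<omega>. enn2real (f \<omega>))"
    using \<open>(\<integral>\<^sup>+\<omega>. f \<omega> \<partial>M) < \<infinity>\<close> by (intro integrableI_nonneg) auto
  show thesis
  proof (rule that[OF int])
    fix A assume [measurable]: "A \<in> sets M"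
    have "(\<integral>\<omega>. indicator A \<omega> * enn2real (f \<omega>) \<partial>M) =
        enn2real (\<integral>\<^sup>+\<omega>. ennreal (indicator A \<omega> * enn2real (f \<omega>)) \<partial>M)"
      by (intro integral_eq_nn_integral) auto
    also have "(\<integral>\<^sup>+\<omega>. ennreal (indicator A \<omega> * enn2real (f \<omega>)) \<partial>M) = (\<integral>\<^sup>+\<omega>. f \<omega> * indicator A \<omega> \<partial>M)"
      using fin by (intro nn_integral_cong_AE) (auto elim!: eventually_mono simp: indicator_def)
    finally show "enn2real (pos A) = (\<integral>\<omega>. indicator A \<omega> * enn2real (f \<omega>) \<partial>M)"
      by (simp add: f_eq)
  qed
qed

text \<open>
  For \<open>B \<subseteq> A\<close> the identity \<open>\<nu> B = \<nu> A + (- \<nu> (A - B))\<close> bounds \<open>\<nu> B\<close> by \<open>\<nu> A\<close> plus the negative variation.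
  Together with the same inequality for \<open>- \<nu>\<close>, this yields the Jordan decomposition.
\<close>

lemma pos_le_neg:
  assumes A: "A \<in> sets M"
  shows "enn2real (pos A) \<le> \<nu> A + enn2real (positive_variation M (\<lambda>A. - \<nu> A) A)"
proof -
  interpret neg: finite_signed_measure M "\<lambda>A. - \<nu> A" C by (rule uminus)
  define n where "n = enn2real (positive_variation M (\<lambda>A. - \<nu> A) A)"
  have n: "positive_variation M (\<lambda>A. - \<nu> A) A = ennreal n"
    using neg.pos_le[of A] by (simp add: n_def less_top order.strict_trans1)
  have n0: "0 \<le> n" by (simp add: n_def)
  have le: "\<nu> B \<le> \<nu> A + n" if B: "B \<in> sets M" "B \<subseteq> A" for B
  proof -
    have "A = B \<union> (A - B)" "B \<inter> (A - B) = {}" using B by auto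
    then have "\<nu> A = \<nu> B + \<nu> (A - B)" using A B additive[of B "A - B"] by simp
    moreover have "- \<nu> (A - B) \<le> n"
      using neg.pos_upper[of "A - B" A] A B n0 by (simp add: n ennreal_le_iff)
    ultimately show ?thesis by simp
  qed
  have "pos A \<le> ennreal (\<nu> A + n)"
    unfolding positive_variation_def using le by (intro SUP_least ennreal_leI) auto
  then show ?thesis
    using le[of "{}"] by (simp add: n_def enn2real_leI)
qed

theorem Radon_Nikodym_signed:
  assumes "sigma_finite_measure M" and null: "\<And>A. A \<in> null_sets M \<Longrightarrow> \<nu> A = 0"
  obtains h where "integrable M h" "\<And>A. A \<in> sets M \<Longrightarrow> \<nu> A = (\<integral>\<omega>. indicator A \<omega> * h \<omega> \<partial>M)"
proof -
  interpret neg: finite_signed_measure M "\<lambda>A. - \<nu> A" C by (rule uminus)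
  obtain p where p: "integrable M p" "\<And>A. A \<in> sets M \<Longrightarrow> enn2real (pos A) = (\<integral>\<omega>. indicator A \<omega> * p \<omega> \<partial>M)"
    using pos_density[OF assms] by blast
  obtain n where n: "integrable M n" "\<And>A. A \<in> sets M \<Longrightarrow> enn2real (neg.pos A) = (\<integral>\<omega>. indicator A \<omega> * n \<omega> \<partial>M)"
    using neg.pos_density[OF assms(1)] null by auto
  show thesis
  proof (rule that[of "\<lambda>\<omega>. p \<omega> - n \<omega>"])
    show "integrable M (\<lambda>\<omega>. p \<omega> - n \<omega>)" using p n by auto
    fix A assume A [measurable]: "A \<in> sets M"
    have "\<nu> A = enn2real (pos A) - enn2real (neg.pos A)"
      using pos_le_neg[OF A] neg.pos_le_neg[OF A] by simp
    also have "\<dots> = (\<integral>\<omega>. indicator A \<omega> * p \<omega> - indicator A \<omega> * n \<omega> \<partial>M)"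
      using p n by (simp add: integrable_real_mult_indicator mult.commute)
    finally show "\<nu> A = (\<integral>\<omega>. indicator A \<omega> * (p \<omega> - n \<omega>) \<partial>M)" by (simp add: right_diff_distrib)
  qed
qed

end

section \<open>The dual of a function space with order continuous norm\<close>

text \<open>
  An ideal of measurable functions with a monotone norm for which dominated convergence holds, and
  with a strictly positive element \<open>w\<close>, a weak unit in the language of Banach lattices.
\<close>

locale order_continuous_function_space = sigma_finite_measure M
  for M :: "'a measure" +
  fixes X :: "'a fspace" and w :: "'a \<Rightarrow> real"
  assumes meas: "f \<in> elems X \<Longrightarrow> f \<in> borel_measurable M"
    and add: "f \<in> elems X \<Longrightarrow> g \<in> elems X \<Longrightarrow> (\<lambda>\<omega>. f \<omega> + g \<omega>) \<in> elems X"
    and norm_nonneg: "f \<in> elems X \<Longrightarrow> 0 \<le> fnorm X f"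
    and norm_cmult: "f \<in> elems X \<Longrightarrow> fnorm X (\<lambda>\<omega>. c * f \<omega>) \<le> \<bar>c\<bar> * fnorm X f"
    and ideal: "g \<in> elems X \<Longrightarrow> f \<in> borel_measurable M \<Longrightarrow> AE \<omega> in M. \<bar>f \<omega>\<bar> \<le> C * \<bar>g \<omega>\<bar> \<Longrightarrow> f \<in> elems X"
    and norm_mono: "g \<in> elems X \<Longrightarrow> f \<in> borel_measurable M \<Longrightarrow> AE \<omega> in M. \<bar>f \<omega>\<bar> \<le> \<bar>g \<omega>\<bar> \<Longrightarrow>
      fnorm X f \<le> fnorm X g"
    and order_continuous: "f \<in> elems X \<Longrightarrow> (\<And>n. F n \<in> borel_measurable M) \<Longrightarrow>
      (\<And>n. AE \<omega> in M. \<bar>F n \<omega>\<bar> \<le> \<bar>f \<omega>\<bar>) \<Longrightarrow> AE \<omega> in M. (\<lambda>n. F n \<omega>) \<longlonglongrightarrow> 0 \<Longrightarrow>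
      (\<lambda>n. fnorm X (F n)) \<longlonglongrightarrow> 0"
    and unit_elem: "w \<in> elems X" and unit_pos: "\<omega> \<in> space M \<Longrightarrow> 0 < w \<omega>"
begin

lemma w_measurable [measurable]: "w \<in> borel_measurable M"
  using meas unit_elem by blast

lemma cmult: "f \<in> elems X \<Longrightarrow> (\<lambda>\<omega>. c * f \<omega>) \<in> elems X"
  by (rule ideal[of f _ "\<bar>c\<bar>"]) (auto simp: abs_mult dest: meas)

lemma zero: "(\<lambda>_. 0) \<in> elems X"
  using cmult[OF unit_elem, of 0] by simp

lemma minus: "f \<in> elems X \<Longrightarrow> g \<in> elems X \<Longrightarrow> (\<lambda>\<omega>. f \<omega> - g \<omega>) \<in> elems X"
  using add[of f "\<lambda>\<omega>. (-1) * g \<omega>"] cmult[of g "-1"] by simp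

lemma nn_integral_le_kothe_norm:
  assumes f: "f \<in> elems X" and l: "fnorm X f < l" and g [measurable]: "g \<in> borel_measurable M"
  shows "(\<integral>\<^sup>+\<omega>. ennreal \<bar>f \<omega> * g \<omega>\<bar> \<partial>M) \<le> ennreal l * kothe_norm M X g"
proof -
  have [measurable]: "f \<in> borel_measurable M" using f by (rule meas)
  have "0 < l" using l norm_nonneg[OF f] by simp
  have "fnorm X (\<lambda>\<omega>. (1 / l) * f \<omega>) \<le> \<bar>1 / l\<bar> * fnorm X f" by (rule norm_cmult[OF f])
  also have "\<dots> \<le> 1" using l \<open>0 < l\<close> by (simp add: field_simps)
  finally have "(\<integral>\<^sup>+\<omega>. ennreal \<bar>(1 / l) * f \<omega> * g \<omega>\<bar> \<partial>M) \<le> kothe_norm M X g"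
    unfolding kothe_norm_def using cmult[OF f, of "1 / l"] by (intro SUP_upper) auto
  then have "ennreal l * (\<integral>\<^sup>+\<omega>. ennreal \<bar>(1 / l) * f \<omega> * g \<omega>\<bar> \<partial>M) \<le> ennreal l * kothe_norm M X g"
    by (rule mult_left_mono) simp
  also have "ennreal l * (\<integral>\<^sup>+\<omega>. ennreal \<bar>(1 / l) * f \<omega> * g \<omega>\<bar> \<partial>M) =
      (\<integral>\<^sup>+\<omega>. ennreal l * ennreal \<bar>(1 / l) * f \<omega> * g \<omega>\<bar> \<partial>M)"
    by (rule nn_integral_cmult[symmetric]) measurable
  also have "\<dots> = (\<integral>\<^sup>+\<omega>. ennreal \<bar>f \<omega> * g \<omega>\<bar> \<partial>M)"
    using \<open>0 < l\<close> by (intro nn_integral_cong) (simp add: abs_mult flip: ennreal_mult)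
  finally show ?thesis .
qed

lemma kothe_integrable:
  assumes f: "f \<in> elems X" and g: "g \<in> elems (kothe_dual M X)"
  shows "integrable M (\<lambda>\<omega>. f \<omega> * g \<omega>)"
    and "\<bar>\<integral>\<omega>. f \<omega> * g \<omega> \<partial>M\<bar> \<le> fnorm X f * fnorm (kothe_dual M X) g"
proof -
  have [measurable]: "f \<in> borel_measurable M" "g \<in> borel_measurable M"
    using f g by (auto simp: kothe_dual_def meas)
  define k where "k = fnorm (kothe_dual M X) g"
  have k: "kothe_norm M X g = ennreal k" "0 \<le> k" using g by (auto simp: k_def kothe_dual_def)
  have le: "(\<integral>\<^sup>+\<omega>. ennreal \<bar>f \<omega> * g \<omega>\<bar> \<partial>M) \<le> ennreal (l * k)" if "fnorm X f < l" for l
    using nn_integral_le_kothe_norm[OF f that, of g] that norm_nonneg[OF f] k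
    by (simp add: ennreal_mult)
  show int: "integrable M (\<lambda>\<omega>. f \<omega> * g \<omega>)"
    unfolding integrable_iff_bounded using le[of "fnorm X f + 1"]
    by (auto intro: le_less_trans[OF _ ennreal_less_top])
  have "\<bar>\<integral>\<omega>. f \<omega> * g \<omega> \<partial>M\<bar> \<le> l * k" if "fnorm X f < l" for l
  proof -
    have "\<bar>\<integral>\<omega>. f \<omega> * g \<omega> \<partial>M\<bar> \<le> (\<integral>\<omega>. \<bar>f \<omega> * g \<omega>\<bar> \<partial>M)" by (rule integral_abs_bound)
    also have "\<dots> = enn2real (\<integral>\<^sup>+\<omega>. ennreal \<bar>f \<omega> * g \<omega>\<bar> \<partial>M)" by (intro integral_eq_nn_integral) auto
    also have "\<dots> \<le> l * k"
      using le[OF that] that norm_nonneg[OF f] k by (intro enn2real_leI) auto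
    finally show ?thesis .
  qed
  then have "\<bar>\<integral>\<omega>. f \<omega> * g \<omega> \<partial>M\<bar> \<le> (fnorm X f + e) * k" if "0 < e" for e
    using that by simp
  moreover have "((\<lambda>e. (fnorm X f + e) * k) \<longlongrightarrow> (fnorm X f + 0) * k) (at_right 0)"
    by (intro tendsto_intros)
  ultimately have "\<bar>\<integral>\<omega>. f \<omega> * g \<omega> \<partial>M\<bar> \<le> (fnorm X f + 0) * k"
    by (intro tendsto_lowerbound[where F = "at_right 0"]) (auto simp: eventually_at_right_field intro!: exI[of _ 1])
  then show "\<bar>\<integral>\<omega>. f \<omega> * g \<omega> \<partial>M\<bar> \<le> fnorm X f * fnorm (kothe_dual M X) g"
    by (simp add: k_def)
qed

lemma pairing_in_top_dual:
  assumes g: "g \<in> elems (kothe_dual M X)"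
  shows "pairing M X g \<in> top_dual X"
proof -
  define k where "k = fnorm (kothe_dual M X) g + 1"
  have k: "0 < k" by (simp add: k_def kothe_dual_def add_nonneg_pos)
  have "\<exists>d>0. \<forall>h\<in>elems X. fnorm X (\<lambda>\<omega>. h \<omega> - f \<omega>) < d \<longrightarrow> \<bar>pairing M X g h - pairing M X g f\<bar> < e"
    if f: "f \<in> elems X" and e: "0 < e" for f e
  proof (intro exI[of _ "e / k"] conjI ballI impI)
    show "0 < e / k" using e k by simp
    fix h assume h: "h \<in> elems X" and less: "fnorm X (\<lambda>\<omega>. h \<omega> - f \<omega>) < e / k"
    have "pairing M X g h - pairing M X g f = (\<integral>\<omega>. (h \<omega> - f \<omega>) * g \<omega> \<partial>M)"
      using kothe_integrable(1)[OF f g] kothe_integrable(1)[OF h g] f h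
      by (simp add: pairing_def left_diff_distrib)
    then have "\<bar>pairing M X g h - pairing M X g f\<bar> \<le>
        fnorm X (\<lambda>\<omega>. h \<omega> - f \<omega>) * fnorm (kothe_dual M X) g"
      using kothe_integrable(2)[OF minus[OF h f] g] by simp
    also have "\<dots> \<le> fnorm X (\<lambda>\<omega>. h \<omega> - f \<omega>) * k"
      using norm_nonneg[OF minus[OF h f]] by (intro mult_left_mono) (auto simp: k_def)
    also have "\<dots> < e" using less k by (simp add: field_simps)
    finally show "\<bar>pairing M X g h - pairing M X g f\<bar> < e" .
  qed
  then show ?thesis
    using kothe_integrable(1)[OF _ g]
    by (auto simp: top_dual_def pairing_def add cmult distrib_right mult.assoc)
qed

lemma top_dual_bounded:
  assumes T: "T \<in> top_dual X"
  obtains K where "0 \<le> K" "\<And>f. f \<in> elems X \<Longrightarrow> \<bar>T f\<bar> \<le> K * fnorm X f"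
proof -
  have cm: "T (\<lambda>\<omega>. c * f \<omega>) = c * T f" if "f \<in> elems X" for c f
    using T that by (simp add: top_dual_def)
  have T0: "T (\<lambda>_. 0) = 0" using cm[OF unit_elem, of 0] by simp
  have "\<forall>f\<in>elems X. \<forall>e>0. \<exists>d>0. \<forall>g\<in>elems X. fnorm X (\<lambda>\<omega>. g \<omega> - f \<omega>) < d \<longrightarrow> \<bar>T g - T f\<bar> < e"
    using T by (simp add: top_dual_def)
  from this[rule_format, OF zero zero_less_one]
  obtain d where d: "0 < d" "\<And>g. g \<in> elems X \<Longrightarrow> fnorm X g < d \<Longrightarrow> \<bar>T g\<bar> < 1"
    by (auto simp: T0)
  show thesis
  proof (rule that[of "2 / d"])
    fix f assume f: "f \<in> elems X"
    show "\<bar>T f\<bar> \<le> 2 / d * fnorm X f"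
    proof (rule dense_ge)
      fix y assume y: "2 / d * fnorm X f < y"
      have "0 \<le> 2 / d * fnorm X f" using d norm_nonneg[OF f] by simp
      with y have "0 < y" by linarith
      have "fnorm X (\<lambda>\<omega>. (1 / y) * f \<omega>) \<le> \<bar>1 / y\<bar> * fnorm X f" by (rule norm_cmult[OF f])
      also have "\<dots> < d" using y d(1) \<open>0 < y\<close> norm_nonneg[OF f] by (simp add: field_simps)
      finally have "\<bar>(1 / y) * T f\<bar> < 1" using d(2)[OF cmult[OF f]] cm[OF f] by metis
      then show "\<bar>T f\<bar> \<le> y" using \<open>0 < y\<close> by (simp add: abs_mult field_simps)
    qed
  qed (use d in simp)
qed

text \<open>
  Functionals respect equality almost everywhere and dominated convergence, so \<open>A \<mapsto> T (1\<^sub>A w)\<close> is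
  countably additive and vanishes on null sets. With its density \<open>h\<close>, put \<open>g = h / w\<close>. The formula
  \<open>T f = \<integral>f g\<close> holds for \<open>f = s w\<close> with a simple function \<open>s\<close>. A general \<open>f\<close> is the dominated limit of
  such functions, where \<open>s\<^sub>i\<close> are simple functions converging to \<open>f / w\<close>. To apply dominated convergence
  on the side of the integrals one needs integrability of \<open>f g\<close>. It follows from Fatou's lemma,
  because \<open>\<integral>\<bar>s\<^sub>i h\<bar>\<close> is the value of \<open>T\<close> at \<open>\<bar>s\<^sub>i\<bar> (sgn h) w\<close>, again a product of \<open>w\<close> with a simple
  function, whose norm is controlled by that of \<open>f\<close>.
\<close>

lemma top_dual_representation:
  assumes T: "T \<in> top_dual X"
  shows "T \<in> pairing M X ` elems (kothe_dual M X)"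
proof -
  have Tadd: "T (\<lambda>\<omega>. f \<omega> + g \<omega>) = T f + T g" if "f \<in> elems X" "g \<in> elems X" for f g
    using T that by (simp add: top_dual_def)
  have Tcm: "T (\<lambda>\<omega>. c * f \<omega>) = c * T f" if "f \<in> elems X" for c f
    using T that by (simp add: top_dual_def)
  have Tminus: "T (\<lambda>\<omega>. f \<omega> - g \<omega>) = T f - T g" if "f \<in> elems X" "g \<in> elems X" for f g
    using Tadd[OF that(1) cmult[OF that(2)], of "-1"] Tcm[OF that(2), of "-1"] by simp
  obtain K where K: "0 \<le> K" "\<And>f. f \<in> elems X \<Longrightarrow> \<bar>T f\<bar> \<le> K * fnorm X f"
    using top_dual_bounded[OF T] by blast
  have Tlim: "(\<lambda>n. T (F n)) \<longlonglongrightarrow> T f"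
    if f: "f \<in> elems X" and e: "e \<in> elems X" and F: "\<And>n. F n \<in> elems X"
      and le: "\<And>n. AE \<omega> in M. \<bar>F n \<omega> - f \<omega>\<bar> \<le> \<bar>e \<omega>\<bar>"
      and lim: "AE \<omega> in M. (\<lambda>n. F n \<omega>) \<longlonglongrightarrow> f \<omega>" for f e F
  proof -
    have "AE \<omega> in M. (\<lambda>n. F n \<omega> - f \<omega>) \<longlonglongrightarrow> 0" using lim by (simp add: LIM_zero_iff)
    then have "(\<lambda>n. fnorm X (\<lambda>\<omega>. F n \<omega> - f \<omega>)) \<longlonglongrightarrow> 0"
      using le by (intro order_continuous[OF e]) (auto intro!: meas minus f F)
    then have "(\<lambda>n. K * fnorm X (\<lambda>\<omega>. F n \<omega> - f \<omega>)) \<longlonglongrightarrow> K * 0" by (intro tendsto_intros)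
    then have lim0: "(\<lambda>n. K * fnorm X (\<lambda>\<omega>. F n \<omega> - f \<omega>)) \<longlonglongrightarrow> 0" by simp
    have "norm (T (F n) - T f) \<le> K * fnorm X (\<lambda>\<omega>. F n \<omega> - f \<omega>)" for n
      using K(2)[OF minus[OF F[of n] f]] unfolding Tminus[OF F[of n] f] real_norm_def .
    then have "(\<lambda>n. T (F n) - T f) \<longlonglongrightarrow> 0"
      by (intro Lim_null_comparison[OF _ lim0] always_eventually allI)
    then show ?thesis by (simp add: LIM_zero_iff)
  qed
  have Tcong: "T f = T g" if f: "f \<in> elems X" and g: "g \<in> elems X" and "AE \<omega> in M. f \<omega> = g \<omega>" for f g
  proof -
    have "AE \<omega> in M. \<bar>g \<omega> - f \<omega>\<bar> \<le> \<bar>0\<bar>" "AE \<omega> in M. (\<lambda>n::nat. g \<omega>) \<longlonglongrightarrow> f \<omega>"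
      using that(3) by (auto elim!: eventually_mono)
    then have "(\<lambda>n::nat. T g) \<longlonglongrightarrow> T f" using Tlim[OF f zero, of "\<lambda>_. g"] g by simp
    then show ?thesis by (simp add: LIMSEQ_const_iff)
  qed
  define \<nu> where "\<nu> A = T (\<lambda>\<omega>. indicator A \<omega> * w \<omega>)" for A
  have wA: "(\<lambda>\<omega>. indicator A \<omega> * w \<omega>) \<in> elems X" if [measurable]: "A \<in> sets M" for A
    by (rule ideal[OF unit_elem, of _ 1]) (auto simp: indicator_def)
  interpret nu: finite_signed_measure M \<nu> "K * fnorm X w"
  proof
    fix A assume A: "A \<in> sets M"
    have "\<bar>\<nu> A\<bar> \<le> K * fnorm X (\<lambda>\<omega>. indicator A \<omega> * w \<omega>)"
      unfolding \<nu>_def using A by (intro K wA)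
    also have "\<dots> \<le> K * fnorm X w"
      using A K wA[OF A] by (intro mult_left_mono norm_mono unit_elem) (auto intro: meas simp: indicator_def)
    finally show "\<bar>\<nu> A\<bar> \<le> K * fnorm X w" .
  next
    fix A :: "nat \<Rightarrow> 'a set" assume A: "range A \<subseteq> sets M" "disjoint_family A"
    have AM [measurable]: "A n \<in> sets M" for n using A by auto
    have partial: "(\<Sum>i<n. \<nu> (A i)) = T (\<lambda>\<omega>. indicator (\<Union>i<n. A i) \<omega> * w \<omega>)" for n
    proof (induction n)
      case 0
      show ?case using Tcm[OF unit_elem, of 0] by simp
    next
      case (Suc n)
      have "(\<Union>i<n. A i) \<inter> A n = {}"
        using A(2) by (auto simp: disjoint_family_on_def) (metis disjoint_iff less_irrefl)
      then have "indicator (\<Union>i<Suc n. A i) \<omega> = indicator (\<Union>i<n. A i) \<omega> + (indicator (A n) \<omega> :: real)" for \<omega>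
        by (auto simp: indicator_def less_Suc_eq)
      then have "T (\<lambda>\<omega>. indicator (\<Union>i<Suc n. A i) \<omega> * w \<omega>) =
          T (\<lambda>\<omega>. indicator (\<Union>i<n. A i) \<omega> * w \<omega> + indicator (A n) \<omega> * w \<omega>)"
        by (simp add: distrib_right)
      also have "\<dots> = (\<Sum>i<n. \<nu> (A i)) + \<nu> (A n)"
        unfolding Suc unfolding \<nu>_def by (intro Tadd wA) auto
      finally show ?case by simp
    qed
    have "(\<lambda>n. T (\<lambda>\<omega>. indicator (\<Union>i<n. A i) \<omega> * w \<omega>)) \<longlonglongrightarrow> T (\<lambda>\<omega>. indicator (\<Union>i. A i) \<omega> * w \<omega>)"
    proof (rule Tlim[OF wA unit_elem wA])
      fix n show "AE \<omega> in M. \<bar>indicator (\<Union>i<n. A i) \<omega> * w \<omega> - indicator (\<Union>i. A i) \<omega> * w \<omega>\<bar> \<le> \<bar>w \<omega>\<bar>"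
        by (auto simp: indicator_def)
    next
      have "(\<lambda>n. indicator (\<Union>i<n. A i) \<omega> :: real) \<longlonglongrightarrow> indicator (\<Union>i. A i) \<omega>" for \<omega>
        by (rule LIMSEQ_indicator_UN)
      then show "AE \<omega> in M. (\<lambda>n. indicator (\<Union>i<n. A i) \<omega> * w \<omega>) \<longlonglongrightarrow> indicator (\<Union>i. A i) \<omega> * w \<omega>"
        by (intro AE_I2 tendsto_intros)
    qed auto
    then show "(\<lambda>n. \<nu> (A n)) sums \<nu> (\<Union>n. A n)"
      by (simp add: sums_def partial) (simp add: \<nu>_def)
  qed
  have null: "\<nu> A = 0" if "A \<in> null_sets M" for A
  proof -
    have "AE \<omega> in M. indicator A \<omega> * w \<omega> = 0" using AE_not_in[OF that] by (auto elim!: eventually_mono)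
    then have "\<nu> A = T (\<lambda>_. 0)" unfolding \<nu>_def using that by (intro Tcong wA zero) auto
    also have "\<dots> = 0" using Tcm[OF unit_elem, of 0] by simp
    finally show ?thesis .
  qed
  obtain h where h: "integrable M h" and \<nu>h: "\<And>A. A \<in> sets M \<Longrightarrow> \<nu> A = (\<integral>\<omega>. indicator A \<omega> * h \<omega> \<partial>M)"
    using nu.Radon_Nikodym_signed[OF sigma_finite_measure_axioms null] by blast
  have [measurable]: "h \<in> borel_measurable M" using h by auto
  have simple: "(\<lambda>\<omega>. s \<omega> * w \<omega>) \<in> elems X \<and> integrable M (\<lambda>\<omega>. s \<omega> * h \<omega>) \<and>
      T (\<lambda>\<omega>. s \<omega> * w \<omega>) = (\<integral>\<omega>. s \<omega> * h \<omega> \<partial>M)" if s: "simple_function M s" for s :: "'a \<Rightarrow> real"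
  proof -
    let ?A = "\<lambda>y. s -` {y} \<inter> space M"
    have fin: "finite (s ` space M)" and A: "?A y \<in> sets M" for y
      using simple_functionD[OF s] by auto
    define S where "S I \<omega> = (\<Sum>y\<in>I. y * indicator (?A y) \<omega>)" for I \<omega>
    have "(\<lambda>\<omega>. S I \<omega> * w \<omega>) \<in> elems X \<and> integrable M (\<lambda>\<omega>. S I \<omega> * h \<omega>) \<and>
      T (\<lambda>\<omega>. S I \<omega> * w \<omega>) = (\<integral>\<omega>. S I \<omega> * h \<omega> \<partial>M)" if "finite I" for I
      using that
    proof (induction I)
      case empty
      show ?case using zero Tcm[OF unit_elem, of 0] by (simp add: S_def)
    next
      case (insert y I)
      have S: "S (insert y I) \<omega> * u \<omega> = y * (indicator (?A y) \<omega> * u \<omega>) + S I \<omega> * u \<omega>" for \<omega> and u :: "'a \<Rightarrow> real"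
        by (simp only: S_def sum.insert[OF insert.hyps] distrib_right mult.assoc)
      have int: "integrable M (\<lambda>\<omega>. indicator (?A y) \<omega> * h \<omega>)"
        using integrable_real_mult_indicator[OF A h] by (simp add: mult.commute)
      show ?case
        unfolding S using insert int A
        by (simp add: Tadd Tcm cmult add wA flip: \<nu>h) (simp add: \<nu>_def)
    qed
    note * = this[OF fin]
    have eq: "s \<omega> = S (s ` space M) \<omega>" if "\<omega> \<in> space M" for \<omega>
    proof -
      have "s \<omega> = (\<Sum>y\<in>s ` space M. indicator (?A y) \<omega> *\<^sub>R y)"
        by (rule simple_function_indicator_representation_banach[OF s that])
      also have "\<dots> = S (s ` space M) \<omega>"
        unfolding S_def real_scaleR_def by (intro sum.cong refl mult.commute)
      finally show ?thesis .
    qed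
    have [measurable]: "s \<in> borel_measurable M" using s by (rule borel_measurable_simple_function)
    have "(\<lambda>\<omega>. s \<omega> * w \<omega>) \<in> elems X"
      by (rule ideal[of "\<lambda>\<omega>. S (s ` space M) \<omega> * w \<omega>" _ 1]) (use * in \<open>auto simp: eq\<close>)
    moreover have "integrable M (\<lambda>\<omega>. s \<omega> * h \<omega>)"
      using * by (subst Bochner_Integration.integrable_cong[OF refl, of _ _ "\<lambda>\<omega>. S (s ` space M) \<omega> * h \<omega>"]) (auto simp: eq)
    moreover have "T (\<lambda>\<omega>. s \<omega> * w \<omega>) = T (\<lambda>\<omega>. S (s ` space M) \<omega> * w \<omega>)"
      using * calculation(1) by (intro Tcong) (auto simp: eq)
    moreover have "(\<integral>\<omega>. s \<omega> * h \<omega> \<partial>M) = (\<integral>\<omega>. S (s ` space M) \<omega> * h \<omega> \<partial>M)"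
      by (intro Bochner_Integration.integral_cong) (auto simp: eq)
    ultimately show ?thesis using * by simp
  qed
  define g where "g = (\<lambda>\<omega>. h \<omega> / w \<omega>)"
  have [measurable]: "g \<in> borel_measurable M" unfolding g_def by measurable
  have main: "(\<integral>\<^sup>+\<omega>. ennreal \<bar>f \<omega> * g \<omega>\<bar> \<partial>M) \<le> ennreal (K * (2 * fnorm X f)) \<and> T f = (\<integral>\<omega>. f \<omega> * g \<omega> \<partial>M)"
    if f: "f \<in> elems X" for f
  proof -
    have [measurable]: "f \<in> borel_measurable M" using f by (rule meas)
    define u where "u = (\<lambda>\<omega>. f \<omega> / w \<omega>)"
    have [measurable]: "u \<in> borel_measurable M" unfolding u_def by measurable
    obtain s where "(\<forall>i. simple_function M (s i)) \<and> (\<forall>\<omega>\<in>space M. (\<lambda>i. s i \<omega>) \<longlonglongrightarrow> u \<omega>) \<and>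
        (\<forall>i. \<forall>\<omega>\<in>space M. dist (s i \<omega>) 0 \<le> 2 * dist (u \<omega>) 0)"
      using borel_measurable_implies_sequence_metric[of u M 0] by auto
    then have s: "\<And>i. simple_function M (s i)" "\<And>\<omega>. \<omega> \<in> space M \<Longrightarrow> (\<lambda>i. s i \<omega>) \<longlonglongrightarrow> u \<omega>"
        "\<And>i \<omega>. \<omega> \<in> space M \<Longrightarrow> \<bar>s i \<omega>\<bar> \<le> 2 * \<bar>u \<omega>\<bar>"
      by (auto simp: dist_real_def)
    have [measurable]: "s i \<in> borel_measurable M" for i using s(1) by (rule borel_measurable_simple_function)
    have uw: "u \<omega> * w \<omega> = f \<omega>" and uh: "u \<omega> * h \<omega> = f \<omega> * g \<omega>" if "\<omega> \<in> space M" for \<omega>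
      using unit_pos[OF that] by (auto simp: u_def g_def)
    have f2: "(\<lambda>\<omega>. 2 * f \<omega>) \<in> elems X" and f3: "(\<lambda>\<omega>. 3 * f \<omega>) \<in> elems X"
      using f by (auto intro: cmult)
    have sw: "\<bar>s i \<omega> * w \<omega>\<bar> \<le> \<bar>2 * f \<omega>\<bar>" if "\<omega> \<in> space M" for i \<omega>
      using mult_right_mono[OF s(3)[OF that, of i], of "\<bar>w \<omega>\<bar>"] uw[OF that]
      by (auto simp: abs_mult)
    have bound: "(\<integral>\<^sup>+\<omega>. ennreal \<bar>s i \<omega> * h \<omega>\<bar> \<partial>M) \<le> ennreal (K * (2 * fnorm X f))" for i
    proof -
      \<comment> \<open>the sign of \<open>h\<close> turns the integral of \<open>\<bar>s i * h\<bar>\<close> into a value of \<open>T\<close>\<close>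
      define s' where "s' = (\<lambda>\<omega>. \<bar>s i \<omega>\<bar> * sgn (h \<omega>))"
      have "simple_function M (\<lambda>\<omega>. sgn (h \<omega>))"
      proof (rule simple_function_borel_measurable)
        show "finite ((\<lambda>\<omega>. sgn (h \<omega>)) ` space M)"
          by (rule finite_subset[of _ "{-1, 0, 1}"]) (auto simp: sgn_real_def)
      qed measurable
      then have s': "simple_function M s'"
        unfolding s'_def using s(1)[of i]
        by (intro simple_function_compose2[where h = "(*)"] simple_function_compose1[where g = abs])
      have eq: "s' \<omega> * h \<omega> = \<bar>s i \<omega> * h \<omega>\<bar>" for \<omega>
        by (auto simp: s'_def abs_mult abs_sgn sgn_mult algebra_simps)
      have "(\<integral>\<^sup>+\<omega>. ennreal \<bar>s i \<omega> * h \<omega>\<bar> \<partial>M) = ennreal (\<integral>\<omega>. s' \<omega> * h \<omega> \<partial>M)"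
        using simple[OF s'] unfolding eq by (intro nn_integral_eq_integral) auto
      also have "\<dots> = ennreal (T (\<lambda>\<omega>. s' \<omega> * w \<omega>))" using simple[OF s'] by simp
      also have "\<dots> \<le> ennreal (K * fnorm X (\<lambda>\<omega>. s' \<omega> * w \<omega>))"
        using K(2)[of "\<lambda>\<omega>. s' \<omega> * w \<omega>"] simple[OF s'] by (intro ennreal_leI) auto
      also have "\<dots> \<le> ennreal (K * fnorm X (\<lambda>\<omega>. 2 * f \<omega>))"
      proof (intro ennreal_leI mult_left_mono norm_mono f2 K)
        show "(\<lambda>\<omega>. s' \<omega> * w \<omega>) \<in> borel_measurable M" using simple[OF s'] by (auto intro: meas)
        show "AE \<omega> in M. \<bar>s' \<omega> * w \<omega>\<bar> \<le> \<bar>2 * f \<omega>\<bar>"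
        proof (rule AE_I2)
          fix \<omega> assume "\<omega> \<in> space M"
          have "\<bar>s' \<omega> * w \<omega>\<bar> \<le> \<bar>s i \<omega> * w \<omega>\<bar>" by (auto simp: s'_def abs_mult sgn_real_def)
          also have "\<dots> \<le> \<bar>2 * f \<omega>\<bar>" by (rule sw) fact
          finally show "\<bar>s' \<omega> * w \<omega>\<bar> \<le> \<bar>2 * f \<omega>\<bar>" .
        qed
      qed
      also have "\<dots> \<le> ennreal (K * (2 * fnorm X f))"
        using norm_cmult[OF f, of 2] K by (intro ennreal_leI mult_left_mono) auto
      finally show ?thesis .
    qed
    have "(\<integral>\<^sup>+\<omega>. ennreal \<bar>u \<omega> * h \<omega>\<bar> \<partial>M) = (\<integral>\<^sup>+\<omega>. liminf (\<lambda>i. ennreal \<bar>s i \<omega> * h \<omega>\<bar>) \<partial>M)"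
    proof (intro nn_integral_cong)
      fix \<omega> assume "\<omega> \<in> space M"
      then have "(\<lambda>i. ennreal \<bar>s i \<omega> * h \<omega>\<bar>) \<longlonglongrightarrow> ennreal \<bar>u \<omega> * h \<omega>\<bar>"
        by (intro tendsto_ennrealI tendsto_intros s)
      then show "ennreal \<bar>u \<omega> * h \<omega>\<bar> = liminf (\<lambda>i. ennreal \<bar>s i \<omega> * h \<omega>\<bar>)"
        by (rule lim_imp_Liminf[OF trivial_limit_sequentially, symmetric])
    qed
    also have "\<dots> \<le> liminf (\<lambda>i. \<integral>\<^sup>+\<omega>. ennreal \<bar>s i \<omega> * h \<omega>\<bar> \<partial>M)"
      by (rule nn_integral_liminf) measurable
    also have "\<dots> \<le> ennreal (K * (2 * fnorm X f))"
      using bound by (intro Liminf_le) auto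
    finally have le: "(\<integral>\<^sup>+\<omega>. ennreal \<bar>u \<omega> * h \<omega>\<bar> \<partial>M) \<le> ennreal (K * (2 * fnorm X f))" .
    then have int: "integrable M (\<lambda>\<omega>. u \<omega> * h \<omega>)"
      unfolding integrable_iff_bounded by (auto intro: le_less_trans[OF _ ennreal_less_top])
    have "(\<lambda>i. \<integral>\<omega>. s i \<omega> * h \<omega> \<partial>M) \<longlonglongrightarrow> (\<integral>\<omega>. u \<omega> * h \<omega> \<partial>M)"
    proof (rule integral_dominated_convergence[where w = "\<lambda>\<omega>. 2 * \<bar>u \<omega> * h \<omega>\<bar>"])
      show "AE \<omega> in M. norm (s i \<omega> * h \<omega>) \<le> 2 * \<bar>u \<omega> * h \<omega>\<bar>" for i
      proof (rule AE_I2)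
        fix \<omega> assume "\<omega> \<in> space M"
        from mult_right_mono[OF s(3)[OF this, of i], of "\<bar>h \<omega>\<bar>"]
        show "norm (s i \<omega> * h \<omega>) \<le> 2 * \<bar>u \<omega> * h \<omega>\<bar>" by (simp add: abs_mult)
      qed
    qed (use int s(2) in \<open>auto intro!: tendsto_intros\<close>)
    moreover have "(\<lambda>i. \<integral>\<omega>. s i \<omega> * h \<omega> \<partial>M) \<longlonglongrightarrow> T f"
    proof -
      have "(\<lambda>i. T (\<lambda>\<omega>. s i \<omega> * w \<omega>)) \<longlonglongrightarrow> T f"
      proof (rule Tlim[OF f f3])
        show "(\<lambda>\<omega>. s i \<omega> * w \<omega>) \<in> elems X" for i using simple[OF s(1)] by blast
        show "AE \<omega> in M. \<bar>s i \<omega> * w \<omega> - f \<omega>\<bar> \<le> \<bar>3 * f \<omega>\<bar>" for i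
        proof (rule AE_I2)
          fix \<omega> assume "\<omega> \<in> space M"
          from sw[OF this, of i] abs_triangle_ineq4[of "s i \<omega> * w \<omega>" "f \<omega>"]
          show "\<bar>s i \<omega> * w \<omega> - f \<omega>\<bar> \<le> \<bar>3 * f \<omega>\<bar>"
            unfolding abs_mult[of 2] abs_mult[of 3] by simp
        qed
        show "AE \<omega> in M. (\<lambda>i. s i \<omega> * w \<omega>) \<longlonglongrightarrow> f \<omega>"
        proof (rule AE_I2)
          fix \<omega> assume "\<omega> \<in> space M"
          from tendsto_mult_right[OF s(2)[OF this], of "w \<omega>"] uw[OF this]
          show "(\<lambda>i. s i \<omega> * w \<omega>) \<longlonglongrightarrow> f \<omega>" by simp
        qed
      qed
      then show ?thesis using simple[OF s(1)] by simp
    qed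
    ultimately have "T f = (\<integral>\<omega>. u \<omega> * h \<omega> \<partial>M)" by (rule LIMSEQ_unique[rotated])
    moreover have "(\<integral>\<omega>. u \<omega> * h \<omega> \<partial>M) = (\<integral>\<omega>. f \<omega> * g \<omega> \<partial>M)"
      by (intro Bochner_Integration.integral_cong) (auto simp: uh)
    moreover have "(\<integral>\<^sup>+\<omega>. ennreal \<bar>u \<omega> * h \<omega>\<bar> \<partial>M) = (\<integral>\<^sup>+\<omega>. ennreal \<bar>f \<omega> * g \<omega>\<bar> \<partial>M)"
      by (intro nn_integral_cong) (auto simp: uh)
    ultimately show ?thesis using le by simp
  qed
  have "kothe_norm M X g \<le> ennreal (K * 2)"
    unfolding kothe_norm_def
  proof (rule SUP_least)
    fix f assume f: "f \<in> {f \<in> elems X. fnorm X f \<le> 1}"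
    then have "(\<integral>\<^sup>+\<omega>. ennreal \<bar>f \<omega> * g \<omega>\<bar> \<partial>M) \<le> ennreal (K * (2 * fnorm X f))" using main by blast
    also have "\<dots> \<le> ennreal (K * 2)" using f K by (intro ennreal_leI mult_left_mono) auto
    finally show "(\<integral>\<^sup>+\<omega>. ennreal \<bar>f \<omega> * g \<omega>\<bar> \<partial>M) \<le> ennreal (K * 2)" .
  qed
  then have "g \<in> elems (kothe_dual M X)"
    by (auto simp: kothe_dual_def intro: le_less_trans[OF _ ennreal_less_top])
  moreover have "T = pairing M X g"
  proof (rule extensionalityI[where A = "elems X"])
    show "T \<in> extensional (elems X)" using T by (simp add: top_dual_def)
    show "pairing M X g \<in> extensional (elems X)" by (simp add: pairing_def)
    show "T f = pairing M X g f" if "f \<in> elems X" for f using main[OF that] that by (simp add: pairing_def)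
  qed
  ultimately show ?thesis by blast
qed

text \<open>
  The function \<open>w sgn (g - h)\<close> belongs to the space, and integrating it against \<open>g - h\<close> gives
  \<open>\<integral>w \<bar>g - h\<bar>\<close>.
\<close>

lemma pairing_inj:
  assumes g: "g \<in> elems (kothe_dual M X)" and h: "h \<in> elems (kothe_dual M X)"
  shows "pairing M X g = pairing M X h \<longleftrightarrow> (AE \<omega> in M. g \<omega> = h \<omega>)"
proof
  have [measurable]: "g \<in> borel_measurable M" "h \<in> borel_measurable M"
    using g h by (auto simp: kothe_dual_def)
  {
    assume eq: "pairing M X g = pairing M X h"
    define f where "f = (\<lambda>\<omega>. w \<omega> * sgn (g \<omega> - h \<omega>))"
    have f: "f \<in> elems X"
      by (rule ideal[OF unit_elem, of _ 1]) (auto simp: f_def abs_mult abs_sgn_eq)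
    have "(\<integral>\<omega>. f \<omega> * g \<omega> \<partial>M) = (\<integral>\<omega>. f \<omega> * h \<omega> \<partial>M)"
      using fun_cong[OF eq, of f] f by (simp add: pairing_def)
    then have "(\<integral>\<omega>. f \<omega> * g \<omega> - f \<omega> * h \<omega> \<partial>M) = 0"
      using kothe_integrable(1)[OF f g] kothe_integrable(1)[OF f h] by simp
    moreover have fgh: "f \<omega> * g \<omega> - f \<omega> * h \<omega> = w \<omega> * \<bar>g \<omega> - h \<omega>\<bar>" for \<omega>
      by (auto simp: f_def abs_sgn algebra_simps)
    moreover have "integrable M (\<lambda>\<omega>. f \<omega> * g \<omega> - f \<omega> * h \<omega>)"
      using kothe_integrable(1)[OF f g] kothe_integrable(1)[OF f h] by simp
    moreover have "AE \<omega> in M. 0 \<le> w \<omega> * \<bar>g \<omega> - h \<omega>\<bar>"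
      using unit_pos by (intro AE_I2 mult_nonneg_nonneg) (auto intro: less_imp_le)
    ultimately have "AE \<omega> in M. w \<omega> * \<bar>g \<omega> - h \<omega>\<bar> = 0"
      using integral_nonneg_eq_0_iff_AE[of M "\<lambda>\<omega>. w \<omega> * \<bar>g \<omega> - h \<omega>\<bar>"] by simp
    then show "AE \<omega> in M. g \<omega> = h \<omega>"
      using AE_space by eventually_elim (use unit_pos in fastforce)
  next
    assume "AE \<omega> in M. g \<omega> = h \<omega>"
    then show "pairing M X g = pairing M X h"
      unfolding pairing_def
      by (intro restrict_ext integral_cong_AE) (auto dest: meas elim!: eventually_mono)
  }
qed

lemma dual_norm_pairing:
  assumes g: "g \<in> elems (kothe_dual M X)"
  shows "dual_norm X (pairing M X g) = fnorm (kothe_dual M X) g"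
proof (rule antisym)
  have [measurable]: "g \<in> borel_measurable M" using g by (simp add: kothe_dual_def)
  let ?B = "{f \<in> elems X. fnorm X f \<le> 1}"
  have "fnorm X (\<lambda>_. 0) \<le> 0" using norm_cmult[OF zero, of 0] by simp
  then have B: "?B \<noteq> {}" using zero by (auto intro!: exI[of _ "\<lambda>_. 0"])
  have le: "\<bar>pairing M X g f\<bar> \<le> fnorm (kothe_dual M X) g" if "f \<in> ?B" for f
  proof -
    have "\<bar>pairing M X g f\<bar> \<le> fnorm X f * fnorm (kothe_dual M X) g"
      using kothe_integrable(2)[OF _ g, of f] that by (simp add: pairing_def)
    also have "\<dots> \<le> 1 * fnorm (kothe_dual M X) g"
      using that by (intro mult_right_mono) (auto simp: kothe_dual_def)
    finally show ?thesis by simp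
  qed
  then show "dual_norm X (pairing M X g) \<le> fnorm (kothe_dual M X) g"
    unfolding dual_norm_def using B by (intro cSUP_least)
  have upper: "\<bar>pairing M X g f\<bar> \<le> dual_norm X (pairing M X g)" if "f \<in> ?B" for f
    unfolding dual_norm_def using le that by (intro cSUP_upper bdd_aboveI2) auto
  have "0 \<le> dual_norm X (pairing M X g)" using B upper by (meson abs_ge_zero equals0I order_trans)
  moreover have "kothe_norm M X g \<le> ennreal (dual_norm X (pairing M X g))"
    unfolding kothe_norm_def
  proof (rule SUP_least)
    fix f assume f: "f \<in> ?B"
    then have [measurable]: "f \<in> borel_measurable M" by (auto intro: meas)
    define f' where "f' = (\<lambda>\<omega>. \<bar>f \<omega>\<bar> * sgn (g \<omega>))"
    have [measurable]: "f' \<in> borel_measurable M" unfolding f'_def by measurable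
    have le: "\<bar>f' \<omega>\<bar> \<le> \<bar>f \<omega>\<bar>" for \<omega> by (auto simp: f'_def abs_mult abs_sgn_eq)
    have f': "f' \<in> elems X" "fnorm X f' \<le> fnorm X f"
      using f le by (auto intro!: ideal[of f f' 1] norm_mono)
    have eq: "f' \<omega> * g \<omega> = \<bar>f \<omega> * g \<omega>\<bar>" for \<omega>
      by (auto simp: f'_def abs_mult abs_sgn sgn_mult algebra_simps)
    have "(\<integral>\<^sup>+\<omega>. ennreal \<bar>f \<omega> * g \<omega>\<bar> \<partial>M) = ennreal (pairing M X g f')"
      using kothe_integrable(1)[OF f'(1) g] f' unfolding pairing_def eq
      by (subst nn_integral_eq_integral) (auto simp: eq)
    also have "\<dots> \<le> ennreal (dual_norm X (pairing M X g))"
      using upper[of f'] f f' by (intro ennreal_leI) auto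
    finally show "(\<integral>\<^sup>+\<omega>. ennreal \<bar>f \<omega> * g \<omega>\<bar> \<partial>M) \<le> ennreal (dual_norm X (pairing M X g))" .
  qed
  ultimately show "fnorm (kothe_dual M X) g \<le> dual_norm X (pairing M X g)"
    by (simp add: kothe_dual_def enn2real_leI)
qed

theorem top_dual_identified_kothe_dual: "top_dual_identified M X (kothe_dual M X)"
  unfolding top_dual_identified_def equivalent_norms_on_def
  using kothe_integrable(1) pairing_in_top_dual top_dual_representation pairing_inj dual_norm_pairing
  by (auto intro!: exI[of _ 1])

end

section \<open>Orlicz-Herz spaces\<close>

text \<open>
  The shells form a partition; this function gives the index of the shell that contains a point.
  It serves to glue functions that are given on the single shells.
\<close>

definition shell_index :: "real ^ 'n \<Rightarrow> int" where
  "shell_index \<omega> = (if norm \<omega> < 1 / 2 then - 1 else \<lfloor>log 2 (norm \<omega>)\<rfloor> + 1)"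

lemma shell_index_in_herz_index: "shell_index \<omega> \<in> herz_index"
proof (cases "norm \<omega> < 1 / 2")
  case False
  then have "- 1 \<le> log 2 (norm \<omega>)"
    by (subst le_log_iff) (auto simp: powr_minus)
  then have "- 1 \<le> \<lfloor>log 2 (norm \<omega>)\<rfloor>" by (simp add: le_floor_iff)
  with False show ?thesis by (simp add: shell_index_def herz_index_def)
qed (simp add: shell_index_def herz_index_def)

lemma mem_shell_iff:
  assumes k: "k \<in> herz_index"
  shows "\<omega> \<in> shell \<Omega> k \<longleftrightarrow> \<omega> \<in> \<Omega> \<and> shell_index \<omega> = k"
proof (cases "k = - 1")
  case True
  have "norm \<omega> < 1 / 2" if "shell_index \<omega> = - 1"
  proof (rule ccontr)
    assume *: "\<not> norm \<omega> < 1 / 2"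
    then have "- 1 \<le> log 2 (norm \<omega>)" by (subst le_log_iff) (auto simp: powr_minus)
    then have "- 1 \<le> \<lfloor>log 2 (norm \<omega>)\<rfloor>" by (simp add: le_floor_iff)
    with * that show False by (simp add: shell_index_def)
  qed
  with True show ?thesis by (auto simp: shell_def shell_index_def)
next
  case False
  with k have k0: "0 \<le> k" by (simp add: herz_index_def)
  have half: "1 / 2 \<le> (2::real) powi (k - 1)"
    using k0 power_int_increasing[of "- 1" "k - 1" "2::real"] by simp
  have iff: "2 powi (k - 1) \<le> norm \<omega> \<and> norm \<omega> < 2 powi k \<longleftrightarrow> \<lfloor>log 2 (norm \<omega>)\<rfloor> = k - 1"
    if "1 / 2 \<le> norm \<omega>"
  proof -
    have pos: "0 < norm \<omega>" using that by (rule less_le_trans[rotated]) simp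
    have powi: "(2::real) powi j = 2 powr of_int j" for j by (simp add: powr_real_of_int')
    show ?thesis
      unfolding powi le_log_iff[OF _ pos, symmetric, of 2, simplified] floor_eq_iff
      using pos by (simp add: le_log_iff log_less_iff)
  qed
  show ?thesis
    using False half iff k0 by (auto simp: shell_def shell_index_def)
qed

lemma shell_subset: "shell \<Omega> k \<subseteq> \<Omega>"
  by (auto simp: shell_def)

lemma shell_lmeasurable:
  assumes "\<Omega> \<in> sets lebesgue"
  shows "shell \<Omega> k \<in> lmeasurable"
proof -
  have "shell \<Omega> k = \<Omega> \<inter> (if k = - 1 then ball 0 (1 / 2) else ball 0 (2 powi k) - ball 0 (2 powi (k - 1)))"
    by (auto simp: shell_def)
  moreover have "(if k = - 1 then ball 0 (1 / 2) else ball 0 (2 powi k) - ball 0 (2 powi (k - 1))) \<in> sets borel"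
    by auto
  ultimately have "shell \<Omega> k \<in> sets lebesgue" using assms by (auto simp del: if_split)
  moreover have "shell \<Omega> k \<subseteq> ball 0 (max (1 / 2) (2 powi k))" by (auto simp: shell_def)
  then have "bounded (shell \<Omega> k)" using bounded_ball bounded_subset by blast
  ultimately show ?thesis by (intro bounded_set_imp_lmeasurable)
qed

locale orlicz_herz_space = convex_orlicz_function \<Phi>
  for \<Phi> :: "real \<Rightarrow> real" +
  fixes \<Omega> :: "(real ^ 'n) set" and a q q' :: real
  assumes \<Omega> [measurable]: "\<Omega> \<in> sets lebesgue"
    and q: "1 < q" and conjugate: "1 / q + 1 / q' = 1"
    and delta2: "delta2_large \<Phi>"
begin

lemma q': "1 < q'"
  using q conjugate by (rule conjugate_exponent_gt_1)

abbreviation M :: "(real ^ 'n) measure" where "M \<equiv> lebesgue_on \<Omega>"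
abbreviation S :: "int \<Rightarrow> (real ^ 'n) measure" where "S k \<equiv> lebesgue_on (shell \<Omega> k)"

abbreviation N :: "int \<Rightarrow> (real ^ 'n \<Rightarrow> real) \<Rightarrow> real" where
  "N k \<equiv> luxemburg_norm (S k) (ennreal \<circ> \<Phi>)"
abbreviation O' :: "int \<Rightarrow> (real ^ 'n \<Rightarrow> real) \<Rightarrow> real" where
  "O' k \<equiv> orlicz_norm_complementary (S k) \<Phi>"
abbreviation L :: "int \<Rightarrow> (real ^ 'n \<Rightarrow> real) set" where
  "L k \<equiv> elems (orlicz_space (S k) (ennreal \<circ> \<Phi>))"
abbreviation L' :: "int \<Rightarrow> (real ^ 'n \<Rightarrow> real) set" where
  "L' k \<equiv> elems (orlicz_space (S k) (complementary \<Phi>))"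

abbreviation E :: "int fspace" where "E \<equiv> weighted_lq q a"
abbreviation E' :: "int fspace" where "E' \<equiv> weighted_lq q' (- a)"
abbreviation HO :: "(real ^ 'n) fspace" where "HO \<equiv> orlicz_herz \<Omega> (ennreal \<circ> \<Phi>) a q"
abbreviation HO' :: "(real ^ 'n) fspace" where
  "HO' \<equiv> herz_type_space \<Omega> E' (\<lambda>k. complementary_orlicz_space (S k) \<Phi>)"

sublocale S: orlicz_finite_measure "S k" \<Phi> for k
proof -
  interpret finite_measure "S k" by (intro finite_measure_lebesgue_on shell_lmeasurable \<Omega>)
  show "orlicz_finite_measure (S k) \<Phi>" ..
qed

lemma shell_sets [measurable]: "shell \<Omega> k \<in> sets M"
  using shell_lmeasurable[OF \<Omega>, of k] shell_subset[of \<Omega> k] \<Omega>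
  by (auto simp: sets_restrict_space_iff)

lemma S_eq: "S k = restrict_space M (shell \<Omega> k)"
  using shell_lmeasurable[OF \<Omega>, of k] shell_subset[of \<Omega> k] \<Omega>
  by (subst restrict_restrict_space) (auto simp: Int_absorb1)

lemma measurable_S: "f \<in> borel_measurable M \<Longrightarrow> f \<in> borel_measurable (S k)"
  unfolding S_eq by (rule measurable_restrict_space1)

lemma AE_S: "AE \<omega> in M. P \<omega> \<Longrightarrow> AE \<omega> in S k. P \<omega>"
  unfolding S_eq by (subst AE_restrict_space_iff) (auto elim: eventually_mono)

lemma shell_index_S: "k \<in> herz_index \<Longrightarrow> \<omega> \<in> shell \<Omega> k \<Longrightarrow> shell_index \<omega> = k"
  by (simp add: mem_shell_iff)

sublocale sigma_finite_measure M
proof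
  have "\<Omega> \<subseteq> (\<Union>k\<in>herz_index. shell \<Omega> k)"
    using shell_index_in_herz_index by (auto simp: mem_shell_iff)
  then have "(\<Union>k\<in>herz_index. shell \<Omega> k) = \<Omega>" using shell_subset by blast
  moreover have "emeasure M (shell \<Omega> k) \<noteq> \<infinity>" for k
    using shell_lmeasurable[OF \<Omega>, of k] shell_subset[of \<Omega> k] \<Omega>
    by (subst emeasure_restrict_space) (auto simp: fmeasurable_def)
  ultimately show "\<exists>A. countable A \<and> A \<subseteq> sets M \<and> \<Union> A = space M \<and> (\<forall>a\<in>A. emeasure M a \<noteq> \<infinity>)"
    by (intro exI[of _ "shell \<Omega> ` herz_index"]) auto
qed

lemma measurable_glue:
  assumes "\<And>k. k \<in> herz_index \<Longrightarrow> \<phi> k \<in> borel_measurable (S k)"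
  shows "(\<lambda>\<omega>. \<phi> (shell_index \<omega>) \<omega>) \<in> borel_measurable M"
proof (rule measurable_piecewise_restrict[where C = "shell \<Omega> ` herz_index"])
  show "space M \<subseteq> \<Union> (shell \<Omega> ` herz_index)"
    using shell_index_in_herz_index by (auto simp: mem_shell_iff)
  fix A assume "A \<in> shell \<Omega> ` herz_index"
  then obtain k where k: "k \<in> herz_index" "A = shell \<Omega> k" by auto
  show "A \<inter> space M \<in> sets M" unfolding k(2) by (intro sets.Int shell_sets sets.top)
  have "(\<lambda>\<omega>. \<phi> (shell_index \<omega>) \<omega>) \<in> borel_measurable (S k) \<longleftrightarrow> \<phi> k \<in> borel_measurable (S k)"
    using k by (intro measurable_cong) (simp add: shell_index_S)
  then show "(\<lambda>\<omega>. \<phi> (shell_index \<omega>) \<omega>) \<in> borel_measurable (restrict_space M A)"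
    using assms k by (simp add: S_eq)
qed simp

lemma nn_integral_shells:
  assumes [measurable]: "f \<in> borel_measurable M"
  shows "(\<integral>\<^sup>+\<omega>. f \<omega> \<partial>M) = (\<integral>\<^sup>+k. (\<integral>\<^sup>+\<omega>. f \<omega> \<partial>S k) \<partial>count_space herz_index)"
proof -
  have "(\<integral>\<^sup>+\<omega>. f \<omega> \<partial>M) = (\<integral>\<^sup>+\<omega>. (\<integral>\<^sup>+k. f \<omega> * indicator (shell \<Omega> k) \<omega> \<partial>count_space herz_index) \<partial>M)"
  proof (rule nn_integral_cong)
    fix \<omega> assume "\<omega> \<in> space M"
    then show "f \<omega> = (\<integral>\<^sup>+k. f \<omega> * indicator (shell \<Omega> k) \<omega> \<partial>count_space herz_index)"
      using shell_index_in_herz_index[of \<omega>]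
      by (subst nn_integral_count_space'[of "{shell_index \<omega>}"]) (auto simp: mem_shell_iff indicator_def)
  qed
  also have "\<dots> = (\<integral>\<^sup>+k. (\<integral>\<^sup>+\<omega>. f \<omega> * indicator (shell \<Omega> k) \<omega> \<partial>M) \<partial>count_space herz_index)"
    by (rule nn_integral_count_space_nn_integral) auto
  also have "\<dots> = (\<integral>\<^sup>+k. (\<integral>\<^sup>+\<omega>. f \<omega> \<partial>S k) \<partial>count_space herz_index)"
    unfolding S_eq by (intro nn_integral_cong nn_integral_restrict_space[symmetric]) auto
  finally show ?thesis .
qed

text \<open>
  The measure on a shell does not see the values outside of the shell, so that the cut-off in the
  definition of the Herz-type spaces disappears.
\<close>

lemma indicator_S [simp]:
  "luxemburg_norm (S k) \<Psi> (\<lambda>\<omega>. f \<omega> * indicator (shell \<Omega> k) \<omega>) = luxemburg_norm (S k) \<Psi> f"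
  "(\<lambda>\<omega>. f \<omega> * indicator (shell \<Omega> k) \<omega>) \<in> elems (orlicz_space (S k) \<Psi>) \<longleftrightarrow> f \<in> elems (orlicz_space (S k) \<Psi>)"
  "orlicz_norm_complementary (S k) \<Phi> (\<lambda>\<omega>. f \<omega> * indicator (shell \<Omega> k) \<omega>) = orlicz_norm_complementary (S k) \<Phi> f"
  by (intro luxemburg_norm_cong orlicz_space_cong orlicz_norm_complementary_cong; simp)+

lemma elems_HO: "f \<in> elems HO \<longleftrightarrow>
    f \<in> borel_measurable M \<and> (\<forall>k\<in>herz_index. f \<in> L k) \<and> (\<lambda>k. N k f) \<in> elems E"
  and fnorm_HO: "fnorm HO f = fnorm E (\<lambda>k. N k f)"
  by (simp_all add: orlicz_herz_def herz_type_space_def fnorm_orlicz_space)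

lemma elems_HO': "g \<in> elems HO' \<longleftrightarrow>
    g \<in> borel_measurable M \<and> (\<forall>k\<in>herz_index. g \<in> L' k) \<and> (\<lambda>k. O' k g) \<in> elems E'"
  and fnorm_HO': "fnorm HO' g = fnorm E' (\<lambda>k. O' k g)"
  by (simp_all add: herz_type_space_def complementary_orlicz_space_def)

lemma elems_orlicz_herz_complementary: "elems (orlicz_herz \<Omega> (complementary \<Phi>) (- a) q') = elems HO'"
proof -
  let ?N = "\<lambda>k. luxemburg_norm (S k) (complementary \<Phi>)"
  have "g \<in> elems (orlicz_herz \<Omega> (complementary \<Phi>) (- a) q') \<longleftrightarrow>
      g \<in> borel_measurable M \<and> (\<forall>k\<in>herz_index. g \<in> L' k) \<and> (\<lambda>k. ?N k g) \<in> elems E'" for g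
    by (simp add: orlicz_herz_def herz_type_space_def fnorm_orlicz_space)
  moreover have "(\<lambda>k. ?N k g) \<in> elems E' \<longleftrightarrow> (\<lambda>k. O' k g) \<in> elems E'"
    if g: "\<forall>k\<in>herz_index. g \<in> L' k" for g
  proof
    have le: "\<bar>?N k g\<bar> \<le> 1 * \<bar>O' k g\<bar>" "\<bar>O' k g\<bar> \<le> 2 * \<bar>?N k g\<bar>" if "k \<in> herz_index" for k
      using g that S.luxemburg_le_orlicz_norm[of g k] orlicz_norm_le_luxemburg[of g "S k"]
        compl.luxemburg_norm_nonneg[of g "S k"] orlicz_norm_nonneg[of g "S k"] by auto
    show "(\<lambda>k. O' k g) \<in> elems E'" if "(\<lambda>k. ?N k g) \<in> elems E'"
      by (rule weighted_lq_mono(1)[OF _ _ that le(2)]) (use q' in auto)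
    show "(\<lambda>k. ?N k g) \<in> elems E'" if "(\<lambda>k. O' k g) \<in> elems E'"
      by (rule weighted_lq_mono(1)[OF _ _ that le(1)]) (use q' in auto)
  qed
  ultimately show ?thesis using elems_HO' by blast
qed

lemma elems_HO_mono:
  assumes g: "g \<in> elems HO" and f: "f \<in> borel_measurable M" and C: "0 \<le> C"
    and le: "AE \<omega> in M. \<bar>f \<omega>\<bar> \<le> C * \<bar>g \<omega>\<bar>"
  shows "f \<in> elems HO" and "fnorm HO f \<le> C * fnorm HO g"
proof -
  have gk: "g \<in> L k" if "k \<in> herz_index" for k using g that by (simp add: elems_HO)
  have fk: "f \<in> L k" and Nk: "N k f \<le> C * N k g" if k: "k \<in> herz_index" for k
  proof -
    have le': "AE \<omega> in S k. \<bar>f \<omega>\<bar> \<le> \<bar>C * g \<omega>\<bar>"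
      using AE_S[OF le] C by (simp add: abs_mult)
    note Cg = Phi.luxemburg_norm_cmult_le[OF gk[OF k], of C]
    show "f \<in> L k" by (rule Phi.orlicz_space_mono(1)[OF Cg(1) measurable_S[OF f] le'])
    have "N k f \<le> N k (\<lambda>\<omega>. C * g \<omega>)" by (rule Phi.orlicz_space_mono(2)[OF Cg(1) measurable_S[OF f] le'])
    with Cg(2) C show "N k f \<le> C * N k g" by simp
  qed
  have abs: "\<bar>N k f\<bar> \<le> C * \<bar>N k g\<bar>" if "k \<in> herz_index" for k
    using that Nk Phi.luxemburg_norm_nonneg[OF fk] Phi.luxemburg_norm_nonneg[OF gk] by simp
  show "f \<in> elems HO" "fnorm HO f \<le> C * fnorm HO g"
    using weighted_lq_mono[of q C "\<lambda>k. N k g" a "\<lambda>k. N k f"] abs q C f fk g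
    by (auto simp: elems_HO fnorm_HO)
qed

lemma add_HO:
  assumes f: "f \<in> elems HO" and g: "g \<in> elems HO"
  shows "(\<lambda>\<omega>. f \<omega> + g \<omega>) \<in> elems HO"
proof -
  have fk: "f \<in> L k" and gk: "g \<in> L k" if "k \<in> herz_index" for k
    using f g that by (auto simp: elems_HO)
  have "(\<lambda>k. N k f + N k g) \<in> elems E"
    using f g q by (intro weighted_lq_add) (auto simp: elems_HO)
  then have "(\<lambda>k. N k (\<lambda>\<omega>. f \<omega> + g \<omega>)) \<in> elems E"
  proof (rule weighted_lq_mono(1)[where C = 1, rotated 2])
    fix k assume k: "k \<in> herz_index"
    show "\<bar>N k (\<lambda>\<omega>. f \<omega> + g \<omega>)\<bar> \<le> 1 * \<bar>N k f + N k g\<bar>"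
      using luxemburg_norm_triangle[OF fk[OF k] gk[OF k]]
        Phi.luxemburg_norm_nonneg[OF luxemburg_norm_triangle(1)[OF fk[OF k] gk[OF k]]] by simp
  qed (use q in auto)
  then show ?thesis
    using f g luxemburg_norm_triangle(1)[OF fk gk] by (auto simp: elems_HO)
qed

lemma HO_dominated_convergence:
  assumes f: "f \<in> elems HO" and F: "\<And>n. F n \<in> borel_measurable M"
    and le: "\<And>n. AE \<omega> in M. \<bar>F n \<omega>\<bar> \<le> \<bar>f \<omega>\<bar>" and lim: "AE \<omega> in M. (\<lambda>n. F n \<omega>) \<longlonglongrightarrow> 0"
  shows "(\<lambda>n. fnorm HO (F n)) \<longlonglongrightarrow> 0"
  unfolding fnorm_HO
proof (rule weighted_lq_dominated_convergence[where y = "\<lambda>k. N k f"])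
  fix k assume k: "k \<in> herz_index"
  have fk: "f \<in> L k" using f k by (simp add: elems_HO)
  show "(\<lambda>n. N k (F n)) \<longlonglongrightarrow> 0"
    by (rule S.luxemburg_norm_dominated_convergence[OF delta2 fk measurable_S[OF F] AE_S[OF le] AE_S[OF lim]])
  fix n
  note mono = Phi.orlicz_space_mono[OF fk measurable_S[OF F[of n]] AE_S[OF le[of n]]]
  show "\<bar>N k (F n)\<bar> \<le> \<bar>N k f\<bar>"
    using mono(2) Phi.luxemburg_norm_nonneg[OF mono(1)] by simp
qed (use f q in \<open>auto simp: elems_HO\<close>)

text \<open>
  Take a constant on each shell, with the constants so small that the norms on the shells are
  dominated by a positive sequence in \<open>l\<^sub>q\<close>.
\<close>

lemma HO_weak_unit:
  obtains w :: "real ^ 'n \<Rightarrow> real" where "w \<in> elems HO" "\<And>\<omega>. 0 < w \<omega>"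
proof -
  obtain z where z: "z \<in> elems E" "\<And>k. 0 < z k"
    using weighted_lq_strictly_positive_elem[OF q] by blast
  have N1: "0 \<le> N k (\<lambda>_. 1)" for k by (rule Phi.luxemburg_norm_nonneg[OF S.const_in_orlicz_space])
  define c where "c k = z k / (1 + N k (\<lambda>_. 1))" for k
  have c: "0 < c k" for k unfolding c_def using z N1[of k] by (intro divide_pos_pos) auto
  define w :: "real ^ 'n \<Rightarrow> real" where "w = (\<lambda>\<omega>. c (shell_index \<omega>))"
  have w: "w \<omega> = c k" if "k \<in> herz_index" "\<omega> \<in> space (S k)" for k \<omega>
    using that by (simp add: w_def shell_index_S)
  have "w \<in> borel_measurable M" unfolding w_def by (rule measurable_glue) simp
  moreover have wL: "w \<in> L k" if "k \<in> herz_index" for k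
    by (subst orlicz_space_cong[OF w[OF that]]) (auto intro: S.const_in_orlicz_space)
  moreover have "(\<lambda>k. N k w) \<in> elems E"
  proof (rule weighted_lq_mono(1)[where C = 1, OF _ _ z(1)])
    fix k assume k: "k \<in> herz_index"
    have "N k w = N k (\<lambda>\<omega>. c k * 1)" by (rule luxemburg_norm_cong) (use w[OF k] in simp)
    also have "\<dots> \<le> \<bar>c k\<bar> * N k (\<lambda>_. 1)" by (rule Phi.luxemburg_norm_cmult_le(2)[OF S.const_in_orlicz_space])
    also have "\<dots> = z k * (N k (\<lambda>_. 1) / (1 + N k (\<lambda>_. 1)))"
      unfolding abs_of_pos[OF c] by (simp add: c_def)
    also have "\<dots> \<le> z k * 1" using z(2)[of k] N1[of k] by (intro mult_left_mono) auto
    finally show "\<bar>N k w\<bar> \<le> 1 * \<bar>z k\<bar>"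
      using Phi.luxemburg_norm_nonneg[OF wL[OF k]] z(2)[of k] by simp
  qed (use q in auto)
  ultimately have "w \<in> elems HO" by (simp add: elems_HO)
  then show thesis by (rule that) (simp add: w_def c)
qed

theorem HO_top_dual: "top_dual_identified M HO (kothe_dual M HO)"
proof -
  obtain w where w: "w \<in> elems HO" "\<And>\<omega>. 0 < w \<omega>" using HO_weak_unit by blast
  interpret X: order_continuous_function_space M HO w
  proof
    show "f \<in> borel_measurable M" if "f \<in> elems HO" for f using that by (simp add: elems_HO)
    show "0 \<le> fnorm HO f" for f by (simp add: fnorm_HO fnorm_weighted_lq_nonneg)
    show "fnorm HO (\<lambda>\<omega>. c * f \<omega>) \<le> \<bar>c\<bar> * fnorm HO f" if "f \<in> elems HO" for c f
      using that by (intro elems_HO_mono(2)) (auto simp: elems_HO abs_mult)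
    show "f \<in> elems HO" if "g \<in> elems HO" "f \<in> borel_measurable M" "AE \<omega> in M. \<bar>f \<omega>\<bar> \<le> C * \<bar>g \<omega>\<bar>" for f g C
    proof (rule elems_HO_mono(1)[OF that(1,2)])
      show "AE \<omega> in M. \<bar>f \<omega>\<bar> \<le> \<bar>C\<bar> * \<bar>g \<omega>\<bar>"
        using that(3) by eventually_elim (meson abs_ge_self abs_ge_zero mult_right_mono order_trans)
    qed simp
    show "fnorm HO f \<le> fnorm HO g" if "g \<in> elems HO" "f \<in> borel_measurable M" "AE \<omega> in M. \<bar>f \<omega>\<bar> \<le> \<bar>g \<omega>\<bar>" for f g
      using elems_HO_mono(2)[OF that(1,2), of 1] that(3) by simp
  qed (use w add_HO HO_dominated_convergence in auto)
  show ?thesis by (rule X.top_dual_identified_kothe_dual)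
qed

lemma HO_Holder:
  assumes f: "f \<in> elems HO" and g: "g \<in> elems HO'"
  shows "(\<integral>\<^sup>+\<omega>. ennreal \<bar>f \<omega> * g \<omega>\<bar> \<partial>M) \<le> ennreal (fnorm HO f * fnorm HO' g)"
proof -
  have [measurable]: "f \<in> borel_measurable M" "g \<in> borel_measurable M"
    using f g by (auto simp: elems_HO elems_HO')
  have fk: "f \<in> L k" and gk: "g \<in> L' k" if "k \<in> herz_index" for k
    using f g that by (auto simp: elems_HO elems_HO')
  have "(\<integral>\<^sup>+k. (\<integral>\<^sup>+\<omega>. ennreal \<bar>f \<omega> * g \<omega>\<bar> \<partial>S k) \<partial>count_space herz_index) \<le> ennreal (fnorm HO f * fnorm HO' g)"
  proof (rule nn_integral_count_space_le)
    fix F assume F: "finite F" "F \<subseteq> herz_index"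
    have nn: "0 \<le> N k f" "0 \<le> O' k g" if "k \<in> F" for k
      using that F Phi.luxemburg_norm_nonneg[OF fk] orlicz_norm_nonneg[OF gk] by auto
    have "(\<Sum>k\<in>F. \<integral>\<^sup>+\<omega>. ennreal \<bar>f \<omega> * g \<omega>\<bar> \<partial>S k) \<le> (\<Sum>k\<in>F. ennreal (\<bar>N k f\<bar> * \<bar>O' k g\<bar>))"
      using F nn orlicz_Holder[OF fk gk] by (intro sum_mono) auto
    also have "\<dots> = ennreal (\<Sum>k\<in>F. \<bar>N k f\<bar> * \<bar>O' k g\<bar>)" by (simp add: sum_ennreal)
    also have "\<dots> \<le> ennreal (fnorm HO f * fnorm HO' g)"
      unfolding fnorm_HO fnorm_HO' using f g F
      by (intro ennreal_leI weighted_lq_Holder[OF q q' conjugate]) (auto simp: elems_HO elems_HO')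
    finally show "(\<Sum>k\<in>F. \<integral>\<^sup>+\<omega>. ennreal \<bar>f \<omega> * g \<omega>\<bar> \<partial>S k) \<le> ennreal (fnorm HO f * fnorm HO' g)" .
  qed simp
  then show ?thesis by (subst nn_integral_shells) auto
qed

text \<open>
  Gluing the functions \<open>x\<^sub>k \<phi>\<^sub>k\<close> gives an element of the unit ball of \<open>HO\<close>, because the Luxemburg norm of
  \<open>\<phi>\<^sub>k\<close> is at most \<open>1\<close>.
\<close>

lemma sum_le_kothe_norm:
  assumes g [measurable]: "g \<in> borel_measurable M" and F: "finite F" "F \<subseteq> herz_index"
    and x: "\<And>k. 0 \<le> x k" "x \<in> elems E" "fnorm E x \<le> 1"
    and \<phi>: "\<And>k. k \<in> herz_index \<Longrightarrow> \<phi> k \<in> borel_measurable (S k)"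
      "\<And>k. k \<in> herz_index \<Longrightarrow> modular (S k) (ennreal \<circ> \<Phi>) (\<phi> k) \<le> 1"
  shows "(\<Sum>k\<in>F. ennreal (x k) * (\<integral>\<^sup>+\<omega>. ennreal \<bar>\<phi> k \<omega> * g \<omega>\<bar> \<partial>S k)) \<le> kothe_norm M HO g"
proof -
  define f where "f = (\<lambda>\<omega>. x (shell_index \<omega>) * \<phi> (shell_index \<omega>) \<omega>)"
  have f: "f \<omega> = x k * \<phi> k \<omega>" if "k \<in> herz_index" "\<omega> \<in> space (S k)" for k \<omega>
    using that by (simp add: f_def shell_index_S)
  have f_meas [measurable]: "f \<in> borel_measurable M"
    unfolding f_def by (rule measurable_glue[of "\<lambda>k \<omega>. x k * \<phi> k \<omega>"]) (use \<phi>(1) in measurable)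
  have \<phi>L: "\<phi> k \<in> L k" if "k \<in> herz_index" for k
    using \<phi>[OF that] unfolding Phi.orlicz_space_iff by (auto intro!: exI[of _ 1])
  have \<phi>N: "N k (\<phi> k) \<le> 1" if "k \<in> herz_index" for k
    using \<phi>[OF that] by (intro Phi.luxemburg_norm_le) auto
  have fL: "f \<in> L k" if "k \<in> herz_index" for k
    by (subst orlicz_space_cong[OF f[OF that]]) (auto intro: Phi.luxemburg_norm_cmult_le(1)[OF \<phi>L[OF that]])
  have fN: "\<bar>N k f\<bar> \<le> 1 * \<bar>x k\<bar>" if k: "k \<in> herz_index" for k
  proof -
    have "N k f = N k (\<lambda>\<omega>. x k * \<phi> k \<omega>)" by (rule luxemburg_norm_cong[OF f[OF k]])
    also have "\<dots> \<le> \<bar>x k\<bar> * N k (\<phi> k)" by (rule Phi.luxemburg_norm_cmult_le(2)[OF \<phi>L[OF k]])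
    also have "\<dots> \<le> \<bar>x k\<bar> * 1" using \<phi>N[OF k] by (intro mult_left_mono) auto
    finally show ?thesis using Phi.luxemburg_norm_nonneg[OF fL[OF k]] by simp
  qed
  have "f \<in> elems HO" "fnorm HO f \<le> 1"
    using weighted_lq_mono[of q 1 x a "\<lambda>k. N k f"] q x fN fL f_meas by (auto simp: elems_HO fnorm_HO)
  then have K: "(\<integral>\<^sup>+\<omega>. ennreal \<bar>f \<omega> * g \<omega>\<bar> \<partial>M) \<le> kothe_norm M HO g"
    unfolding kothe_norm_def by (intro SUP_upper) auto
  have "(\<Sum>k\<in>F. ennreal (x k) * (\<integral>\<^sup>+\<omega>. ennreal \<bar>\<phi> k \<omega> * g \<omega>\<bar> \<partial>S k)) =
      (\<Sum>k\<in>F. \<integral>\<^sup>+\<omega>. ennreal \<bar>f \<omega> * g \<omega>\<bar> \<partial>S k)"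
  proof (rule sum.cong[OF refl])
    fix k assume "k \<in> F"
    then have k: "k \<in> herz_index" using F by auto
    have [measurable]: "g \<in> borel_measurable (S k)" "\<phi> k \<in> borel_measurable (S k)"
      using g \<phi>(1)[OF k] by (auto intro: measurable_S)
    have "ennreal (x k) * (\<integral>\<^sup>+\<omega>. ennreal \<bar>\<phi> k \<omega> * g \<omega>\<bar> \<partial>S k) =
        (\<integral>\<^sup>+\<omega>. ennreal (x k) * ennreal \<bar>\<phi> k \<omega> * g \<omega>\<bar> \<partial>S k)"
      by (rule nn_integral_cmult[symmetric]) measurable
    also have "\<dots> = (\<integral>\<^sup>+\<omega>. ennreal \<bar>f \<omega> * g \<omega>\<bar> \<partial>S k)"
      using f[OF k] x(1)[of k] by (intro nn_integral_cong) (simp add: abs_mult mult.assoc flip: ennreal_mult)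
    finally show "ennreal (x k) * (\<integral>\<^sup>+\<omega>. ennreal \<bar>\<phi> k \<omega> * g \<omega>\<bar> \<partial>S k) = (\<integral>\<^sup>+\<omega>. ennreal \<bar>f \<omega> * g \<omega>\<bar> \<partial>S k)" .
  qed
  also have "\<dots> \<le> (\<integral>\<^sup>+k. (\<integral>\<^sup>+\<omega>. ennreal \<bar>f \<omega> * g \<omega>\<bar> \<partial>S k) \<partial>count_space herz_index)"
    using F by (rule nn_integral_count_space_ge_sum)
  also have "\<dots> = (\<integral>\<^sup>+\<omega>. ennreal \<bar>f \<omega> * g \<omega>\<bar> \<partial>M)" by (rule nn_integral_shells[symmetric]) measurable
  finally show ?thesis using K by (rule order_trans)
qed

text \<open>
  Test functions supported on a single shell show that \<open>g\<close> belongs to \<open>L\<^bsup>\<Phi>*\<^esup>\<close> there. Test functions that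
  nearly attain the Orlicz norm on finitely many shells then give the estimate of the norm.
\<close>

lemma kothe_dual_HO_subset:
  assumes g [measurable]: "g \<in> borel_measurable M" and fin: "kothe_norm M HO g < \<infinity>"
  shows "g \<in> elems HO'" and "fnorm HO' g \<le> enn2real (kothe_norm M HO g)"
proof -
  define C where "C = enn2real (kothe_norm M HO g)"
  have C: "kothe_norm M HO g = ennreal C" "0 \<le> C" using fin by (auto simp: C_def)
  have zero: "modular (S k) (ennreal \<circ> \<Phi>) (\<lambda>_. 0) \<le> 1" for k by (simp add: modular_def)
  have gk: "g \<in> L' k" if k: "k \<in> herz_index" for k
  proof (rule S.complementary_orlicz_spaceI(1)[OF measurable_S[OF g], of "weight a k * C"])
    fix f assume f: "f \<in> borel_measurable (S k)" "modular (S k) (ennreal \<circ> \<Phi>) f \<le> 1"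
    define x where "x j = (if j = k then 1 / weight a k else 0)" for j
    define \<phi> where "\<phi> j = (if j = k then f else (\<lambda>_. 0))" for j
    have "(\<Sum>j\<in>G. (weight a j * \<bar>x j\<bar>) powr q) \<le> 1 powr q" if "finite G" for G
    proof -
      have "(\<Sum>j\<in>G. (weight a j * \<bar>x j\<bar>) powr q) = (\<Sum>j\<in>G. if j = k then 1 else 0)"
        by (intro sum.cong) (auto simp: x_def)
      then show ?thesis using that by simp
    qed
    then have x: "x \<in> elems E" "fnorm E x \<le> 1" using weighted_lqI[of q 1 a x] q by auto
    have "(\<Sum>j\<in>{k}. ennreal (x j) * (\<integral>\<^sup>+\<omega>. ennreal \<bar>\<phi> j \<omega> * g \<omega>\<bar> \<partial>S j)) \<le> kothe_norm M HO g"
      by (rule sum_le_kothe_norm[OF g _ _ _ x]) (use k f zero in \<open>auto simp: x_def \<phi>_def\<close>)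
    then have "ennreal (1 / weight a k) * (\<integral>\<^sup>+\<omega>. ennreal \<bar>f \<omega> * g \<omega>\<bar> \<partial>S k) \<le> ennreal C"
      by (simp add: x_def \<phi>_def C)
    then have "ennreal (weight a k) * (ennreal (1 / weight a k) * (\<integral>\<^sup>+\<omega>. ennreal \<bar>f \<omega> * g \<omega>\<bar> \<partial>S k)) \<le>
        ennreal (weight a k) * ennreal C" by (rule mult_left_mono) simp
    then show "(\<integral>\<^sup>+\<omega>. ennreal \<bar>f \<omega> * g \<omega>\<bar> \<partial>S k) \<le> ennreal (weight a k * C)"
      using C by (simp add: ennreal_mult flip: mult.assoc) (simp flip: ennreal_mult)
  qed (use C in simp)
  have le: "(\<Sum>k\<in>F. x k * \<bar>O' k g\<bar>) \<le> C"
    if F: "finite F" "F \<subseteq> herz_index" and x: "\<And>k. 0 \<le> x k" "x \<in> elems E" "fnorm E x \<le> 1" for F x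
  proof (rule field_le_epsilon)
    fix e :: real assume "0 < e"
    define d where "d = e / (1 + sum x F)"
    have sx: "0 \<le> sum x F" using x(1) by (simp add: sum_nonneg)
    have d: "0 < d" "d * sum x F \<le> e" using \<open>0 < e\<close> sx by (auto simp: d_def field_simps)
    have "\<forall>k\<in>herz_index. \<exists>h. h \<in> borel_measurable (S k) \<and> modular (S k) (ennreal \<circ> \<Phi>) h \<le> 1 \<and>
        O' k g - d < (\<integral>\<omega>. g \<omega> * h \<omega> \<partial>S k)"
    proof
      fix k assume k: "k \<in> herz_index"
      let ?B = "{h \<in> borel_measurable (S k). modular (S k) (ennreal \<circ> \<Phi>) h \<le> 1}"
      have "?B \<noteq> {}" using zero[of k] by (auto intro!: exI[of _ "\<lambda>_. 0"])
      moreover have "O' k g - d < O' k g" using d by simp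
      ultimately obtain h where "h \<in> ?B" "O' k g - d < (\<integral>\<omega>. g \<omega> * h \<omega> \<partial>S k)"
        unfolding orlicz_norm_complementary_def[of _ _ g]
        using less_cSUP_iff[OF _ bdd_above_orlicz_norm[OF gk[OF k]]] by blast
      then show "\<exists>h. h \<in> borel_measurable (S k) \<and> modular (S k) (ennreal \<circ> \<Phi>) h \<le> 1 \<and>
        O' k g - d < (\<integral>\<omega>. g \<omega> * h \<omega> \<partial>S k)" by (intro exI[of _ h]) auto
    qed
    from bchoice[OF this] obtain \<phi> where "\<forall>k\<in>herz_index. \<phi> k \<in> borel_measurable (S k) \<and>
        modular (S k) (ennreal \<circ> \<Phi>) (\<phi> k) \<le> 1 \<and> O' k g - d < (\<integral>\<omega>. g \<omega> * \<phi> k \<omega> \<partial>S k)" ..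
    then have \<phi>: "\<And>k. k \<in> herz_index \<Longrightarrow> \<phi> k \<in> borel_measurable (S k)"
        "\<And>k. k \<in> herz_index \<Longrightarrow> modular (S k) (ennreal \<circ> \<Phi>) (\<phi> k) \<le> 1"
        "\<And>k. k \<in> herz_index \<Longrightarrow> O' k g - d < (\<integral>\<omega>. g \<omega> * \<phi> k \<omega> \<partial>S k)"
      by blast+
    define r where "r k = (\<integral>\<omega>. \<bar>g \<omega> * \<phi> k \<omega>\<bar> \<partial>S k)" for k
    have r: "0 \<le> r k" "(\<integral>\<^sup>+\<omega>. ennreal \<bar>\<phi> k \<omega> * g \<omega>\<bar> \<partial>S k) = ennreal (r k)" "O' k g - d \<le> r k"
      if k: "k \<in> herz_index" for k
    proof -
      have int: "integrable (S k) (\<lambda>\<omega>. g \<omega> * \<phi> k \<omega>)"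
        by (rule orlicz_norm_bdd(1)[OF gk[OF k] \<phi>(1,2)[OF k]])
      show "0 \<le> r k" by (simp add: r_def)
      show "(\<integral>\<^sup>+\<omega>. ennreal \<bar>\<phi> k \<omega> * g \<omega>\<bar> \<partial>S k) = ennreal (r k)"
        unfolding r_def using int by (subst nn_integral_eq_integral[symmetric]) (auto simp: mult.commute)
      have "(\<integral>\<omega>. g \<omega> * \<phi> k \<omega> \<partial>S k) \<le> r k"
        unfolding r_def using int by (intro integral_mono) auto
      then show "O' k g - d \<le> r k" using \<phi>(3)[OF k] by simp
    qed
    have "ennreal (\<Sum>k\<in>F. x k * r k) = (\<Sum>k\<in>F. ennreal (x k) * (\<integral>\<^sup>+\<omega>. ennreal \<bar>\<phi> k \<omega> * g \<omega>\<bar> \<partial>S k))"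
      using F r x(1) by (subst sum_ennreal[symmetric]) (auto simp: ennreal_mult intro!: sum.cong mult_nonneg_nonneg)
    also have "\<dots> \<le> ennreal C"
      using sum_le_kothe_norm[OF g F x \<phi>(1,2)] by (simp add: C)
    finally have xr: "(\<Sum>k\<in>F. x k * r k) \<le> C" using C by simp
    have "(\<Sum>k\<in>F. x k * \<bar>O' k g\<bar>) \<le> (\<Sum>k\<in>F. x k * r k + d * x k)"
    proof (rule sum_mono)
      fix k assume "k \<in> F"
      then have k: "k \<in> herz_index" using F by auto
      have "x k * \<bar>O' k g\<bar> \<le> x k * (r k + d)"
        using r(3)[OF k] x(1)[of k] orlicz_norm_nonneg[OF gk[OF k]] by (intro mult_left_mono) auto
      then show "x k * \<bar>O' k g\<bar> \<le> x k * r k + d * x k" by (simp add: algebra_simps)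
    qed
    also have "\<dots> = (\<Sum>k\<in>F. x k * r k) + d * sum x F" by (simp add: sum.distrib sum_distrib_left)
    also have "\<dots> \<le> C + e" using xr d by simp
    finally show "(\<Sum>k\<in>F. x k * \<bar>O' k g\<bar>) \<le> C + e" .
  qed
  have "(\<lambda>k. O' k g) \<in> elems E'" "fnorm E' (\<lambda>k. O' k g) \<le> C"
    using weighted_lq_Holder_converse[OF q q' conjugate C(2), of a "\<lambda>k. O' k g"] le by auto
  then show "g \<in> elems HO'" "fnorm HO' g \<le> enn2real (kothe_norm M HO g)"
    using gk g by (auto simp: elems_HO' fnorm_HO' C_def)
qed

theorem kothe_dual_HO: "eq_equal_norms (kothe_dual M HO) HO'"
proof -
  have le: "kothe_norm M HO g \<le> ennreal (fnorm HO' g)" if g: "g \<in> elems HO'" for g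
    unfolding kothe_norm_def
  proof (rule SUP_least)
    fix f assume f: "f \<in> {f \<in> elems HO. fnorm HO f \<le> 1}"
    have "0 \<le> fnorm HO' g" by (simp add: fnorm_HO' fnorm_weighted_lq_nonneg)
    then have "fnorm HO f * fnorm HO' g \<le> 1 * fnorm HO' g" using f by (intro mult_right_mono) auto
    then have "ennreal (fnorm HO f * fnorm HO' g) \<le> ennreal (fnorm HO' g)" by (intro ennreal_leI) simp
    with HO_Holder[OF _ g, of f] f
    show "(\<integral>\<^sup>+\<omega>. ennreal \<bar>f \<omega> * g \<omega>\<bar> \<partial>M) \<le> ennreal (fnorm HO' g)" by (blast intro: order_trans)
  qed
  have fin: "kothe_norm M HO g < \<infinity>" if "g \<in> elems HO'" for g
    using le[OF that] by (rule le_less_trans) simp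
  have "elems (kothe_dual M HO) = elems HO'"
  proof (intro set_eqI iffI)
    fix g assume "g \<in> elems (kothe_dual M HO)"
    then have "g \<in> borel_measurable M" "kothe_norm M HO g < \<infinity>" by (simp_all add: kothe_dual_def)
    then show "g \<in> elems HO'" by (rule kothe_dual_HO_subset(1))
  next
    fix g assume g: "g \<in> elems HO'"
    then have "g \<in> borel_measurable M" by (simp add: elems_HO')
    with fin[OF g] show "g \<in> elems (kothe_dual M HO)" by (simp add: kothe_dual_def)
  qed
  moreover have "enn2real (kothe_norm M HO g) = fnorm HO' g" if g: "g \<in> elems HO'" for g
  proof (rule antisym)
    show "enn2real (kothe_norm M HO g) \<le> fnorm HO' g"
      using le[OF g] by (intro enn2real_leI) (auto simp: fnorm_HO' fnorm_weighted_lq_nonneg)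
    show "fnorm HO' g \<le> enn2real (kothe_norm M HO g)"
      using g by (intro kothe_dual_HO_subset(2) fin) (simp add: elems_HO')
  qed
  ultimately show ?thesis by (simp add: eq_equal_norms_def kothe_dual_def)
qed

end

section \<open>Duality of Orlicz-Herz spaces\<close>

theorem corollaryA3:
  fixes \<Omega> :: "(real ^ 'n) set" and a q q' :: real and \<Phi> :: "real \<Rightarrow> real"
  defines "HO \<equiv> orlicz_herz \<Omega> (ennreal \<circ> \<Phi>) a q"
    and "HO_compl \<equiv> orlicz_herz \<Omega> (complementary \<Phi>) (- a) q'"
    and "E \<equiv> weighted_lq q a"
    and "E' \<equiv> weighted_lq q' (- a)"
    and "X \<equiv> (\<lambda>k. orlicz_space (lebesgue_on (shell \<Omega> k)) (ennreal \<circ> \<Phi>))"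
    and "X' \<equiv> (\<lambda>k. complementary_orlicz_space (lebesgue_on (shell \<Omega> k)) \<Phi>)"
  assumes "\<Omega> \<in> sets lebesgue"
    and "1 < q" and "1 / q + 1 / q' = 1"
    and "orlicz_function \<Phi>" and "convex_on {0..} \<Phi>"
    and "delta2_suitable (lebesgue_on \<Omega>) \<Phi>"
    and "\<forall>k\<in>herz_index. \<exists>f\<in>elems (X k). \<not> (AE \<omega> in lebesgue_on (shell \<Omega> k). f \<omega> = 0)"
  shows "eq_equal_norms (kothe_dual (count_space herz_index) E) E' \<and>
    top_dual_identified (lebesgue_on \<Omega>) HO (kothe_dual (lebesgue_on \<Omega>) HO) \<and>
    elems HO_compl = elems (herz_type_space \<Omega> E' X') \<and>
    eq_equivalent_norms (kothe_dual (lebesgue_on \<Omega>) HO)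
      (HO_compl \<lparr> fnorm := fnorm (herz_type_space \<Omega> E' X') \<rparr>) \<and>
    (\<forall>f\<in>elems (herz_type_space \<Omega> E X). \<forall>g\<in>elems (herz_type_space \<Omega> E' X').
       integrable (lebesgue_on \<Omega>) (\<lambda>\<omega>. f \<omega> * g \<omega>) \<and>
       (\<integral>\<omega>. \<bar>f \<omega> * g \<omega>\<bar> \<partial>lebesgue_on \<Omega>)
         \<le> fnorm (herz_type_space \<Omega> E X) f * fnorm (herz_type_space \<Omega> E' X') g)"
proof -
  have d2: "delta2_large \<Phi>"
  proof (cases "emeasure (lebesgue_on \<Omega>) (space (lebesgue_on \<Omega>)) = \<infinity>")
    case True
    then obtain K where "\<forall>u\<ge>0. \<Phi> (2 * u) \<le> K * \<Phi> u"
      using assms(12) by (auto simp: delta2_suitable_def delta2_all_def)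
    then show ?thesis unfolding delta2_large_def by (intro exI[of _ K] exI[of _ 0]) auto
  next
    case False
    then show ?thesis using assms(12) unfolding delta2_suitable_def by simp
  qed
  interpret H: orlicz_herz_space \<Phi> \<Omega> a q q'
    using assms(7-11) d2 by unfold_locales
  have HO: "herz_type_space \<Omega> E X = HO" by (simp add: HO_def E_def X_def orlicz_herz_def)
  have HO': "herz_type_space \<Omega> E' X' = H.HO'" by (simp add: E'_def X'_def)
  have kothe: "eq_equal_norms (kothe_dual (lebesgue_on \<Omega>) HO) H.HO'"
    unfolding HO_def by (rule H.kothe_dual_HO)
  have compl: "elems HO_compl = elems H.HO'"
    unfolding HO_compl_def by (rule H.elems_orlicz_herz_complementary)
  have "eq_equivalent_norms (kothe_dual (lebesgue_on \<Omega>) HO) (HO_compl \<lparr> fnorm := fnorm H.HO' \<rparr>)"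
    using kothe compl
    by (auto simp: eq_equal_norms_def eq_equivalent_norms_def equivalent_norms_on_def intro!: exI[of _ 1])
  moreover have "integrable (lebesgue_on \<Omega>) (\<lambda>\<omega>. f \<omega> * g \<omega>) \<and>
      (\<integral>\<omega>. \<bar>f \<omega> * g \<omega>\<bar> \<partial>lebesgue_on \<Omega>) \<le> fnorm HO f * fnorm H.HO' g"
    if f: "f \<in> elems HO" and g: "g \<in> elems H.HO'" for f g
  proof -
    have [measurable]: "f \<in> borel_measurable (lebesgue_on \<Omega>)" "g \<in> borel_measurable (lebesgue_on \<Omega>)"
      using f g by (auto simp: HO_def H.elems_HO H.elems_HO')
    have le: "(\<integral>\<^sup>+\<omega>. ennreal \<bar>f \<omega> * g \<omega>\<bar> \<partial>lebesgue_on \<Omega>) \<le> ennreal (fnorm HO f * fnorm H.HO' g)"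
      using H.HO_Holder[OF _ g] f by (simp add: HO_def)
    have nn: "0 \<le> fnorm HO f * fnorm H.HO' g"
      unfolding HO_def H.fnorm_HO H.fnorm_HO' by (simp add: fnorm_weighted_lq_nonneg)
    have "integrable (lebesgue_on \<Omega>) (\<lambda>\<omega>. f \<omega> * g \<omega>)"
      unfolding integrable_iff_bounded using le by (auto intro: le_less_trans[OF _ ennreal_less_top])
    moreover have "(\<integral>\<omega>. \<bar>f \<omega> * g \<omega>\<bar> \<partial>lebesgue_on \<Omega>) \<le> fnorm HO f * fnorm H.HO' g"
      using le nn by (subst integral_eq_nn_integral) (auto intro: enn2real_leI)
    ultimately show ?thesis ..
  qed
  ultimately show ?thesis
    using kothe_dual_weighted_lq[OF H.q H.q' H.conjugate, of a] H.HO_top_dual compl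
    unfolding HO HO' by (simp add: HO_def E_def E'_def)
qed

end
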